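(* Let $h:[0,\infty)\to[0,\infty)$ be continuous, nondecreasing, with $h(s)=0$ only for $s=0$. Assume that $r\mapsto rh(r)$ is convex on $[0,\infty)$ and that $h$ satisfies the Keller–Osserman condition $$\int_a^\infty\frac{ds}{\sqrt{H(s)}}<\infty\ \text{ for some } a>0,\qquad H(s)=\int_0^s t\,h(t)\,dt .$$ Let $g\in C(\mathbb{R}^N)$, $g\ge 0$. Then the prospective minimal solution $\underline u_g$ (defined in the context) is the minimal nonnegative solution of $$\partial_t u-\Delta u+uh(u)=0 \text{ in } (0,\infty)\times\mathbb{R}^N,\qquad \lim_{t\to0}u(t,\cdot)=g \text{ locally uniformly in } \mathbb{R}^N .$$ Furthermore, $\underline u_g$ is the unique nonnegative solution of this problem.
   Context: For a bounded nonnegative initial datum the problem $\partial_t u-\Delta u+uh(u)=0$ in $(0,\infty)\times\mathbb{R}^N$ with given initial value has a unique bounded nonnegative (weak) solution. For $n\in\mathbb{N}$ let $B_n$ be the open ball of radius $n$ centered at $0$ and let $u_{g_n}$ be the solution of $\partial_t u-\Delta u+uh(u)=0$ in $(0,\infty)\times\mathbb{R}^N$ with $\lim_{t\to0}u(t,\cdot)=g\chi_{B_n}$ in $L^1(\mathbb{R}^N)$ ($\chi_{B_n}$ the characteristic function of $B_n$). The sequence $(u_{g_n})$ is nondecreasing in $n$, and its limit $\underline u_g=\lim_{n\to\infty}u_{g_n}$ is called the prospective minimal solution with initial datum $g$. A solution of the problem with initial datum $g$ means a nonnegative continuous weak solution of the equation in $(0,\infty)\times\mathbb{R}^N$ with $u(t,\cdot)\to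 g$ locally uniformly as $t\to0$. *)

theory Defs
  imports "HOL-Analysis.Analysis"
begin

definition test_fun ::
  "(real \<times> 'a::euclidean_space \<Rightarrow> real) \<Rightarrow> (real \<times> 'a \<Rightarrow> (real \<times> 'a) \<Rightarrow>\<^sub>L real)
     \<Rightarrow> (real \<times> 'a \<Rightarrow> (real \<times> 'a) \<Rightarrow>\<^sub>L ((real \<times> 'a) \<Rightarrow>\<^sub>L real)) \<Rightarrow> bool" where
  "test_fun \<phi> D D2 \<longleftrightarrow>
     (\<forall>z. (\<phi> has_derivative blinfun_apply (D z)) (at z)) \<and>
     (\<forall>z. (D has_derivative blinfun_apply (D2 z)) (at z)) \<and>
     continuous_on UNIV D2 \<and>
     (\<exists>K. compact K \<and> K \<subseteq> {z. fst z > 0} \<and> (\<forall>z. z \<notin> K \<longrightarrow> \<phi> z = 0))"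

definition dt_test :: "(real \<times> 'a::euclidean_space \<Rightarrow> (real \<times> 'a) \<Rightarrow>\<^sub>L real) \<Rightarrow> real \<times> 'a \<Rightarrow> real" where
  "dt_test D z = blinfun_apply (D z) (1, 0)"

definition lap_test ::
  "(real \<times> 'a::euclidean_space \<Rightarrow> (real \<times> 'a) \<Rightarrow>\<^sub>L ((real \<times> 'a) \<Rightarrow>\<^sub>L real)) \<Rightarrow> real \<times> 'a \<Rightarrow> real" where
  "lap_test D2 z = (\<Sum>b\<in>Basis. blinfun_apply (blinfun_apply (D2 z) (0, b)) (0, b))"

definition weak_sol :: "(real \<Rightarrow> real) \<Rightarrow> (real \<Rightarrow> 'a::euclidean_space \<Rightarrow> real) \<Rightarrow> bool" where
  "weak_sol h u \<longleftrightarrow>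
     continuous_on ({0<..} \<times> UNIV) (\<lambda>(t,x). u t x) \<and>
     (\<forall>t>0. \<forall>x. u t x \<ge> 0) \<and>
     (\<forall>\<phi> D D2. test_fun \<phi> D D2 \<longrightarrow>
        ((\<lambda>(t,x). u t x * (- dt_test D (t,x) - lap_test D2 (t,x)) + u t x * h (u t x) * \<phi> (t,x))
           has_integral 0) UNIV)"

definition is_solution :: "(real \<Rightarrow> real) \<Rightarrow> ('a::euclidean_space \<Rightarrow> real) \<Rightarrow> (real \<Rightarrow> 'a \<Rightarrow> real) \<Rightarrow> bool" where
  "is_solution h g u \<longleftrightarrow> weak_sol h u \<and>
     (\<forall>K. compact K \<longrightarrow> (\<forall>e>0. \<exists>d>0. \<forall>t. 0 < t \<and> t < d \<longrightarrow> (\<forall>x\<in>K. \<bar>u t x - g x\<bar> < e)))"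

definition bounded_L1_solution :: "(real \<Rightarrow> real) \<Rightarrow> ('a::euclidean_space \<Rightarrow> real) \<Rightarrow> (real \<Rightarrow> 'a \<Rightarrow> real) \<Rightarrow> bool" where
  "bounded_L1_solution h g0 u \<longleftrightarrow> weak_sol h u \<and>
     (\<exists>M. \<forall>t>0. \<forall>x. u t x \<le> M) \<and>
     ((\<lambda>t. \<integral>\<^sup>+ x. ennreal \<bar>u t x - g0 x\<bar> \<partial>lborel) \<longlongrightarrow> 0) (at_right 0)"

text \<open>u_{g_n}: the (unique) bounded solution with initial datum g chi_{B_n}; normalized to 0 for t <= 0.\<close>
definition u_gn :: "(real \<Rightarrow> real) \<Rightarrow> ('a::euclidean_space \<Rightarrow> real) \<Rightarrow> nat \<Rightarrow> real \<Rightarrow> 'a \<Rightarrow> real" where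
  "u_gn h g n = (THE u. bounded_L1_solution h (\<lambda>x. if x \<in> ball 0 (real n) then g x else 0) u
                        \<and> (\<forall>t x. t \<le> 0 \<longrightarrow> u t x = 0))"

definition prospective_min :: "(real \<Rightarrow> real) \<Rightarrow> ('a::euclidean_space \<Rightarrow> real) \<Rightarrow> real \<Rightarrow> 'a \<Rightarrow> real" where
  "prospective_min h g t x = lim (\<lambda>n. u_gn h g n t x)"

definition Hprim :: "(real \<Rightarrow> real) \<Rightarrow> real \<Rightarrow> real" where
  "Hprim h s = integral {0..s} (\<lambda>t. t * h t)"

end

theory Submission
  imports Defs
begin

text \<open>
  Put \<open>f r = r h r\<close>. Since \<open>h\<close> is nondecreasing, \<open>f\<close> is superadditive, so the difference \<open>W\<close> of two
  solutions satisfies \<open>\<partial>\<^sub>t W - \<Delta> W \<le> - f W\<close> wherever \<open>W \<ge> 0\<close>. The Keller--Osserman condition provides a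
  function \<open>p\<close> of one variable with \<open>p'' = f p\<close> that blows up at 0 and vanishes at infinity; by
  superadditivity again, the sum of its values at the distances to the faces of a cube of half-width
  \<open>R\<close> is a stationary supersolution, infinite on the boundary of the cube and tending to 0 locally
  uniformly as \<open>R \<rightarrow> \<infinity>\<close>. The maximum principle, applied to mollifications of \<open>W\<close>, shows that two
  solutions with the same data near the cube differ inside it by at most this barrier, at all times
  and without any growth condition. That estimate makes \<open>u\<^bsub>g\<^sub>n\<^esub>\<close> unique, nondecreasing in \<open>n\<close> and locally
  uniformly Cauchy, and it gives minimality and uniqueness of the limit. The \<open>u\<^bsub>g\<^sub>n\<^esub>\<close> themselves come
  from a monotone iteration of Duhamel's formula, whose weak form follows by duality from the
  representation of test functions by the heat kernel.
\<close>

section \<open>The Keller--Osserman barrier\<close>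

text \<open>Solutions are only continuous, carry no growth bound, and take their data in two
  different senses: in \<open>L^1\<close> for the truncated problems, locally uniformly for the
  limit problem. Comparison is therefore phrased through the local \<open>L^1\<close> size of the
  positive part of \<open>u - v\<close> as time tends to 0, which both senses control. Such
  smallness gives no pointwise bound at a small time \<open>\<tau>\<close>, so the heat solution
  started from a cut-off of that positive part is added to the barrier; at time \<open>t\<close> it
  is at most a constant times \<open>(t - \<tau>)\<close> to the power \<open>-N/2\<close> times the
  \<open>L^1\<close> norm, and so disappears as \<open>\<tau>\<close> tends to 0. Cubes replace
  balls because a sum of functions of one coordinate each has no first-order radial term in its
  Laplacian. For existence, convexity supplies a Lipschitz constant \<open>L\<close> of
  \<open>f\<close> on bounded intervals. Adding \<open>L u\<close> to both sides of the equation has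
  a second benefit besides monotonicity: the fundamental solution gets the finite mass
  \<open>1 / L\<close>, so that Fubini and dominated convergence apply to merely bounded
  functions.\<close>

definition cube :: "real \<Rightarrow> 'a::euclidean_space set" where
  "cube R = {x. \<forall>b\<in>Basis. \<bar>x \<bullet> b\<bar> < R}"

text \<open>A pointwise notion along one line: the first derivative exists near the point, the
  second only at it. This is all that a second derivative test at a maximum uses, and it suits the
  barrier, mollifications and heat extensions alike, without total derivatives.\<close>

definition has_second_dir_deriv :: "('a::real_normed_vector \<Rightarrow> real) \<Rightarrow> 'a \<Rightarrow> 'a \<Rightarrow> real \<Rightarrow> bool" where
  "has_second_dir_deriv Z x e d \<longleftrightarrow> (\<exists>D. (\<forall>\<^sub>F s in nhds 0. ((\<lambda>s. Z (x + s *\<^sub>R e)) has_real_derivative D s) (at s))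
     \<and> (D has_real_derivative d) (at 0))"

lemma has_second_dir_deriv_add:
  assumes "has_second_dir_deriv Y x e c" "has_second_dir_deriv Z x e d"
  shows "has_second_dir_deriv (\<lambda>x. Y x + Z x) x e (c + d)"
proof -
  from assms obtain C D where CD:
    "\<forall>\<^sub>F s in nhds 0. ((\<lambda>s. Y (x + s *\<^sub>R e)) has_real_derivative C s) (at s)" "(C has_real_derivative c) (at 0)"
    "\<forall>\<^sub>F s in nhds 0. ((\<lambda>s. Z (x + s *\<^sub>R e)) has_real_derivative D s) (at s)" "(D has_real_derivative d) (at 0)"
    unfolding has_second_dir_deriv_def by fast
  have "\<forall>\<^sub>F s in nhds 0. ((\<lambda>s. Y (x + s *\<^sub>R e) + Z (x + s *\<^sub>R e)) has_real_derivative C s + D s) (at s)"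
    using CD(1,3) by eventually_elim (rule DERIV_add)
  with DERIV_add[OF CD(2,4)] show ?thesis unfolding has_second_dir_deriv_def
    by (intro exI[of _ "\<lambda>s. C s + D s"] conjI)
qed

lemma has_second_dir_deriv_minus:
  assumes "has_second_dir_deriv Y x e c"
  shows "has_second_dir_deriv (\<lambda>x. - Y x) x e (- c)"
proof -
  obtain C where C:
    "\<forall>\<^sub>F s in nhds 0. ((\<lambda>s. Y (x + s *\<^sub>R e)) has_real_derivative C s) (at s)" "(C has_real_derivative c) (at 0)"
    using assms unfolding has_second_dir_deriv_def by blast
  have "\<forall>\<^sub>F s in nhds 0. ((\<lambda>s. - Y (x + s *\<^sub>R e)) has_real_derivative - C s) (at s)"
    using C(1) by eventually_elim (rule DERIV_minus)
  with DERIV_minus[OF C(2)] show ?thesis unfolding has_second_dir_deriv_def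
    by (intro exI[of _ "\<lambda>s. - C s"] conjI)
qed

lemma has_second_dir_deriv_const: "has_second_dir_deriv (\<lambda>x. c) x e 0"
  unfolding has_second_dir_deriv_def by (intro exI[of _ "\<lambda>s. 0"]) auto

lemma has_second_dir_deriv_sum:
  assumes "finite A" "\<And>i. i \<in> A \<Longrightarrow> has_second_dir_deriv (Z i) x e (d i)"
  shows "has_second_dir_deriv (\<lambda>x. \<Sum>i\<in>A. Z i x) x e (\<Sum>i\<in>A. d i)"
  using assms
proof (induction A rule: finite_induct)
  case (insert i A)
  then have "has_second_dir_deriv (\<lambda>x. Z i x + (\<Sum>i\<in>A. Z i x)) x e (d i + (\<Sum>i\<in>A. d i))"
    by (intro has_second_dir_deriv_add) auto
  then show ?case using insert by simp
qed (simp add: has_second_dir_deriv_const)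

text \<open>The first derivative vanishes at the maximum; if its slope there were positive, it would
  be positive just to the right and the function would increase strictly.\<close>

lemma second_dir_deriv_nonpos_at_max:
  assumes Z: "has_second_dir_deriv Z x e d" and max: "\<forall>\<^sub>F s in nhds 0. Z (x + s *\<^sub>R e) \<le> Z x"
  shows "d \<le> 0"
proof (rule ccontr)
  assume "\<not> d \<le> 0"
  then have d: "0 < d" by simp
  define \<zeta> where "\<zeta> s = Z (x + s *\<^sub>R e)" for s
  from Z obtain D where D: "\<forall>\<^sub>F s in nhds 0. (\<zeta> has_real_derivative D s) (at s)"
    and D': "(D has_real_derivative d) (at 0)"
    unfolding has_second_dir_deriv_def \<zeta>_def by fast
  from max have "\<forall>\<^sub>F s in nhds 0. \<zeta> s \<le> \<zeta> 0" by (simp add: \<zeta>_def)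
  from eventually_conj[OF D this] obtain r where r: "0 < r" and
    *: "\<And>s. dist s 0 < r \<Longrightarrow> (\<zeta> has_real_derivative D s) (at s) \<and> \<zeta> s \<le> \<zeta> 0"
    unfolding eventually_nhds_metric by blast
  then have rD: "\<And>s. \<bar>s\<bar> < r \<Longrightarrow> (\<zeta> has_real_derivative D s) (at s)" and
    rmax: "\<And>s. \<bar>s\<bar> < r \<Longrightarrow> \<zeta> s \<le> \<zeta> 0"
    by (simp_all add: dist_real_def)
  have "D 0 = 0"
    by (rule DERIV_local_max[of \<zeta> _ 0 r]) (use r rD[of 0] rmax in auto)
  then obtain r' where r': "0 < r'" "\<And>s. 0 < s \<Longrightarrow> s < r' \<Longrightarrow> 0 < D s"
    using DERIV_pos_inc_right[OF D' d] by auto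
  define s where "s = min r r' / 2"
  have s: "0 < s" "s < r" "s < r'" using r r' by (auto simp: s_def)
  have "\<zeta> 0 < \<zeta> s"
  proof (rule DERIV_pos_imp_increasing_open[OF s(1)])
    fix y assume y: "0 < y" "y < s"
    then have "(\<zeta> has_real_derivative D y) (at y)" "0 < D y" using rD[of y] r'(2)[of y] s by simp_all
    then show "\<exists>l. (\<zeta> has_real_derivative l) (at y) \<and> 0 < l" by blast
  next
    have "isCont \<zeta> y" if "y \<in> {0..s}" for y using DERIV_isCont[OF rD[of y]] that s by simp
    then show "continuous_on {0..s} \<zeta>" by (simp add: continuous_at_imp_continuous_on)
  qed
  then show False using rmax[of s] s by simp
qed

section \<open>The absorption term and its primitive\<close>

locale absorption =
  fixes h :: "real \<Rightarrow> real"
  assumes h_cont: "continuous_on {0..} h"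
    and h_nonneg: "\<forall>s\<ge>0. h s \<ge> 0"
    and h_mono: "mono_on {0..} h"
    and h_zero: "\<forall>s\<ge>0. h s = 0 \<longleftrightarrow> s = 0"
    and h_convex: "convex_on {0..} (\<lambda>r. r * h r)"
begin

definition f :: "real \<Rightarrow> real" where "f r = r * h r"

lemma f_0 [simp]: "f 0 = 0"
  by (simp add: f_def)

lemma f_nonneg: "0 \<le> r \<Longrightarrow> 0 \<le> f r"
  using h_nonneg by (simp add: f_def)

lemma f_pos: "0 < r \<Longrightarrow> 0 < f r"
  using h_nonneg h_zero by (metis f_def less_eq_real_def mult_pos_pos)

lemma f_cont: "continuous_on {0..} f"
  unfolding f_def by (intro continuous_intros h_cont)

lemma f_superadditive:
  assumes "0 \<le> a" "0 \<le> b" shows "f a + f b \<le> f (a + b)"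
proof -
  have "h a \<le> h (a + b)" "h b \<le> h (a + b)"
    using assms by (auto intro!: mono_onD[OF h_mono])
  then have "a * h a \<le> a * h (a + b)" "b * h b \<le> b * h (a + b)"
    using assms by (auto intro!: mult_left_mono)
  then show ?thesis by (simp add: f_def algebra_simps)
qed

lemma f_mono: "0 \<le> a \<Longrightarrow> a \<le> b \<Longrightarrow> f a \<le> f b"
  using f_superadditive[of a "b - a"] f_nonneg[of "b - a"] by simp

lemma f_sum_superadditive:
  assumes "finite A" "\<And>i. i \<in> A \<Longrightarrow> 0 \<le> a i"
  shows "(\<Sum>i\<in>A. f (a i)) \<le> f (\<Sum>i\<in>A. a i)"
  using assms
proof (induction A rule: finite_induct)
  case (insert i A)
  then have "(\<Sum>i\<in>A. f (a i)) \<le> f (\<Sum>i\<in>A. a i)" by auto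
  moreover have "f (a i) + f (\<Sum>i\<in>A. a i) \<le> f (a i + (\<Sum>i\<in>A. a i))"
    using insert by (intro f_superadditive sum_nonneg) auto
  ultimately show ?case using insert by simp
qed simp

text \<open>By convexity the slope over \<open>[a, b]\<close> is at most the slope over
  \<open>[b, M + 1]\<close>. Going one unit beyond \<open>M\<close> keeps the length of the second
  interval at least 1, so no derivative of \<open>f\<close> at \<open>M\<close> is involved.\<close>

lemma f_lipschitz:
  assumes "0 \<le> a" "a \<le> b" "b \<le> M"
  shows "f b - f a \<le> f (M + 1) * (b - a)"
proof (cases "a = b")
  case False
  then have ab: "a < b" using assms by simp
  have c: "convex_on {0..} f" using h_convex unfolding f_def .
  have "(f b - f a) / (b - a) \<le> (f (M + 1) - f b) / (M + 1 - b)"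
    using convex_on_slope_le[OF c, of a "M + 1" b] assms ab
    by (smt (verit, best) atLeast_iff minus_divide_divide)
  also have "\<dots> \<le> f (M + 1) / 1"
    using assms f_nonneg[of b] f_nonneg[of "M+1"] by (intro frac_le) auto
  finally show ?thesis using ab by (simp add: field_simps)
qed simp

lemma Hprim_eq: "Hprim h s = integral {0..s} f"
  by (simp add: Hprim_def f_def[abs_def])

lemma Hprim_deriv:
  assumes "0 < s" shows "(Hprim h has_real_derivative f s) (at s)"
proof -
  have "((\<lambda>x. integral {0..x} f) has_real_derivative f s) (at s within {0..s+1})"
    using assms by (intro integral_has_real_derivative continuous_on_subset[OF f_cont]) auto
  moreover have "at s within {0..s+1} = at s" using assms by (intro at_within_interior) auto
  ultimately show ?thesis using Hprim_eq unfolding Hprim_eq[abs_def] by simp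
qed

lemma Hprim_0: "Hprim h 0 = 0"
  by (simp add: Hprim_eq)

lemma Hprim_cont: "continuous_on {0..s} (Hprim h)"
proof -
  have "continuous_on {0..s} (\<lambda>x. integral {0..x} f)"
    by (intro indefinite_integral_continuous_1 integrable_continuous_real continuous_on_subset[OF f_cont]) auto
  then show ?thesis by (simp add: Hprim_eq[abs_def])
qed

lemma Hprim_pos:
  assumes "0 < s" shows "0 < Hprim h s"
proof -
  have "Hprim h 0 < Hprim h s"
    using DERIV_pos_imp_increasing_open[OF assms _ Hprim_cont] Hprim_deriv f_pos by blast
  then show ?thesis by (simp add: Hprim_0)
qed

text \<open>Near 0 the bound \<open>h \<le> h 1\<close> makes the primitive at most quadratic, so
  \<open>1 / sqrt (2 * Hprim h s)\<close> is at least a multiple of \<open>1 / s\<close> and is not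
  integrable at 0. This is what makes the profile reach 0 only at infinity.\<close>

lemma Hprim_le_square:
  assumes "0 < s" "s \<le> 1" shows "2 * Hprim h s \<le> h 1 * s\<^sup>2"
proof -
  have "Hprim h s - h 1 * s\<^sup>2 / 2 \<le> Hprim h 0 - h 1 * 0\<^sup>2 / 2"
  proof (rule DERIV_nonpos_imp_decreasing_open[where f="\<lambda>s. Hprim h s - h 1 * s\<^sup>2 / 2"])
    show "0 \<le> s" using assms by simp
    show "continuous_on {0..s} (\<lambda>s. Hprim h s - h 1 * s\<^sup>2 / 2)"
      by (intro continuous_intros Hprim_cont) simp
    fix x assume x: "0 < x" "x < s"
    then have "h x \<le> h 1" using assms by (intro mono_onD[OF h_mono]) auto
    then have "f x - h 1 * x \<le> 0" using x by (simp add: f_def mult.commute mult_left_mono)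
    moreover have "((\<lambda>s. Hprim h s - h 1 * s\<^sup>2 / 2) has_real_derivative f x - h 1 * x) (at x)"
      using x by (auto intro!: derivative_eq_intros Hprim_deriv)
    ultimately show "\<exists>y. ((\<lambda>s. Hprim h s - h 1 * s\<^sup>2 / 2) has_real_derivative y) (at x) \<and> y \<le> 0"
      by blast
  qed
  then show ?thesis by (simp add: Hprim_0)
qed

end

section \<open>The one-dimensional blow-up profile\<close>

locale keller_osserman = absorption +
  assumes KO: "\<exists>a>0. set_integrable lborel {a..} (\<lambda>s. 1 / sqrt (Hprim h s))"
begin

lemma blow_up_time_function:
  obtains G where "\<And>s. 0 < s \<Longrightarrow> (G has_real_derivative - 1 / sqrt (2 * Hprim h s)) (at s)"
    "(G \<longlongrightarrow> 0) at_top" "filterlim G at_top (at_right 0)"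
proof -
  define q where "q s = 1 / sqrt (2 * Hprim h s)" for s
  have q_cont: "isCont q s" if "0 < s" for s
    unfolding q_def using DERIV_isCont[OF Hprim_deriv[OF that]] Hprim_pos[OF that]
    by (intro continuous_intros) auto
  \<comment> \<open>An antiderivative on the whole open half-line. It cannot be written as an
    integral from 0, because \<open>q\<close> is not integrable there.\<close>
  obtain A where A: "\<And>s. 0 < s \<Longrightarrow> (A has_real_derivative q s) (at s)"
    using einterval_antiderivative[of 0 \<infinity> q] q_cont
    by (auto simp: has_real_derivative_iff_has_vector_derivative zero_ereal_def)
  obtain a where a: "0 < a" and int: "set_integrable lborel {a..} (\<lambda>s. 1 / sqrt (Hprim h s))"
    using KO by blast
  have int': "set_integrable lborel {a..} q"
    using set_integrable_mult_right[of "1 / sqrt 2", OF int] unfolding q_def by (simp add: real_sqrt_mult)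
  have "((\<lambda>s. LBINT x:{a..s}. q x) \<longlongrightarrow> (LBINT x:{a..}. q x)) at_top"
    by (rule tendsto_set_lebesgue_integral_at_top[OF _ int']) auto
  moreover have "\<forall>\<^sub>F s in at_top. (LBINT x:{a..s}. q x) = A s - A a"
    using eventually_ge_at_top[of a]
  proof eventually_elim
    case (elim s)
    have "set_integrable lborel {a..s} q" by (rule set_integrable_subset[OF int']) auto
    then have "(LBINT x:{a..s}. q x) = integral {a..s} q"
      by (rule set_borel_integral_eq_integral)
    also have "\<dots> = A s - A a"
    proof (intro integral_unique fundamental_theorem_of_calculus elim)
      fix x assume "x \<in> {a..s}"
      with a have "0 < x" by simp
      from A[OF this] show "(A has_vector_derivative q x) (at x within {a..s})"
        unfolding has_real_derivative_iff_has_vector_derivative by (rule has_vector_derivative_at_within)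
    qed
    finally show ?case .
  qed
  ultimately have "((\<lambda>s. A s - A a) \<longlongrightarrow> (LBINT x:{a..}. q x)) at_top"
    by (rule Lim_transform_eventually)
  then obtain l where l: "(A \<longlongrightarrow> l) at_top"
    using tendsto_add[OF _ tendsto_const[of "A a"]] by fastforce
  \<comment> \<open>Subtracting from the limit of \<open>A\<close> at infinity, which exists by the
    Keller-Osserman condition, makes \<open>G s\<close> the integral of \<open>q\<close> from
    \<open>s\<close> to infinity.\<close>
  define G where "G s = l - A s" for s
  have G': "(G has_real_derivative - 1 / sqrt (2 * Hprim h s)) (at s)" if "0 < s" for s
    unfolding G_def using A[OF that] by (auto intro!: derivative_eq_intros simp: q_def)
  have G0: "(G \<longlongrightarrow> 0) at_top" unfolding G_def using tendsto_diff[OF tendsto_const l, of l] by simp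
  have h1: "0 < h 1" using h_nonneg h_zero by (metis less_eq_real_def zero_le_one zero_neq_one)
  \<comment> \<open>On \<open>(0, 1]\<close> the derivative of \<open>G\<close> is at most
    \<open>- 1 / (sqrt (h 1) * s)\<close>, so \<open>G\<close> dominates a negative multiple of the
    logarithm, which tends to infinity at 0.\<close>
  have lower: "G 1 - ln s / sqrt (h 1) \<le> G s" if s: "0 < s" "s \<le> 1" for s
  proof -
    have "G s + ln s / sqrt (h 1) \<ge> G 1 + ln 1 / sqrt (h 1)"
    proof (rule DERIV_nonpos_imp_nonincreasing[OF s(2)])
      fix x assume x: "s \<le> x" "x \<le> 1"
      with s have x0: "0 < x" by simp
      have "sqrt (2 * Hprim h x) \<le> sqrt (h 1 * x\<^sup>2)"
        using Hprim_le_square x x0 by (intro real_sqrt_le_mono) auto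
      also have "\<dots> = sqrt (h 1) * x" using x0 by (simp add: real_sqrt_mult)
      finally have "1 / (sqrt (h 1) * x) \<le> 1 / sqrt (2 * Hprim h x)"
        using Hprim_pos[OF x0] by (intro divide_left_mono) (auto simp: h1 x0)
      then have "- 1 / sqrt (2 * Hprim h x) + 1 / x / sqrt (h 1) \<le> 0"
        by (simp add: field_simps)
      moreover have "((\<lambda>s. G s + ln s / sqrt (h 1)) has_real_derivative
           - 1 / sqrt (2 * Hprim h x) + 1 / x / sqrt (h 1)) (at x)"
        using G'[OF x0] x0 h1 by (auto intro!: derivative_eq_intros simp: field_simps)
      ultimately show "\<exists>y. ((\<lambda>s. G s + ln s / sqrt (h 1)) has_real_derivative y) (at x) \<and> y \<le> 0"
        by blast
    qed
    then show ?thesis by simp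
  qed
  have "filterlim (\<lambda>s. G 1 + (- ln s) * (1 / sqrt (h 1))) at_top (at_right 0)"
    by (intro filterlim_tendsto_add_at_top[OF tendsto_const] filterlim_at_top_mult_tendsto_pos[OF tendsto_const]
      filterlim_compose[OF filterlim_uminus_at_top_at_bot ln_at_0]) (use h1 in auto)
  moreover have "\<forall>\<^sub>F s in at_right 0. G 1 + (- ln s) * (1 / sqrt (h 1)) \<le> G s"
    using eventually_at_right_real[of 0 1] lower by (auto elim!: eventually_mono)
  ultimately have "filterlim G at_top (at_right 0)" by (rule filterlim_at_top_mono)
  with G' G0 that show thesis by blast
qed

text \<open>The profile is the inverse of \<open>G(s) = \<integral>\<^sub>s\<^sup>\<infinity> d\<sigma> / \<surd>(2 H(\<sigma>))\<close>: finiteness of \<open>G\<close> is the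
  Keller--Osserman condition and gives the blow-up at 0, while \<open>G(0+) = \<infinity>\<close> gives the decay.\<close>

lemma large_profile:
  obtains p p' :: "real \<Rightarrow> real" where "\<And>y. 0 < y \<Longrightarrow> 0 < p y"
    "\<And>y. 0 < y \<Longrightarrow> (p has_real_derivative p' y) (at y)"
    "\<And>y. 0 < y \<Longrightarrow> (p' has_real_derivative f (p y)) (at y)"
    "filterlim p at_top (at_right 0)" "(p \<longlongrightarrow> 0) at_top"
proof -
  obtain G where G': "\<And>s. 0 < s \<Longrightarrow> (G has_real_derivative - 1 / sqrt (2 * Hprim h s)) (at s)"
    and G0: "(G \<longlongrightarrow> 0) at_top" and Ginf: "filterlim G at_top (at_right 0)"
    using blow_up_time_function by blast
  have Gcont: "isCont G s" if "0 < s" for s using G'[OF that] DERIV_isCont by blast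
  have Gdec: "G t < G s" if "0 < s" "s < t" for s t
  proof (rule DERIV_neg_imp_decreasing[OF that(2)])
    fix x assume "s \<le> x"
    with that have x: "0 < x" by simp
    show "\<exists>y. (G has_real_derivative y) (at x) \<and> y < 0"
      using G'[OF x] Hprim_pos[OF x] by (intro exI[of _ "- 1 / sqrt (2 * Hprim h x)"]) simp
  qed
  have Gpos: "0 < G s" if "0 < s" for s
  proof -
    have "0 \<le> G (s + 1)"
      by (rule tendsto_upperbound[OF G0])
        (use Gdec that in \<open>auto intro!: eventually_mono[OF eventually_gt_at_top[of "s+1"]] less_imp_le\<close>)
    then show ?thesis using Gdec[of s "s+1"] that by simp
  qed
  have ex: "\<exists>s>0. G s = y" if y: "0 < y" for y
  proof -
    obtain s where s: "0 < s" "y \<le> G s"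
    proof -
      have "\<forall>\<^sub>F s in at_right 0. y \<le> G s" using Ginf by (simp add: filterlim_at_top)
      then have "\<forall>\<^sub>F s in at_right 0. y \<le> G s \<and> 0 < s"
        by (intro eventually_conj eventually_at_right_less)
      then show thesis using that eventually_happens' trivial_limit_at_right_real by blast
    qed
    obtain t where t: "s < t" "G t \<le> y"
    proof -
      have "\<forall>\<^sub>F t in at_top. G t < y" using order_tendstoD(2)[OF G0 y] .
      then have "\<forall>\<^sub>F t in at_top. G t < y \<and> s < t" by (intro eventually_conj eventually_gt_at_top)
      then show thesis using that eventually_happens' trivial_limit_at_top_linorder less_imp_le by blast
    qed
    have "continuous_on {s..t} G" using Gcont s by (auto intro!: continuous_at_imp_continuous_on)
    then obtain x where "s \<le> x" "G x = y" using IVT2'[of G t y s] s t by auto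
    with s show ?thesis by (intro exI[of _ x]) auto
  qed
  define p where "p y = (SOME s. 0 < s \<and> G s = y)" for y
  have p: "0 < p y" "G (p y) = y" if "0 < y" for y
    using someI_ex[of "\<lambda>s. 0 < s \<and> G s = y"] ex[OF that] unfolding p_def by auto
  have pG: "p (G s) = s" if "0 < s" for s
    using p[OF Gpos[OF that]] Gdec[of "p (G s)" s] Gdec[of s "p (G s)"] that by force
  have pdec: "p z < p y" if "0 < y" "y < z" for y z
    using Gdec[of "p y" "p z"] p[of y] p[of z] that by (cases "p y" "p z" rule: linorder_cases) auto
  have pcont: "isCont p y" if "0 < y" for y
  proof -
    have "isCont p (G (p y))"
    proof (rule isCont_inverse_function[where d="p y / 2" and f=G and x="p y"])
      have py: "0 < p y" using p that by simp
      then show "0 < p y / 2" by simp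
      fix z assume "\<bar>z - p y\<bar> \<le> p y / 2"
      with py have "0 < z" unfolding abs_le_iff by (simp add: field_simps)
      then show "p (G z) = z" "isCont G z" using pG[of z] Gcont[of z] by simp_all
    qed
    then show ?thesis using p that by simp
  qed
  \<comment> \<open>The reciprocal of the derivative of \<open>G\<close> at \<open>p y\<close>. Its
    square is the first integral \<open>(p')^2 = 2 H(p)\<close> of \<open>p'' = f p\<close>, and the
    negative root belongs to the decreasing solution.\<close>
  define p' where "p' y = - sqrt (2 * Hprim h (p y))" for y
  have pD: "(p has_real_derivative p' y) (at y)" if y: "0 < y" for y
  proof -
    have "(p has_real_derivative inverse (- 1 / sqrt (2 * Hprim h (p y)))) (at y)"
      by (rule DERIV_inverse_function[where f=G and a=0 and b="y + 1", OF G'])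
        (use p y pcont Hprim_pos[of "p y"] in auto)
    then show ?thesis by (simp add: p'_def inverse_eq_divide)
  qed
  have pDD: "(p' has_real_derivative f (p y)) (at y)" if y: "0 < y" for y
  proof -
    have H: "0 < Hprim h (p y)" using Hprim_pos p y by simp
    have "((\<lambda>y. Hprim h (p y)) has_real_derivative f (p y) * p' y) (at y)"
      using DERIV_chain2[OF Hprim_deriv pD] p y by blast
    then have "(p' has_real_derivative - (inverse (sqrt (2 * Hprim h (p y))) / 2 * (2 * (f (p y) * p' y)))) (at y)"
      unfolding p'_def using H by (auto intro!: derivative_eq_intros simp: p'_def)
    moreover have "- (inverse (sqrt (2 * Hprim h (p y))) / 2 * (2 * (f (p y) * p' y))) = f (p y)"
      using H by (simp add: p'_def field_simps)
    ultimately show ?thesis by simp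
  qed
  have "filterlim p at_top (at_right 0)"
    unfolding filterlim_at_top_gt[where c=0]
  proof (intro allI impI)
    fix Z :: real assume Z: "0 < Z"
    show "\<forall>\<^sub>F y in at_right 0. Z \<le> p y"
      using eventually_at_right_real[OF Gpos[OF Z]]
    proof eventually_elim
      case (elim y) then show ?case using pdec[of y "G Z"] pG[OF Z] by simp
    qed
  qed
  moreover have "(p \<longlongrightarrow> 0) at_top"
  proof (rule order_tendstoI)
    fix e :: real assume e: "0 < e"
    show "\<forall>\<^sub>F y in at_top. p y < e"
      using eventually_gt_at_top[of "G e"]
      by eventually_elim (use pdec[of "G e"] Gpos[OF e] pG[OF e] in auto)
  next
    fix e :: real assume e: "e < 0"
    show "\<forall>\<^sub>F y in at_top. e < p y"
      using eventually_gt_at_top[of 0] by eventually_elim (use p(1) e in force)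
  qed
  ultimately show thesis using that p(1) pD pDD by blast
qed

text \<open>Fixing one profile by choice lets the barrier depend on \<open>R\<close> and
  \<open>x\<close> only.\<close>

definition profile :: "real \<Rightarrow> real" where
  "profile = (SOME p. \<exists>p'. (\<forall>y>0. 0 < p y \<and> (p has_real_derivative p' y) (at y) \<and> (p' has_real_derivative f (p y)) (at y))
      \<and> filterlim p at_top (at_right 0) \<and> (p \<longlongrightarrow> 0) at_top)"

lemma profile:
  shows profile_deriv: "\<exists>p'. \<forall>y>0. (profile has_real_derivative p' y) (at y) \<and> (p' has_real_derivative f (profile y)) (at y)"
  and profile_pos: "\<And>y. 0 < y \<Longrightarrow> 0 < profile y"
  and profile_blow_up: "filterlim profile at_top (at_right 0)"
  and profile_decay: "(profile \<longlongrightarrow> 0) at_top"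
proof -
  have "\<exists>p p'. (\<forall>y>0. 0 < p y \<and> (p has_real_derivative p' y) (at y) \<and> (p' has_real_derivative f (p y)) (at y))
      \<and> filterlim p at_top (at_right 0) \<and> (p \<longlongrightarrow> 0) at_top"
    by (rule large_profile) blast
  from someI_ex[OF this, folded profile_def]
  show "\<exists>p'. \<forall>y>0. (profile has_real_derivative p' y) (at y) \<and> (p' has_real_derivative f (profile y)) (at y)"
    "\<And>y. 0 < y \<Longrightarrow> 0 < profile y" "filterlim profile at_top (at_right 0)" "(profile \<longlongrightarrow> 0) at_top"
    by blast+
qed

section \<open>The barrier on a cube\<close>

definition barrier :: "real \<Rightarrow> 'a::euclidean_space \<Rightarrow> real" where
  "barrier R x = (\<Sum>b\<in>Basis. profile (R - x \<bullet> b) + profile (R - x \<bullet> - b))"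

lemma cube_pos: "x \<in> cube R \<Longrightarrow> b \<in> Basis \<Longrightarrow> 0 < R - x \<bullet> b \<and> 0 < R - x \<bullet> - b"
  by (auto simp: cube_def abs_less_iff)

text \<open>All terms are positive inside the cube, so any one of them bounds the sum from below. A
  face is named by its outward normal \<open>v\<close>, uniformly in the sign; hence the form
  \<open>x \<bullet> - b\<close> in \<open>barrier\<close>, which the simplifier is kept from
  rewriting.\<close>

lemma barrier_ge:
  assumes x: "x \<in> cube R" and b: "b \<in> Basis" and v: "v = b \<or> v = - b"
  shows "profile (R - x \<bullet> v) \<le> barrier R x"
proof -
  have pos: "0 \<le> profile (R - x \<bullet> c)" "0 \<le> profile (R - x \<bullet> - c)" if "c \<in> Basis" for c
    using cube_pos[OF x that] profile_pos by (simp_all add: less_imp_le)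
  have "profile (R - x \<bullet> v) \<le> profile (R - x \<bullet> b) + profile (R - x \<bullet> - b)"
    using v pos[OF b] by auto
  also have "\<dots> \<le> barrier R x"
    unfolding barrier_def using b pos
    by (intro member_le_sum[where f="\<lambda>b. profile (R - x \<bullet> b) + profile (R - x \<bullet> - b)"]) (auto simp del: inner_minus_right)
  finally show ?thesis .
qed

lemma barrier_pos:
  assumes x: "x \<in> cube R" shows "0 < barrier R x"
proof -
  obtain b :: 'a where b: "b \<in> Basis" using nonempty_Basis by blast
  have "0 < profile (R - x \<bullet> b)" using cube_pos[OF x b] by (intro profile_pos) simp
  also have "\<dots> \<le> barrier R x" by (rule barrier_ge[OF x b]) simp
  finally show ?thesis .
qed

lemma barrier_cont: "continuous_on (cube R) (barrier R)"
proof -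
  obtain p' where p': "\<And>y. 0 < y \<Longrightarrow> (profile has_real_derivative p' y) (at y)" using profile_deriv by blast
  have "continuous_on {0<..} profile"
    using p' DERIV_isCont by (auto intro!: continuous_at_imp_continuous_on)
  then have "continuous_on (cube R) (\<lambda>x::'a. profile (R - x \<bullet> v))" if "v \<in> Basis \<or> - v \<in> Basis" for v
    by (rule continuous_on_compose2)
      (use cube_pos[of _ R v] cube_pos[of _ R "- v"] that in \<open>auto intro!: continuous_intros simp del: inner_minus_right\<close>)
  then show ?thesis unfolding barrier_def[abs_def]
    by (intro continuous_on_sum continuous_on_add) (simp_all del: inner_minus_right)
qed

text \<open>Each term depends on a single coordinate, so the Laplacian is the sum of
  \<open>f\<close> over the terms, and superadditivity bounds this by \<open>f\<close> of the whole
  sum.\<close>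

lemma barrier_laplacian:
  assumes x: "x \<in> cube R"
  obtains d where "\<And>b. b \<in> Basis \<Longrightarrow> has_second_dir_deriv (barrier R) x b (d b)"
    "(\<Sum>b\<in>Basis. d b) \<le> f (barrier R x)"
proof -
  obtain p' where p': "\<And>y. 0 < y \<Longrightarrow> (profile has_real_derivative p' y) (at y)"
    and p'': "\<And>y. 0 < y \<Longrightarrow> (p' has_real_derivative f (profile y)) (at y)" using profile_deriv by blast
  \<comment> \<open>The argument of \<open>profile\<close> is affine along the line, with slope
    \<open>- (e \<bullet> v)\<close>; differentiating twice yields the square of this slope.\<close>
  have D: "has_second_dir_deriv (\<lambda>x. profile (R - x \<bullet> v)) x e (f (profile (R - x \<bullet> v)) * (e \<bullet> v)\<^sup>2)"
    if pos: "0 < R - x \<bullet> v" for e v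
    unfolding has_second_dir_deriv_def
  proof (intro exI conjI)
    have lim: "((\<lambda>s. R - (x + s *\<^sub>R e) \<bullet> v) \<longlongrightarrow> R - (x + 0 *\<^sub>R e) \<bullet> v) (nhds 0)"
      by (intro tendsto_intros filterlim_ident)
    have "\<forall>\<^sub>F s in nhds 0. 0 < R - (x + s *\<^sub>R e) \<bullet> v"
      using pos by (intro order_tendstoD(1)[OF lim]) simp
    then show "\<forall>\<^sub>F s in nhds 0. ((\<lambda>s. profile (R - (x + s *\<^sub>R e) \<bullet> v)) has_real_derivative
        p' (R - (x + s *\<^sub>R e) \<bullet> v) * (- (e \<bullet> v))) (at s)"
    proof eventually_elim
      case (elim s)
      show ?case
        by (rule DERIV_chain2[where f=profile and g="\<lambda>s. R - (x + s *\<^sub>R e) \<bullet> v", OF p'[OF elim]]) (auto intro!: derivative_eq_intros simp: inner_add_left)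
    qed
    have "((\<lambda>s. p' (R - (x + s *\<^sub>R e) \<bullet> v)) has_real_derivative f (profile (R - (x + 0 *\<^sub>R e) \<bullet> v)) * (- (e \<bullet> v))) (at 0)"
      using pos by (intro DERIV_chain2[where f=p', OF p'']) (auto intro!: derivative_eq_intros simp: inner_add_left)
    from DERIV_cmult_right[OF this, of "- (e \<bullet> v)"]
    show "((\<lambda>s. p' (R - (x + s *\<^sub>R e) \<bullet> v) * (- (e \<bullet> v))) has_real_derivative
        f (profile (R - x \<bullet> v)) * (e \<bullet> v)\<^sup>2) (at 0)"
      by (simp add: power2_eq_square mult.assoc)
  qed
  define F where "F b = f (profile (R - x \<bullet> b)) + f (profile (R - x \<bullet> - b))" for b
  define d where "d e = (\<Sum>b\<in>Basis. f (profile (R - x \<bullet> b)) * (e \<bullet> b)\<^sup>2 + f (profile (R - x \<bullet> - b)) * (e \<bullet> - b)\<^sup>2)" for e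
  have "has_second_dir_deriv (barrier R) x e (d e)" for e
    unfolding barrier_def[abs_def] d_def using cube_pos[OF x]
    by (intro has_second_dir_deriv_sum[OF finite_Basis] has_second_dir_deriv_add D) simp_all
  moreover have "d e = F e" if "e \<in> Basis" for e
  proof -
    have "d e = (\<Sum>b\<in>Basis. if b = e then F e else 0)"
      unfolding d_def using that by (intro sum.cong) (auto simp: F_def inner_Basis)
    then show ?thesis using that by simp
  qed
  \<comment> \<open>Superadditivity is used twice: within each pair of opposite faces, and then over
    the coordinates.\<close>
  moreover have "(\<Sum>b\<in>Basis. F b) \<le> f (barrier R x)"
  proof -
    have pos: "0 \<le> profile (R - x \<bullet> c)" "0 \<le> profile (R - x \<bullet> - c)" if "c \<in> Basis" for c
      using cube_pos[OF x that] profile_pos by (simp_all add: less_imp_le)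
    have "(\<Sum>b\<in>Basis. F b) \<le> (\<Sum>b\<in>Basis. f (profile (R - x \<bullet> b) + profile (R - x \<bullet> - b)))"
      unfolding F_def using pos by (intro sum_mono f_superadditive) blast+
    also have "\<dots> \<le> f (barrier R x)"
      unfolding barrier_def using pos by (intro f_sum_superadditive add_nonneg_nonneg) auto
    finally show ?thesis .
  qed
  ultimately show thesis by (intro that[of F]) metis+
qed

lemma barrier_blow_up:
  assumes R: "0 < R"
  obtains R' where "0 < R'" "R' < R"
    "\<And>x b. x \<in> cube R \<Longrightarrow> b \<in> Basis \<Longrightarrow> R' \<le> \<bar>x \<bullet> b\<bar> \<Longrightarrow> M < barrier R x"
proof -
  have "\<forall>\<^sub>F y in at_right 0. M < profile y"
    using profile_blow_up by (simp add: filterlim_at_top_dense)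
  then obtain r where r: "0 < r" "\<And>y. 0 < y \<Longrightarrow> y < r \<Longrightarrow> M < profile y"
    unfolding eventually_at_right_field by auto
  \<comment> \<open>The first entry keeps \<open>R'\<close> positive; the second puts every point
    with \<open>R' \<le> \<bar>x \<bullet> b\<bar>\<close> within distance \<open>r / 2\<close> of a
    face.\<close>
  define R' where "R' = max (R / 2) (R - r / 2)"
  have *: "M < barrier R x" if x: "x \<in> cube R" and b: "b \<in> Basis" and xb: "R' \<le> \<bar>x \<bullet> b\<bar>" for x b
  proof -
    define v where "v = (if 0 \<le> x \<bullet> b then b else - b)"
    have "R - x \<bullet> v = R - \<bar>x \<bullet> b\<bar>" by (simp add: v_def)
    also have "\<dots> < r" using xb r R unfolding R'_def by linarith
    finally have "M < profile (R - x \<bullet> v)" using r(2) cube_pos[OF x b] by (simp add: v_def)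
    also have "\<dots> \<le> barrier R x" by (rule barrier_ge[OF x b]) (simp add: v_def)
    finally show ?thesis .
  qed
  show thesis by (rule that[of R', OF _ _ *]) (use R r in \<open>auto simp: R'_def\<close>)
qed

lemma barrier_decay:
  assumes e: "0 < e"
  obtains R0 where "\<And>R x::'a::euclidean_space. R0 \<le> R \<Longrightarrow> norm x \<le> r \<Longrightarrow> x \<in> cube R \<and> barrier R x < e"
proof -
  \<comment> \<open>The barrier has two terms for each coordinate, so each gets an equal share of
    \<open>e\<close>.\<close>
  define e' where "e' = e / (2 * DIM('a))"
  have "0 < e'" using e by (simp add: e'_def)
  then have "\<forall>\<^sub>F y in at_top. profile y < e'" using order_tendstoD(2)[OF profile_decay] by blast
  then obtain y0 where y0: "\<And>y. y0 \<le> y \<Longrightarrow> profile y < e'" unfolding eventually_at_top_linorder by blast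
  have "x \<in> cube R \<and> barrier R x < e" if R: "\<bar>r\<bar> + \<bar>y0\<bar> + 1 \<le> R" and x: "norm x \<le> r" for R and x :: 'a
  proof
    have xb: "\<bar>x \<bullet> b\<bar> \<le> r" if "b \<in> Basis" for b using x Basis_le_norm[OF that, of x] by simp
    then show "x \<in> cube R" using R by (force simp: cube_def)
    have "barrier R x < (\<Sum>b\<in>(Basis::'a set). e' + e')"
      unfolding barrier_def
    proof (rule sum_strict_mono)
      fix b :: 'a assume "b \<in> Basis"
      from xb[OF this] have "y0 \<le> R - x \<bullet> b" "y0 \<le> R - x \<bullet> - b" using R by (auto simp: abs_le_iff)
      then show "profile (R - x \<bullet> b) + profile (R - x \<bullet> - b) < e' + e'" using y0 by (intro add_strict_mono)
    qed auto
    then show "barrier R x < e" by (simp add: e'_def)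
  qed
  with that show thesis by blast
qed

end

section \<open>Mollification and the maximum principle\<close>

lemma cutoff_power_deriv:
  assumes "1 \<le> k"
  shows "((\<lambda>r::real. (max 0 (1 - r)) ^ Suc k) has_real_derivative - real (Suc k) * (max 0 (1 - r)) ^ k) (at r)"
proof (cases "r = 1")
  case True
  \<comment> \<open>The junction point is the only delicate one. There the difference quotient is at
    most \<open>\<bar>h\<bar> ^ k\<close>, which tends to 0 because \<open>k\<close> is at least
    1.\<close>
  have "((\<lambda>h::real. (max 0 (1 - (1 + h))) ^ Suc k / h) \<longlongrightarrow> 0) (at 0)"
  proof (rule Lim_null_comparison)
    show "((\<lambda>h::real. \<bar>h\<bar> ^ k) \<longlongrightarrow> 0) (at 0)"
      using assms by (auto intro!: tendsto_eq_intros simp: power_0_left)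
    show "\<forall>\<^sub>F h in at 0. norm ((max 0 (1 - (1 + h))) ^ Suc k / h) \<le> \<bar>h\<bar> ^ k"
    proof (rule eventually_at_topological[THEN iffD2], intro exI[of _ UNIV] conjI ballI impI)
      fix h :: real assume h: "h \<noteq> 0"
      show "norm ((max 0 (1 - (1 + h))) ^ Suc k / h) \<le> \<bar>h\<bar> ^ k"
        using h assms by (cases "0 < h") (auto simp: max_def power_abs abs_mult)
    qed auto
  qed
  with True assms show ?thesis by (simp add: DERIV_def power_0_left)
next
  case False
  then consider "r < 1" | "1 < r" by linarith
  then show ?thesis
  proof cases
    case 1
    have "((\<lambda>r::real. 1 - r) has_real_derivative -1) (at r)"
      by (auto intro!: derivative_eq_intros)
    from DERIV_power[OF this, of "Suc k"]
    have "((\<lambda>r::real. (1 - r) ^ Suc k) has_real_derivative - real (Suc k) * (1 - r) ^ k) (at r)"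
      by (simp add: algebra_simps)
    then have "((\<lambda>r::real. (max 0 (1 - r)) ^ Suc k) has_real_derivative - real (Suc k) * (1 - r) ^ k) (at r)"
      by (rule has_field_derivative_transform_within_open[of _ _ _ "{..<1}"]) (use 1 in auto)
    then show ?thesis using 1 by simp
  next
    case 2
    have "((\<lambda>r::real. (max 0 (1 - r)) ^ Suc k) has_real_derivative 0) (at r)"
      by (rule has_field_derivative_transform_within_open[of "\<lambda>_. 0" _ _ "{1<..}"]) (use 2 in auto)
    then show ?thesis using 2 assms by (simp add: power_0_left)
  qed
qed

text \<open>The exponent 3 is the smallest integer one whose second derivative is continuous across
  1, as \<open>test_fun\<close> demands.\<close>

definition cutoff :: "real \<Rightarrow> real" where "cutoff r = (max 0 (1 - r)) ^ 3"
definition cutoff' :: "real \<Rightarrow> real" where "cutoff' r = - 3 * (max 0 (1 - r)) ^ 2"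
definition cutoff'' :: "real \<Rightarrow> real" where "cutoff'' r = 6 * max 0 (1 - r)"

lemma cutoff_deriv: "(cutoff has_real_derivative cutoff' r) (at r)"
  using cutoff_power_deriv[of 2 r] by (simp add: cutoff_def[abs_def] cutoff'_def numeral_3_eq_3)

lemma cutoff'_deriv: "(cutoff' has_real_derivative cutoff'' r) (at r)"
  using DERIV_cmult[OF cutoff_power_deriv[of 1 r], of "-3"]
  by (simp add: cutoff'_def[abs_def] cutoff''_def numeral_2_eq_2)

lemma cutoff_eq_0: "1 \<le> r \<Longrightarrow> cutoff r = 0" "1 \<le> r \<Longrightarrow> cutoff' r = 0" "1 \<le> r \<Longrightarrow> cutoff'' r = 0"
  by (auto simp: cutoff_def cutoff'_def cutoff''_def)

lemma cutoff_nonneg: "0 \<le> cutoff r"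
  by (simp add: cutoff_def)

lemma cutoff_cont [continuous_intros]:
  assumes "continuous_on S g"
  shows "continuous_on S (\<lambda>x. cutoff (g x))" "continuous_on S (\<lambda>x. cutoff' (g x))"
    "continuous_on S (\<lambda>x. cutoff'' (g x))"
  unfolding cutoff_def cutoff'_def cutoff''_def by (intro continuous_intros assms)+

text \<open>The first point is the centre, the second the variable. The squared distance, rather
  than the distance, enters the cut-off, so that nothing singular happens at the centre.\<close>

definition bump :: "real \<Rightarrow> 'e::euclidean_space \<Rightarrow> 'e \<Rightarrow> real" where
  "bump \<epsilon> y z = cutoff (((z - y) \<bullet> (z - y)) / \<epsilon>\<^sup>2)"

definition bump' :: "real \<Rightarrow> 'e::euclidean_space \<Rightarrow> 'e \<Rightarrow> 'e \<Rightarrow> real" where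
  "bump' \<epsilon> y z v = cutoff' (((z - y) \<bullet> (z - y)) / \<epsilon>\<^sup>2) * (2 / \<epsilon>\<^sup>2) * (v \<bullet> (z - y))"

definition bump'' :: "real \<Rightarrow> 'e::euclidean_space \<Rightarrow> 'e \<Rightarrow> 'e \<Rightarrow> 'e \<Rightarrow> real" where
  "bump'' \<epsilon> y z v w = cutoff'' (((z - y) \<bullet> (z - y)) / \<epsilon>\<^sup>2) * (2 / \<epsilon>\<^sup>2)\<^sup>2 * (v \<bullet> (z - y)) * (w \<bullet> (z - y))
     + cutoff' (((z - y) \<bullet> (z - y)) / \<epsilon>\<^sup>2) * (2 / \<epsilon>\<^sup>2) * (w \<bullet> v)"

lemma bump_support:
  assumes "0 < \<epsilon>" "z \<notin> ball y \<epsilon>"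
  shows "bump \<epsilon> y z = 0" "bump' \<epsilon> y z v = 0" "bump'' \<epsilon> y z v w = 0"
proof -
  have "\<epsilon>\<^sup>2 \<le> (norm (z - y))\<^sup>2"
    using assms by (intro power_mono) (auto simp: dist_norm norm_minus_commute)
  then have "1 \<le> ((z - y) \<bullet> (z - y)) / \<epsilon>\<^sup>2" using assms by (simp add: dot_square_norm)
  then show "bump \<epsilon> y z = 0" "bump' \<epsilon> y z v = 0" "bump'' \<epsilon> y z v w = 0"
    by (simp_all add: bump_def bump'_def bump''_def cutoff_eq_0)
qed

lemma bump_nonneg: "0 \<le> bump \<epsilon> y z"
  by (simp add: bump_def cutoff_nonneg)

lemma bump_cont [continuous_intros]:
  assumes "continuous_on S p" "continuous_on S q"
  shows "continuous_on S (\<lambda>x. bump \<epsilon> (p x) (q x))" "continuous_on S (\<lambda>x. bump' \<epsilon> (p x) (q x) v)"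
    "continuous_on S (\<lambda>x. bump'' \<epsilon> (p x) (q x) v w)"
  unfolding bump_def bump'_def bump''_def divide_inverse by (intro continuous_intros assms)+

text \<open>The bump depends on \<open>z - y\<close> only, so moving the centre changes the sign of
  first derivatives and leaves second ones alone. Mollification differentiates in the centre,
  whereas the weak formulation differentiates in the variable; these formulas link the two.\<close>

lemma bump_deriv_centre:
  shows "((\<lambda>s. bump \<epsilon> (y + s *\<^sub>R e) z) has_real_derivative - bump' \<epsilon> (y + s *\<^sub>R e) z e) (at s)"
    and "((\<lambda>s. - bump' \<epsilon> (y + s *\<^sub>R e) z e) has_real_derivative bump'' \<epsilon> (y + s *\<^sub>R e) z e e) (at s)"
proof -
  define n where "n s = ((z - (y + s *\<^sub>R e)) \<bullet> (z - (y + s *\<^sub>R e))) / \<epsilon>\<^sup>2" for s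
  define \<kappa> where "\<kappa> = 2 / \<epsilon>\<^sup>2"
  define E where "E s = e \<bullet> (z - (y + s *\<^sub>R e))" for s
  have E: "(E has_real_derivative - (e \<bullet> e)) (at s)" for s
    unfolding E_def by (auto intro!: derivative_eq_intros simp: inner_diff_right inner_add_right)
  have n: "(n has_real_derivative - (\<kappa> * E s)) (at s)" for s
  proof -
    have "n = (\<lambda>s. ((z - y) \<bullet> (z - y) - 2 * s * (e \<bullet> (z - y)) + s\<^sup>2 * (e \<bullet> e)) * inverse (\<epsilon>\<^sup>2))"
      by (auto simp: n_def fun_eq_iff algebra_simps inner_commute power2_eq_square divide_inverse)
    then show ?thesis
      by (auto intro!: derivative_eq_intros simp: algebra_simps divide_inverse \<kappa>_def E_def)
  qed
  show "((\<lambda>s. bump \<epsilon> (y + s *\<^sub>R e) z) has_real_derivative - bump' \<epsilon> (y + s *\<^sub>R e) z e) (at s)"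
    using DERIV_chain2[OF cutoff_deriv n, of s] unfolding bump_def bump'_def n_def \<kappa>_def E_def
    by (simp add: mult.assoc)
  have "((\<lambda>s. - (cutoff' (n s) * \<kappa> * E s)) has_real_derivative
     - (cutoff'' (n s) * - (\<kappa> * E s) * \<kappa> * E s + - (e \<bullet> e) * (cutoff' (n s) * \<kappa>))) (at s)"
    by (rule DERIV_minus[OF DERIV_mult[OF DERIV_cmult_right[OF DERIV_chain2[OF cutoff'_deriv n]] E]])
  then show "((\<lambda>s. - bump' \<epsilon> (y + s *\<^sub>R e) z e) has_real_derivative bump'' \<epsilon> (y + s *\<^sub>R e) z e e) (at s)"
    unfolding bump'_def bump''_def n_def[symmetric] \<kappa>_def[symmetric] E_def[symmetric]
    by (simp add: power2_eq_square mult_ac add.commute)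
qed

definition bump_D :: "real \<Rightarrow> 'e::euclidean_space \<Rightarrow> 'e \<Rightarrow> 'e \<Rightarrow>\<^sub>L real" where
  "bump_D \<epsilon> y z = (cutoff' (((z - y) \<bullet> (z - y)) / \<epsilon>\<^sup>2) * (2 / \<epsilon>\<^sup>2)) *\<^sub>R blinfun_inner_left (z - y)"

text \<open>The Hessian as a nested bounded linear map: a rank-one part from the chain rule, plus a
  multiple of the inner product, which is what \<open>Blinfun blinfun_inner_left\<close>
  represents.\<close>

definition bump_D2 :: "real \<Rightarrow> 'e::euclidean_space \<Rightarrow> 'e \<Rightarrow> 'e \<Rightarrow>\<^sub>L ('e \<Rightarrow>\<^sub>L real)" where
  "bump_D2 \<epsilon> y z = (cutoff'' (((z - y) \<bullet> (z - y)) / \<epsilon>\<^sup>2) * (2 / \<epsilon>\<^sup>2)\<^sup>2) *\<^sub>R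
      (blinfun_scaleR_left (blinfun_inner_left (z - y)) o\<^sub>L blinfun_inner_left (z - y))
    + (cutoff' (((z - y) \<bullet> (z - y)) / \<epsilon>\<^sup>2) * (2 / \<epsilon>\<^sup>2)) *\<^sub>R Blinfun blinfun_inner_left"

lemma bump_D_apply: "blinfun_apply (bump_D \<epsilon> y z) v = bump' \<epsilon> y z v"
  by (simp add: bump_D_def bump'_def scaleR_blinfun.rep_eq)

lemma bump_D2_apply: "blinfun_apply (blinfun_apply (bump_D2 \<epsilon> y z) v) w = bump'' \<epsilon> y z v w"
  by (simp add: bump_D2_def bump''_def plus_blinfun.rep_eq scaleR_blinfun.rep_eq
    bounded_linear_Blinfun_apply[OF bounded_linear_blinfun_inner_left])

lemma bump_has_derivative:
  "(bump \<epsilon> y has_derivative blinfun_apply (bump_D \<epsilon> y z)) (at z)"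
proof -
  define n where "n z = ((z - y) \<bullet> (z - y)) / \<epsilon>\<^sup>2" for z
  have n: "(n has_derivative (\<lambda>v. (2 / \<epsilon>\<^sup>2) * (v \<bullet> (z - y)))) (at z)"
    unfolding n_def divide_inverse
    by (rule derivative_eq_intros refl)+ (auto simp: inner_commute algebra_simps)
  show ?thesis
    using has_derivative_compose[OF n cutoff_deriv[unfolded has_field_derivative_def]]
    by (simp add: bump_def[abs_def] n_def bump_D_apply[abs_def] bump'_def[abs_def] mult.assoc)
qed

lemma bump_D_has_derivative:
  "(bump_D \<epsilon> y has_derivative blinfun_apply (bump_D2 \<epsilon> y z)) (at z)"
proof -
  define n where "n z = ((z - y) \<bullet> (z - y)) / \<epsilon>\<^sup>2" for z
  have n: "(n has_derivative (\<lambda>v. (2 / \<epsilon>\<^sup>2) * (v \<bullet> (z - y)))) (at z)"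
    unfolding n_def divide_inverse
    by (rule derivative_eq_intros refl)+ (auto simp: inner_commute algebra_simps)
  have 1: "((\<lambda>z. cutoff' (n z) * (2 / \<epsilon>\<^sup>2)) has_derivative
      (\<lambda>v. cutoff'' (n z) * ((2 / \<epsilon>\<^sup>2) * (v \<bullet> (z - y))) * (2 / \<epsilon>\<^sup>2))) (at z)"
    by (rule has_derivative_mult_left[OF has_derivative_compose[OF n cutoff'_deriv[unfolded has_field_derivative_def]]])
  have 2: "((\<lambda>z. blinfun_inner_left (z - y)) has_derivative blinfun_inner_left) (at z)"
    by (rule bounded_linear.has_derivative[OF bounded_linear_blinfun_inner_left]) (auto intro!: derivative_eq_intros)
  have "(bump_D \<epsilon> y has_derivative (\<lambda>v. (cutoff' (n z) * (2 / \<epsilon>\<^sup>2)) *\<^sub>R blinfun_inner_left v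
     + (cutoff'' (n z) * ((2 / \<epsilon>\<^sup>2) * (v \<bullet> (z - y))) * (2 / \<epsilon>\<^sup>2)) *\<^sub>R blinfun_inner_left (z - y))) (at z)"
    unfolding bump_D_def[abs_def] n_def[symmetric] by (rule has_derivative_scaleR[OF 1 2])
  moreover have "(\<lambda>v. (cutoff' (n z) * (2 / \<epsilon>\<^sup>2)) *\<^sub>R blinfun_inner_left v
     + (cutoff'' (n z) * ((2 / \<epsilon>\<^sup>2) * (v \<bullet> (z - y))) * (2 / \<epsilon>\<^sup>2)) *\<^sub>R blinfun_inner_left (z - y)) = blinfun_apply (bump_D2 \<epsilon> y z)"
    by (intro ext blinfun_eqI)
      (simp add: bump_D2_apply bump''_def plus_blinfun.rep_eq scaleR_blinfun.rep_eq n_def power2_eq_square mult_ac)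
  ultimately show ?thesis by simp
qed

lemma bump_D2_cont: "continuous_on UNIV (bump_D2 \<epsilon> y)"
proof -
  have 1: "continuous_on UNIV (\<lambda>z. blinfun_inner_left (z - y))"
    by (intro bounded_linear.continuous_on[OF bounded_linear_blinfun_inner_left] continuous_on_diff continuous_on_id continuous_on_const)
  have 2: "continuous_on UNIV (\<lambda>z. blinfun_scaleR_left (blinfun_inner_left (z - y)))"
    by (rule bounded_linear.continuous_on[OF bounded_linear_blinfun_scaleR_left 1])
  have 3: "continuous_on UNIV (\<lambda>z. blinfun_scaleR_left (blinfun_inner_left (z - y)) o\<^sub>L blinfun_inner_left (z - y))"
    by (rule bounded_bilinear.continuous_on[OF bounded_bilinear_blinfun_compose 2 1])
  have 4: "continuous_on UNIV (\<lambda>z. ((z - y) \<bullet> (z - y)) / \<epsilon>\<^sup>2)"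
    unfolding divide_inverse by (intro continuous_intros)
  have 5: "continuous_on UNIV (\<lambda>z. cutoff'' (((z - y) \<bullet> (z - y)) / \<epsilon>\<^sup>2) * (2 / \<epsilon>\<^sup>2)\<^sup>2)"
    "continuous_on UNIV (\<lambda>z. cutoff' (((z - y) \<bullet> (z - y)) / \<epsilon>\<^sup>2) * (2 / \<epsilon>\<^sup>2))"
    by (rule continuous_on_mult_right[OF cutoff_cont(3)[OF 4]], rule continuous_on_mult_right[OF cutoff_cont(2)[OF 4]])
  show ?thesis
    unfolding bump_D2_def
    by (rule continuous_on_add[OF continuous_on_scaleR[OF 5(1) 3] continuous_on_scaleR[OF 5(2) continuous_on_const]])
qed

lemma test_fun_bump:
  fixes y :: "real \<times> 'a::euclidean_space"
  assumes "0 < \<epsilon>" "\<epsilon> < fst y"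
  shows "test_fun (bump \<epsilon> y) (bump_D \<epsilon> y) (bump_D2 \<epsilon> y)"
proof -
  have "cball y \<epsilon> \<subseteq> {z. fst z > 0}"
  proof
    fix z assume "z \<in> cball y \<epsilon>"
    then have "\<bar>fst y - fst z\<bar> \<le> \<epsilon>"
      using dist_fst_le[of y z] by (simp add: dist_real_def)
    then show "z \<in> {z. fst z > 0}" using assms by simp
  qed
  moreover have "bump \<epsilon> y z = 0" if "z \<notin> cball y \<epsilon>" for z
    using that assms by (intro bump_support) auto
  ultimately show ?thesis
    unfolding test_fun_def using bump_has_derivative bump_D_has_derivative bump_D2_cont
    by (intro conjI allI exI[of _ "cball y \<epsilon>"] compact_cball) blast+
qed

section \<open>Mollification of weak solutions\<close>

definition bump_mass :: "real \<Rightarrow> 'e::euclidean_space itself \<Rightarrow> real" where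
  "bump_mass \<epsilon> _ = integral UNIV (bump \<epsilon> (0::'e))"

lemma integral_superset:
  fixes w :: "'e::euclidean_space \<Rightarrow> real"
  assumes "\<And>z. z \<notin> B \<Longrightarrow> w z = 0"
  shows "integral UNIV w = integral B w"
proof -
  have "integral UNIV (\<lambda>z. if z \<in> B then w z else 0) = integral B w" by (rule integral_restrict_UNIV)
  moreover have "(\<lambda>z. if z \<in> B then w z else 0) = w" using assms by auto
  ultimately show ?thesis by simp
qed

lemma bump_integrable:
  assumes "0 < \<epsilon>" shows "integrable lborel (bump \<epsilon> y)"
proof -
  have "continuous_on (cball y \<epsilon>) (bump \<epsilon> y)" by (intro continuous_intros)
  then have "set_integrable lborel (cball y \<epsilon>) (bump \<epsilon> y)"
    unfolding set_integrable_def by (rule borel_integrable_compact[OF compact_cball])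
  moreover have "(\<lambda>z. indicator (cball y \<epsilon>) z *\<^sub>R bump \<epsilon> y z) = bump \<epsilon> y"
  proof
    fix z show "indicator (cball y \<epsilon>) z *\<^sub>R bump \<epsilon> y z = bump \<epsilon> y z"
      using bump_support(1)[OF assms, of z y] by (cases "z \<in> cball y \<epsilon>") auto
  qed
  ultimately show ?thesis unfolding set_integrable_def by simp
qed

lemma integral_bump:
  assumes "0 < \<epsilon>" shows "integral UNIV (bump \<epsilon> (y::'e::euclidean_space)) = bump_mass \<epsilon> TYPE('e)"
proof -
  have "integral UNIV (bump \<epsilon> y) = (\<integral>z. bump \<epsilon> y z \<partial>lborel)"
    by (rule integral_lborel[OF bump_integrable[OF assms]])
  also have "\<dots> = (\<integral>z. bump \<epsilon> y z \<partial>distr lborel borel ((+) y))" by (simp add: lborel_distr_plus)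
  also have "\<dots> = (\<integral>z. bump \<epsilon> y (y + z) \<partial>lborel)"
    using borel_measurable_integrable[OF bump_integrable[OF assms, of y]]
    by (intro integral_distr) auto
  also have "\<dots> = (\<integral>z. bump \<epsilon> (0::'e) z \<partial>lborel)" by (simp add: bump_def)
  also have "\<dots> = bump_mass \<epsilon> TYPE('e)"
    unfolding bump_mass_def by (rule integral_lborel[OF bump_integrable[OF assms], symmetric])
  finally show ?thesis .
qed

text \<open>A continuous nonnegative function with integral 0 over a box vanishes in its interior,
  but the bump equals 1 at its centre.\<close>

lemma bump_mass_pos:
  assumes "0 < \<epsilon>" shows "0 < bump_mass \<epsilon> TYPE('e::euclidean_space)"
proof -
  obtain a b :: 'e where ab: "cball 0 \<epsilon> \<subseteq> cbox a b"
    using bounded_subset_cbox_symmetric[OF bounded_cball] by metis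
  have c: "continuous_on (cbox a b) (bump \<epsilon> (0::'e))" by (intro continuous_intros)
  have "bump_mass \<epsilon> TYPE('e) = integral (cbox a b) (bump \<epsilon> 0)"
    unfolding bump_mass_def using ab bump_support(1)[OF assms] by (intro integral_superset) force
  moreover have "integral (cbox a b) (bump \<epsilon> (0::'e)) \<ge> 0"
    by (intro integral_nonneg integrable_continuous c) (simp add: bump_nonneg)
  moreover have "integral (cbox a b) (bump \<epsilon> (0::'e)) \<noteq> 0"
  proof
    assume "integral (cbox a b) (bump \<epsilon> (0::'e)) = 0"
    then have "(bump \<epsilon> (0::'e) has_integral 0) (cbox a b)"
      using integrable_continuous[OF c] by (metis integrable_integral)
    moreover have z: "0 \<in> box a b"
    proof -
      have "(0::'e) \<in> interior (cbox a b)"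
        using interior_mono[OF ab] assms by (auto simp: interior_cball)
      then show ?thesis by (simp add: interior_cbox)
    qed
    ultimately have "bump \<epsilon> (0::'e) 0 = 0"
      by (intro has_integral_0_cbox_imp_0[OF c _ _ _ box_subset_cbox[THEN subsetD]]) (auto simp: bump_nonneg)
    then show False by (simp add: bump_def cutoff_def)
  qed
  ultimately show ?thesis by linarith
qed

text \<open>The equation \<open>\<partial>\<^sub>t W - \<Delta> W = - F\<close> tested against
  compactly supported functions. The term \<open>F\<close> is kept separate from \<open>W\<close>,
  because for a difference of two solutions it is not a function of the difference.\<close>

definition weak_heat :: "(real \<times> 'a::euclidean_space \<Rightarrow> real) \<Rightarrow> (real \<times> 'a \<Rightarrow> real) \<Rightarrow> bool" where
  "weak_heat W F \<longleftrightarrow> continuous_on {z. 0 < fst z} W \<and> continuous_on {z. 0 < fst z} F \<and>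
    (\<forall>\<phi> D D2. test_fun \<phi> D D2 \<longrightarrow>
      ((\<lambda>z. W z * (- dt_test D z - lap_test D2 z) + F z * \<phi> z) has_integral 0) UNIV)"

lemma bump_average:
  fixes W :: "'e::euclidean_space \<Rightarrow> real"
  assumes \<epsilon>: "0 < \<epsilon>" and B: "cball y \<epsilon> \<subseteq> cbox a b" and W: "continuous_on (cbox a b) W"
    and close: "\<And>z. z \<in> cball y \<epsilon> \<Longrightarrow> \<bar>W z - W y\<bar> \<le> e"
  shows "\<bar>integral (cbox a b) (\<lambda>z. W z * bump \<epsilon> y z) / bump_mass \<epsilon> TYPE('e) - W y\<bar> \<le> e"
proof -
  define m where "m = bump_mass \<epsilon> TYPE('e)"
  have m: "0 < m" unfolding m_def by (rule bump_mass_pos[OF \<epsilon>])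
  have mi: "integral (cbox a b) (bump \<epsilon> y) = m"
    unfolding m_def integral_bump[OF \<epsilon>, of y, symmetric]
    using B bump_support(1)[OF \<epsilon>, of _ y] by (intro integral_superset[symmetric]) force
  have c: "continuous_on (cbox a b) (bump \<epsilon> y)" by (intro continuous_intros)
  have cW: "continuous_on (cbox a b) (\<lambda>z. W z * bump \<epsilon> y z)" by (intro continuous_intros W)
  have "integral (cbox a b) (\<lambda>z. W z * bump \<epsilon> y z) - W y * m
      = integral (cbox a b) (\<lambda>z. W z * bump \<epsilon> y z - W y * bump \<epsilon> y z)"
  proof (rule integral_unique[symmetric], rule has_integral_diff)
    show "((\<lambda>z. W z * bump \<epsilon> y z) has_integral integral (cbox a b) (\<lambda>z. W z * bump \<epsilon> y z)) (cbox a b)"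
      by (intro integrable_integral integrable_continuous cW)
    show "((\<lambda>z. W y * bump \<epsilon> y z) has_integral W y * m) (cbox a b)"
      unfolding mi[symmetric] by (intro has_integral_mult_right integrable_integral integrable_continuous c)
  qed
  also have "norm \<dots> \<le> integral (cbox a b) (\<lambda>z. e * bump \<epsilon> y z)"
  proof (rule integral_norm_bound_integral)
    show "(\<lambda>z. W z * bump \<epsilon> y z - W y * bump \<epsilon> y z) integrable_on cbox a b"
      by (intro integrable_continuous continuous_intros cW)
    show "(\<lambda>z. e * bump \<epsilon> y z) integrable_on cbox a b"
      by (intro integrable_continuous continuous_intros)
    fix z
    show "norm (W z * bump \<epsilon> y z - W y * bump \<epsilon> y z) \<le> e * bump \<epsilon> y z"
    proof (cases "z \<in> cball y \<epsilon>")
      case True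
      then show ?thesis using close[OF True] bump_nonneg[of \<epsilon> y z]
        by (simp add: left_diff_distrib[symmetric] abs_mult mult_right_mono)
    next
      case False
      then show ?thesis using bump_support(1)[OF \<epsilon>, of z y] by simp
    qed
  qed
  also have "\<dots> = e * m" using mi by simp
  finally have "\<bar>integral (cbox a b) (\<lambda>z. W z * bump \<epsilon> y z) - W y * m\<bar> \<le> e * m" by simp
  moreover have "integral (cbox a b) (\<lambda>z. W z * bump \<epsilon> y z) / m - W y = (integral (cbox a b) (\<lambda>z. W z * bump \<epsilon> y z) - W y * m) / m"
    using m by (simp add: diff_divide_distrib)
  ultimately show ?thesis unfolding m_def[symmetric] using m by (simp add: abs_divide pos_divide_le_eq)
qed

text \<open>As the centre moves in \<open>ball y \<epsilon>\<close>, the supports of the bumps stay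
  in \<open>cball y (2 * \<epsilon>)\<close> and thus in one fixed box. There the mollification is
  an integral with a parameter, to which the Leibniz rule applies; \<open>norm e \<le> 1\<close>
  keeps the moving centre in that ball for \<open>\<bar>s\<bar> < \<epsilon>\<close>.\<close>

lemma mollified_derivs:
  fixes W :: "'e::euclidean_space \<Rightarrow> real"
  assumes \<epsilon>: "0 < \<epsilon>" and B: "cball y (2 * \<epsilon>) \<subseteq> cbox a b" and W: "continuous_on (cbox a b) W"
    and e: "norm e \<le> 1"
  defines "M \<equiv> \<lambda>y. integral UNIV (\<lambda>z. W z * bump \<epsilon> y z)"
  shows "isCont M y"
    and "((\<lambda>s. M (y + s *\<^sub>R e)) has_real_derivative - integral (cbox a b) (\<lambda>z. W z * bump' \<epsilon> y z e)) (at 0)"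
    and "has_second_dir_deriv M y e (integral (cbox a b) (\<lambda>z. W z * bump'' \<epsilon> y z e e))"
proof -
  have sub: "cball x \<epsilon> \<subseteq> cbox a b" if "x \<in> ball y \<epsilon>" for x
  proof -
    have "cball x \<epsilon> \<subseteq> cball y (2 * \<epsilon>)"
      using that by (intro cball_subset_cball_iff[THEN iffD2]) (auto simp: dist_commute)
    with B show ?thesis by blast
  qed
  have M_eq: "M x = integral (cbox a b) (\<lambda>z. W z * bump \<epsilon> x z)" if "x \<in> ball y \<epsilon>" for x
    unfolding M_def using sub[OF that] bump_support(1)[OF \<epsilon>, of _ x] by (intro integral_superset) force
  have cW: "continuous_on (S \<times> cbox a b) (\<lambda>p. W (snd p))" for S :: "'x::topological_space set"
    by (rule continuous_on_compose2[OF W]) (auto intro!: continuous_intros)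
  have cont: "continuous_on (S \<times> cbox a b) (\<lambda>(x, z). W z * bump \<epsilon> (p x) z)"
    "continuous_on (S \<times> cbox a b) (\<lambda>(x, z). W z * - bump' \<epsilon> (p x) z e)"
    "continuous_on (S \<times> cbox a b) (\<lambda>(x, z). W z * bump'' \<epsilon> (p x) z e e)"
    if "continuous_on UNIV p" for p :: "'x::topological_space \<Rightarrow> 'e" and S
    unfolding split_beta
    by (intro continuous_intros cW continuous_on_compose2[OF that]; simp)+
  have "continuous_on (ball y \<epsilon>) (\<lambda>x. integral (cbox a b) (\<lambda>z. W z * bump \<epsilon> x z))"
    by (rule integral_continuous_on_param[OF cont(1)[OF continuous_on_id]])
  then have "continuous_on (ball y \<epsilon>) M" by (rule continuous_on_eq) (rule M_eq[symmetric])
  then show "isCont M y" using \<epsilon> by (simp add: continuous_on_eq_continuous_at)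
  define U where "U = ball (0::real) \<epsilon>"
  have U: "open U" "convex U" "0 \<in> U" using \<epsilon> by (auto simp: U_def)
  have inU: "y + s *\<^sub>R e \<in> ball y \<epsilon>" if "s \<in> U" for s
  proof -
    have "norm (s *\<^sub>R e) \<le> \<bar>s\<bar> * 1" using e by (simp add: mult_left_le)
    also have "\<dots> < \<epsilon>" using that by (simp add: U_def dist_real_def)
    finally show ?thesis by (simp add: dist_norm)
  qed
  have cp: "continuous_on UNIV (\<lambda>s::real. y + s *\<^sub>R e)" by (intro continuous_intros)
  have integ: "(\<lambda>z. W z * bump \<epsilon> x z) integrable_on cbox a b" "(\<lambda>z. W z * - bump' \<epsilon> x z e) integrable_on cbox a b" for x
    by (intro integrable_continuous continuous_intros W)+
  have D1: "((\<lambda>s. M (y + s *\<^sub>R e)) has_real_derivative integral (cbox a b) (\<lambda>z. W z * - bump' \<epsilon> (y + s *\<^sub>R e) z e)) (at s)"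
    if s: "s \<in> U" for s
  proof -
    have "((\<lambda>s. integral (cbox a b) (\<lambda>z. W z * bump \<epsilon> (y + s *\<^sub>R e) z)) has_field_derivative
        integral (cbox a b) (\<lambda>z. W z * - bump' \<epsilon> (y + s *\<^sub>R e) z e)) (at s within U)"
      by (rule leibniz_rule_field_derivative[OF _ integ(1) cont(2)[OF cp] s U(2)])
        (rule has_field_derivative_at_within[OF DERIV_cmult[OF bump_deriv_centre(1)]])
    then have "((\<lambda>s. integral (cbox a b) (\<lambda>z. W z * bump \<epsilon> (y + s *\<^sub>R e) z)) has_field_derivative
        integral (cbox a b) (\<lambda>z. W z * - bump' \<epsilon> (y + s *\<^sub>R e) z e)) (at s)"
      using at_within_open[OF s U(1)] by simp
    then show ?thesis
      by (rule has_field_derivative_transform_within_open[OF _ U(1) s]) (rule M_eq[OF inU, symmetric])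
  qed
  have D2: "((\<lambda>s. integral (cbox a b) (\<lambda>z. W z * - bump' \<epsilon> (y + s *\<^sub>R e) z e)) has_real_derivative
     integral (cbox a b) (\<lambda>z. W z * bump'' \<epsilon> (y + 0 *\<^sub>R e) z e e)) (at 0)"
  proof -
    have "((\<lambda>s. integral (cbox a b) (\<lambda>z. W z * - bump' \<epsilon> (y + s *\<^sub>R e) z e)) has_field_derivative
     integral (cbox a b) (\<lambda>z. W z * bump'' \<epsilon> (y + 0 *\<^sub>R e) z e e)) (at 0 within U)"
      by (rule leibniz_rule_field_derivative[OF _ integ(2) cont(3)[OF cp] U(3) U(2)])
        (rule has_field_derivative_at_within[OF DERIV_cmult[OF bump_deriv_centre(2)]])
    then show ?thesis using at_within_open[OF U(3) U(1)] by simp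
  qed
  show "((\<lambda>s. M (y + s *\<^sub>R e)) has_real_derivative - integral (cbox a b) (\<lambda>z. W z * bump' \<epsilon> y z e)) (at 0)"
    using D1[OF U(3)] by simp
  have "\<forall>\<^sub>F s in nhds 0. s \<in> U" using U by (intro eventually_nhds_in_open)
  then have "\<forall>\<^sub>F s in nhds 0. ((\<lambda>s. M (y + s *\<^sub>R e)) has_real_derivative integral (cbox a b) (\<lambda>z. W z * - bump' \<epsilon> (y + s *\<^sub>R e) z e)) (at s)"
    by eventually_elim (rule D1)
  with D2 show "has_second_dir_deriv M y e (integral (cbox a b) (\<lambda>z. W z * bump'' \<epsilon> y z e e))"
    unfolding has_second_dir_deriv_def
    by (intro exI[of _ "\<lambda>s. integral (cbox a b) (\<lambda>z. W z * - bump' \<epsilon> (y + s *\<^sub>R e) z e)"]) simp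
qed

text \<open>Testing the weak equation with the bump centred at \<open>z\<close> says that the
  mollification of \<open>W\<close> satisfies the equation pointwise, with the mollification of
  \<open>F\<close> on the right; on a compact set both mollifications are uniformly close to the
  originals.\<close>

lemma mollification:
  fixes W F :: "real \<times> 'a::euclidean_space \<Rightarrow> real"
  assumes weak: "weak_heat W F" and K: "compact K" "K \<subseteq> {z. 0 < fst z}" and e: "0 < e"
  obtains M where "continuous_on K M" "\<And>z. z \<in> K \<Longrightarrow> \<bar>M z - W z\<bar> \<le> e"
    "\<And>z. z \<in> K \<Longrightarrow> \<exists>T S. ((\<lambda>s. M (z + s *\<^sub>R (1, 0))) has_real_derivative T) (at 0) \<and>
       (\<forall>b\<in>Basis. has_second_dir_deriv M z (0, b) (S b)) \<and> T - (\<Sum>b\<in>Basis. S b) \<le> e - F z"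
proof -
  define P where "P = {z :: real \<times> 'a. 0 < fst z}"
  have P: "open P" unfolding P_def by (intro open_Collect_less continuous_intros)
  have cWF: "continuous_on P W" "continuous_on P F" using weak by (simp_all add: weak_heat_def P_def)
  have KP: "K \<subseteq> P" using K by (simp add: P_def)
  obtain r where r: "0 < r" "\<And>z. z \<in> K \<Longrightarrow> cball z r \<subseteq> P"
  proof -
    obtain r where "0 < r" "(\<Union>x\<in>K. cball x r) \<subseteq> P"
      using compact_subset_open_imp_cball_epsilon_subset[OF K(1) P KP] by blast
    with that show thesis by blast
  qed
  define K' where "K' = (\<Union>x\<in>K. cball x r)"
  have K': "compact K'" unfolding K'_def using compact_minkowski_sum_cball[OF K(1)] .
  have K'P: "K' \<subseteq> P" unfolding K'_def using r by blast
  have unif: "\<exists>d>0. \<forall>y\<in>K. \<forall>z\<in>cball y (min d r). \<bar>G z - G y\<bar> \<le> e" if G: "continuous_on P G" for G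
  proof -
    have "uniformly_continuous_on K' G"
      using compact_uniformly_continuous[OF continuous_on_subset[OF G K'P] K'] .
    then obtain d where d: "0 < d" "\<And>x y. x \<in> K' \<Longrightarrow> y \<in> K' \<Longrightarrow> dist y x < d \<Longrightarrow> dist (G y) (G x) < e"
      unfolding uniformly_continuous_on_def using e by blast
    have "\<bar>G z - G y\<bar> \<le> e" if "y \<in> K" "z \<in> cball y (min (d / 2) r)" for y z
    proof -
      have "y \<in> cball y r" "z \<in> cball y r" using that r(1) by auto
      then have "y \<in> K'" "z \<in> K'" using that(1) unfolding K'_def by blast+
      moreover have "dist z y < d" using that d(1) by (auto simp: dist_commute)
      ultimately show ?thesis using d(2)[of y z] by (simp add: dist_real_def)
    qed
    with d(1) show ?thesis by (intro exI[of _ "d / 2"]) auto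
  qed
  obtain d1 d2 where d: "0 < d1" "0 < d2"
    "\<And>y z. y \<in> K \<Longrightarrow> z \<in> cball y (min d1 r) \<Longrightarrow> \<bar>W z - W y\<bar> \<le> e"
    "\<And>y z. y \<in> K \<Longrightarrow> z \<in> cball y (min d2 r) \<Longrightarrow> \<bar>F z - F y\<bar> \<le> e"
    using unif[OF cWF(1)] unif[OF cWF(2)] by metis
  \<comment> \<open>The radii \<open>d1\<close> and \<open>d2\<close> make \<open>W\<close> and
    \<open>F\<close> vary by at most \<open>e\<close> on each support. The last entry keeps the box
    of half-width \<open>2 * \<epsilon>\<close> inside the ball of radius \<open>r\<close>, since
    the norm is at most the sum of the coordinates.\<close>
  define \<epsilon> where "\<epsilon> = min (min d1 d2) (r / (4 * real (DIM(real \<times> 'a))))"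
  have \<epsilon>: "0 < \<epsilon>" using d r by (simp add: \<epsilon>_def)
  have "r / (4 * real (DIM(real \<times> 'a))) \<le> r / 1" using r(1) by (intro divide_left_mono) auto
  then have \<epsilon>r: "\<epsilon> \<le> r" by (simp add: \<epsilon>_def)
  define lo hi where "lo y = y - (2 * \<epsilon>) *\<^sub>R One" and "hi y = y + (2 * \<epsilon>) *\<^sub>R One" for y :: "real \<times> 'a"
  have box1: "cball y (2 * \<epsilon>) \<subseteq> cbox (lo y) (hi y)" for y
  proof
    fix z assume z: "z \<in> cball y (2 * \<epsilon>)"
    show "z \<in> cbox (lo y) (hi y)" unfolding mem_box
    proof
      fix i :: "real \<times> 'a" assume i: "i \<in> Basis"
      have "\<bar>(z - y) \<bullet> i\<bar> \<le> 2 * \<epsilon>"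
        using Basis_le_norm[OF i, of "z - y"] z by (simp add: dist_norm norm_minus_commute)
      then show "lo y \<bullet> i \<le> z \<bullet> i \<and> z \<bullet> i \<le> hi y \<bullet> i"
        using i by (auto simp: lo_def hi_def inner_diff_left inner_add_left abs_le_iff algebra_simps)
    qed
  qed
  have box2: "cbox (lo y) (hi y) \<subseteq> P" if y: "y \<in> K" for y
  proof
    fix z assume z: "z \<in> cbox (lo y) (hi y)"
    have "norm (z - y) \<le> (\<Sum>i\<in>Basis. \<bar>(z - y) \<bullet> i\<bar>)" by (rule norm_le_l1)
    also have "\<dots> \<le> (\<Sum>i\<in>(Basis::(real \<times> 'a) set). 2 * \<epsilon>)"
    proof (rule sum_mono)
      fix i :: "real \<times> 'a" assume i: "i \<in> Basis"
      show "\<bar>(z - y) \<bullet> i\<bar> \<le> 2 * \<epsilon>"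
        using z i unfolding mem_box by (force simp: lo_def hi_def inner_diff_left inner_add_left abs_le_iff algebra_simps)
    qed
    also have "\<dots> = 2 * \<epsilon> * real (DIM(real \<times> 'a))" by simp
    also have "\<dots> \<le> 2 * (r / (4 * real (DIM(real \<times> 'a)))) * real (DIM(real \<times> 'a))"
      by (intro mult_right_mono mult_left_mono) (auto simp: \<epsilon>_def)
    also have "\<dots> \<le> r" using r(1) by (simp add: field_simps)
    finally have "z \<in> cball y r" by (simp add: dist_norm norm_minus_commute)
    then show "z \<in> P" using r(2)[OF y] by blast
  qed
  define m where "m = bump_mass \<epsilon> TYPE(real \<times> 'a)"
  have m: "0 < m" unfolding m_def by (rule bump_mass_pos[OF \<epsilon>])
  define N where "N y = integral UNIV (\<lambda>z. W z * bump \<epsilon> y z)" for y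
  define M where "M y = N y * inverse m" for y
  have cB: "continuous_on (cbox (lo y) (hi y)) W" "continuous_on (cbox (lo y) (hi y)) F" if "y \<in> K" for y
    using cWF box2[OF that] continuous_on_subset by blast+
  have b1: "cball y \<epsilon> \<subseteq> cbox (lo y) (hi y)" for y using box1[of y] \<epsilon> by (auto simp: subset_iff)
  show thesis
  proof (rule that[of M])
    have "isCont N y" if "y \<in> K" for y
      using mollified_derivs(1)[OF \<epsilon> box1 cB(1)[OF that], of 0] unfolding N_def by simp
    then show "continuous_on K M"
      unfolding M_def by (intro continuous_intros continuous_at_imp_continuous_on ballI)
  next
    fix y assume y: "y \<in> K"
    have "N y = integral (cbox (lo y) (hi y)) (\<lambda>z. W z * bump \<epsilon> y z)"
      unfolding N_def using b1[of y] bump_support(1)[OF \<epsilon>, of _ y] by (intro integral_superset) force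
    moreover have "\<bar>W z - W y\<bar> \<le> e" if "z \<in> cball y \<epsilon>" for z
      using that \<epsilon>r by (intro d(3)[OF y]) (auto simp: \<epsilon>_def)
    ultimately show "\<bar>M y - W y\<bar> \<le> e"
      using bump_average[OF \<epsilon> b1 cB(1)[OF y], where e=e] unfolding M_def m_def by (simp add: divide_inverse)
  next
    fix y assume y: "y \<in> K"
    let ?B = "cbox (lo y) (hi y)"
    define T where "T = - integral ?B (\<lambda>z. W z * bump' \<epsilon> y z (1, 0))"
    define S where "S b = integral ?B (\<lambda>z. W z * bump'' \<epsilon> y z (0, b) (0, b))" for b
    define I where "I = integral ?B (\<lambda>z. F z * bump \<epsilon> y z)"
    have T: "((\<lambda>s. N (y + s *\<^sub>R (1, 0))) has_real_derivative T) (at 0)"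
      unfolding N_def T_def by (rule mollified_derivs(2)[OF \<epsilon> box1 cB(1)[OF y]]) simp
    have S: "has_second_dir_deriv N y (0, b) (S b)" if "b \<in> Basis" for b
      unfolding N_def[abs_def] S_def
      by (rule mollified_derivs(3)[OF \<epsilon> box1 cB(1)[OF y]]) (use that in simp)
    have "y \<in> P" using y KP by blast
    have "\<epsilon> < fst y"
    proof -
      have "(fst y - \<epsilon>, snd y) \<in> cball y \<epsilon>" using \<epsilon> by (cases y) (simp add: dist_Pair_Pair dist_real_def)
      then have "(fst y - \<epsilon>, snd y) \<in> P" using b1 box2[OF y] by blast
      then show ?thesis by (simp add: P_def)
    qed
    then have tf: "test_fun (bump \<epsilon> y) (bump_D \<epsilon> y) (bump_D2 \<epsilon> y)" using \<epsilon> by (intro test_fun_bump)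
    have "((\<lambda>z. W z * (- dt_test (bump_D \<epsilon> y) z - lap_test (bump_D2 \<epsilon> y) z) + F z * bump \<epsilon> y z) has_integral 0) UNIV"
      using weak tf by (simp add: weak_heat_def)
    \<comment> \<open>Derivatives in the variable are now read as derivatives in the centre: the
      first-order term changes sign and becomes \<open>T\<close>, the second-order terms are the
      \<open>S b\<close>, and the tested equation becomes \<open>T\<close> minus their sum plus
      \<open>I\<close> equals 0.\<close>
    then have "integral UNIV (\<lambda>z. W z * (- bump' \<epsilon> y z (1, 0) - (\<Sum>b\<in>Basis. bump'' \<epsilon> y z (0, b) (0, b))) + F z * bump \<epsilon> y z) = 0"
      by (simp add: dt_test_def lap_test_def bump_D_apply bump_D2_apply integral_unique)
    moreover have "integral UNIV (\<lambda>z. W z * (- bump' \<epsilon> y z (1, 0) - (\<Sum>b\<in>Basis. bump'' \<epsilon> y z (0, b) (0, b))) + F z * bump \<epsilon> y z)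
        = integral ?B (\<lambda>z. W z * (- bump' \<epsilon> y z (1, 0) - (\<Sum>b\<in>Basis. bump'' \<epsilon> y z (0, b) (0, b))) + F z * bump \<epsilon> y z)"
    proof (rule integral_superset)
      fix z assume "z \<notin> ?B"
      then have "z \<notin> ball y \<epsilon>" using b1[of y] ball_subset_cball by blast
      then show "W z * (- bump' \<epsilon> y z (1, 0) - (\<Sum>b\<in>Basis. bump'' \<epsilon> y z (0, b) (0, b))) + F z * bump \<epsilon> y z = 0"
        using bump_support[OF \<epsilon> \<open>z \<notin> ball y \<epsilon>\<close>] by simp
    qed
    moreover have "\<dots> = T - (\<Sum>b\<in>Basis. S b) + I"
    proof -
      have i: "(\<lambda>z. W z * bump' \<epsilon> y z v) integrable_on ?B" "(\<lambda>z. W z * bump'' \<epsilon> y z v w) integrable_on ?B"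
        "(\<lambda>z. F z * bump \<epsilon> y z) integrable_on ?B" for v w
        by (intro integrable_continuous continuous_intros cB[OF y])+
      have "((\<lambda>z. - (W z * bump' \<epsilon> y z (1, 0)) - (\<Sum>b\<in>Basis. W z * bump'' \<epsilon> y z (0, b) (0, b)) + F z * bump \<epsilon> y z)
         has_integral T - (\<Sum>b\<in>Basis. S b) + I) ?B"
        unfolding T_def S_def I_def
        by (intro has_integral_add has_integral_diff has_integral_neg has_integral_sum integrable_integral i) auto
      then show ?thesis by (intro integral_unique) (simp add: algebra_simps sum_distrib_left)
    qed
    ultimately have TSI: "T - (\<Sum>b\<in>Basis. S b) = - I" by simp
    have "\<bar>F z - F y\<bar> \<le> e" if "z \<in> cball y \<epsilon>" for z
      using that \<epsilon>r by (intro d(4)[OF y]) (auto simp: \<epsilon>_def)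
    then have "\<bar>I / m - F y\<bar> \<le> e"
      using bump_average[OF \<epsilon> b1 cB(2)[OF y], where e=e] unfolding I_def m_def by simp
    moreover have "T * inverse m - (\<Sum>b\<in>Basis. S b * inverse m) = - (I / m)"
      using TSI by (simp add: divide_inverse sum_distrib_right[symmetric] left_diff_distrib[symmetric])
    ultimately have "T * inverse m - (\<Sum>b\<in>Basis. S b * inverse m) \<le> e - F y" by linarith
    moreover have "((\<lambda>s. M (y + s *\<^sub>R (1, 0))) has_real_derivative T * inverse m) (at 0)"
      unfolding M_def by (rule DERIV_cmult_right[OF T])
    moreover have "has_second_dir_deriv M y (0, b) (S b * inverse m)" if b: "b \<in> Basis" for b
      using S[OF b] unfolding has_second_dir_deriv_def M_def
      by (elim exE conjE) (intro exI conjI; (rule DERIV_cmult_right, assumption)?; (erule eventually_mono, rule DERIV_cmult_right)?)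
    ultimately show "\<exists>T S. ((\<lambda>s. M (y + s *\<^sub>R (1, 0))) has_real_derivative T) (at 0) \<and>
       (\<forall>b\<in>Basis. has_second_dir_deriv M y (0, b) (S b)) \<and> T - (\<Sum>b\<in>Basis. S b) \<le> e - F y"
      by (intro exI[of _ "T * inverse m"] exI[of _ "\<lambda>b. S b * inverse m"]) blast
  qed
qed

section \<open>Maximum principle against the barrier\<close>

context keller_osserman
begin

text \<open>If \<open>W\<close> exceeded \<open>Z = barrier + E\<close> at some point, then a
  mollification of \<open>W\<close> minus \<open>Z\<close> would have a maximum away from the faces,
  by blow-up, and away from the initial time, by \<open>init\<close>. There the equation for
  \<open>W\<close>, the supersolution property of the barrier and that of \<open>E\<close> for the
  heat equation contradict superadditivity.\<close>

lemma barrier_comparison: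
  fixes W F E :: "real \<times> 'a::euclidean_space \<Rightarrow> real"
  assumes weak: "weak_heat W F"
    and F: "\<And>z. 0 < fst z \<Longrightarrow> 0 \<le> W z \<Longrightarrow> f (W z) \<le> F z"
    and R: "0 < R" and \<tau>: "0 < \<tau>" "\<tau> < t"
    and E_cont: "continuous_on ({\<tau>..t} \<times> UNIV) E"
    and E_nonneg: "\<And>z. 0 \<le> E z"
    and E_heat: "\<And>s x. \<tau> < s \<Longrightarrow> s \<le> t \<Longrightarrow> \<exists>T S. ((\<lambda>r. E ((s, x) + r *\<^sub>R (1, 0))) has_real_derivative T) (at 0)
       \<and> (\<forall>b\<in>Basis. has_second_dir_deriv E (s, x) (0, b) (S b)) \<and> (\<Sum>b\<in>Basis. S b) \<le> T"
    and init: "\<And>x. x \<in> cube R \<Longrightarrow> W (\<tau>, x) \<le> E (\<tau>, x)"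
    and x: "x \<in> cube R"
  shows "W (t, x) \<le> barrier R x + E (t, x)"
proof (rule ccontr)
  assume contra: "\<not> ?thesis"
  define Z where "Z z = barrier R (snd z) + E z" for z
  define m where "m = W (t, x) - Z (t, x)"
  have m: "0 < m" using contra by (simp add: m_def Z_def)
  have W_cont: "continuous_on {z. 0 < fst z} W" using weak by (simp add: weak_heat_def)
  \<comment> \<open>On the closed cube \<open>W\<close> is bounded although the barrier is not, so
    near the faces the barrier alone exceeds \<open>W\<close>.\<close>
  obtain C where C: "\<And>z. z \<in> {\<tau>..t} \<times> cbox (- (R *\<^sub>R One)) (R *\<^sub>R One) \<Longrightarrow> W z \<le> C"
  proof -
    have "compact (W ` ({\<tau>..t} \<times> cbox (- (R *\<^sub>R One)) (R *\<^sub>R One)))"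
      by (intro compact_continuous_image continuous_on_subset[OF W_cont] compact_Times compact_cbox)
        (use \<tau> in auto)
    then have "bdd_above (W ` ({\<tau>..t} \<times> cbox (- (R *\<^sub>R One)) (R *\<^sub>R One)))"
      by (intro bounded_imp_bdd_above compact_imp_bounded)
    then show thesis using that unfolding bdd_above_def by blast
  qed
  have cube_cbox: "y \<in> cbox (- (r *\<^sub>R One)) (r *\<^sub>R One) \<longleftrightarrow> (\<forall>b\<in>Basis. \<bar>y \<bullet> b\<bar> \<le> r)" for y :: 'a and r
    unfolding mem_box by (auto simp: abs_le_iff minus_le_iff)
  obtain R' where R': "0 < R'" "R' < R"
    and blow: "\<And>(x::'a) b. x \<in> cube R \<Longrightarrow> b \<in> Basis \<Longrightarrow> R' \<le> \<bar>x \<bullet> b\<bar> \<Longrightarrow> C < barrier R x"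
    using barrier_blow_up[OF R] by metis
  have inside: "\<forall>b\<in>Basis. \<bar>y \<bullet> b\<bar> < R'" if "s \<in> {\<tau>..t}" "y \<in> cube R" "0 < W (s, y) - Z (s, y)" for s y
  proof (rule ccontr)
    assume "\<not> ?thesis"
    then obtain b where "b \<in> Basis" "R' \<le> \<bar>y \<bullet> b\<bar>" by (auto simp: not_less)
    then have "C < barrier R y" by (rule blow[OF that(2)])
    also have "\<dots> \<le> Z (s, y)" using E_nonneg by (simp add: Z_def)
    also have "\<dots> < W (s, y)" using that by simp
    also have "\<dots> \<le> C" using that by (intro C) (auto simp: cube_cbox cube_def less_imp_le)
    finally show False by simp
  qed
  define Q where "Q = cbox (- (R' *\<^sub>R One)) (R' *\<^sub>R (One::'a))"
  have Q_cube: "Q \<subseteq> cube R" using R' by (force simp: Q_def cube_cbox cube_def)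
  define K where "K = {\<tau>..t} \<times> Q"
  have K: "compact K" "K \<subseteq> {z. 0 < fst z}"
    using \<tau> by (auto simp: K_def Q_def intro!: compact_Times)
  \<comment> \<open>The bound \<open>m / 4\<close> leaves a gap of at least \<open>m / 2\<close>
    between \<open>W\<close> and \<open>Z\<close> at the maximum point for the mollification; the
    bound \<open>f (m / 2) / 2\<close> makes the mollification error smaller than the absorption
    produced by this gap.\<close>
  define e where "e = min (m / 4) (f (m / 2) / 2)"
  have e: "0 < e" using m f_pos[of "m / 2"] by (simp add: e_def)
  obtain M where M_cont: "continuous_on K M" and M_close: "\<And>z. z \<in> K \<Longrightarrow> \<bar>M z - W z\<bar> \<le> e"
    and M_heat: "\<And>z. z \<in> K \<Longrightarrow> \<exists>T S. ((\<lambda>s. M (z + s *\<^sub>R (1, 0))) has_real_derivative T) (at 0) \<and>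
       (\<forall>b\<in>Basis. has_second_dir_deriv M z (0, b) (S b)) \<and> T - (\<Sum>b\<in>Basis. S b) \<le> e - F z"
    using mollification[OF weak K e] by blast
  have tx: "(t, x) \<in> K"
    using inside[of t x] x m \<tau> by (auto simp: K_def Q_def cube_cbox m_def intro: less_imp_le)
  have "continuous_on K (\<lambda>z. M z - Z z)"
    unfolding Z_def
  proof (intro continuous_intros M_cont)
    show "continuous_on K (\<lambda>z. barrier R (snd z))"
      by (rule continuous_on_compose2[OF barrier_cont]) (use Q_cube in \<open>auto simp: K_def intro!: continuous_intros\<close>)
    show "continuous_on K E" by (rule continuous_on_subset[OF E_cont]) (auto simp: K_def)
  qed
  then obtain z0 where z0: "z0 \<in> K" and max: "\<And>z. z \<in> K \<Longrightarrow> M z - Z z \<le> M z0 - Z z0"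
    using continuous_attains_sup[OF K(1)] tx by blast
  obtain s0 x0 where z0_eq: "z0 = (s0, x0)" by (cases z0)
  have WZ: "m / 2 \<le> W z0 - Z z0"
  proof -
    have "m - e \<le> M (t, x) - Z (t, x)" using M_close[OF tx] unfolding m_def by linarith
    also have "\<dots> \<le> M z0 - Z z0" by (rule max[OF tx])
    also have "\<dots> \<le> W z0 + e - Z z0" using M_close[OF z0] by linarith
    finally show ?thesis by (simp add: e_def)
  qed
  have x0: "x0 \<in> cube R" "s0 \<in> {\<tau>..t}" using z0 Q_cube by (auto simp: K_def z0_eq)
  have x0_in: "\<forall>b\<in>Basis. \<bar>x0 \<bullet> b\<bar> < R'" using WZ m by (intro inside[OF x0(2,1)]) (simp add: z0_eq)
  \<comment> \<open>At time \<open>\<tau>\<close> the datum bound gives \<open>W \<le> E\<close>,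
    and the positive barrier makes this strictly less than \<open>Z\<close>, which a positive gap
    excludes.\<close>
  have s0: "\<tau> < s0"
  proof (rule ccontr)
    assume "\<not> ?thesis"
    then have "s0 = \<tau>" using x0(2) by simp
    then have "W z0 \<le> E z0" using init[OF x0(1)] by (simp add: z0_eq)
    also have "\<dots> < Z z0" using barrier_pos[OF x0(1)] by (simp add: Z_def z0_eq)
    finally show False using WZ m by simp
  qed
  obtain T S where T: "((\<lambda>s. M (z0 + s *\<^sub>R (1, 0))) has_real_derivative T) (at 0)"
    and S: "\<And>b. b \<in> Basis \<Longrightarrow> has_second_dir_deriv M z0 (0, b) (S b)"
    and TS: "T - (\<Sum>b\<in>Basis. S b) \<le> e - F z0"
    using M_heat[OF z0] by blast
  obtain T' S' where T': "((\<lambda>s. E (z0 + s *\<^sub>R (1, 0))) has_real_derivative T') (at 0)"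
    and S': "\<And>b. b \<in> Basis \<Longrightarrow> has_second_dir_deriv E z0 (0, b) (S' b)"
    and TS': "(\<Sum>b\<in>Basis. S' b) \<le> T'"
    using E_heat[OF s0, of x0] x0(2) unfolding z0_eq by auto
  obtain d where d: "\<And>b. b \<in> Basis \<Longrightarrow> has_second_dir_deriv (barrier R) x0 b (d b)"
    and d_le: "(\<Sum>b\<in>Basis. d b) \<le> f (barrier R x0)"
    using barrier_laplacian[OF x0(1)] by blast
  \<comment> \<open>Only earlier times are compared, because \<open>s0\<close> may be the final time
    \<open>t\<close>; hence an inequality rather than equality of the time derivatives.\<close>
  have "T' \<le> T"
  proof (rule ccontr)
    assume neg: "\<not> ?thesis"
    have "((\<lambda>s. M (z0 + s *\<^sub>R (1, 0)) - (barrier R x0 + E (z0 + s *\<^sub>R (1, 0)))) has_real_derivative T - (0 + T')) (at 0)"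
      by (intro DERIV_diff DERIV_add T T' DERIV_const)
    then have "((\<lambda>s. M (z0 + s *\<^sub>R (1, 0)) - Z (z0 + s *\<^sub>R (1, 0))) has_real_derivative T - T') (at 0)"
      by (simp add: Z_def z0_eq)
    from DERIV_neg_dec_left[OF this] neg obtain \<delta> where \<delta>: "0 < \<delta>"
      "\<And>h. 0 < h \<Longrightarrow> h < \<delta> \<Longrightarrow> M z0 - Z z0 < M (z0 + (- h) *\<^sub>R (1, 0)) - Z (z0 + (- h) *\<^sub>R (1, 0))"
      by (auto simp flip: zero_prod_def)
    define h where "h = min \<delta> (s0 - \<tau>) / 2"
    have h: "0 < h" "h < \<delta>" "h \<le> s0 - \<tau>" using \<delta>(1) s0 by (auto simp: h_def)
    have "z0 + (- h) *\<^sub>R (1, 0) \<in> K" using z0 h by (auto simp: K_def z0_eq)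
    from max[OF this] \<delta>(2)[OF h(1,2)] show False by simp
  qed
  moreover have "S b \<le> d b + S' b" if b: "b \<in> Basis" for b
  proof -
    have "has_second_dir_deriv (\<lambda>z. barrier R (snd z)) z0 (0, b) (d b)"
      using d[OF b] by (simp add: has_second_dir_deriv_def z0_eq)
    then have "has_second_dir_deriv (\<lambda>z. M z + - (barrier R (snd z) + E z)) z0 (0, b) (S b + - (d b + S' b))"
      by (intro has_second_dir_deriv_add has_second_dir_deriv_minus S S' b)
    then have "S b + - (d b + S' b) \<le> 0"
    proof (rule second_dir_deriv_nonpos_at_max)
      have "((\<lambda>s. x0 + s *\<^sub>R b) \<longlongrightarrow> x0 + 0 *\<^sub>R b) (nhds 0)"
        by (intro tendsto_intros filterlim_ident)
      moreover have "x0 + 0 *\<^sub>R b \<in> box (- (R' *\<^sub>R One)) (R' *\<^sub>R One)"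
        unfolding mem_box using x0_in by (auto simp: abs_less_iff minus_less_iff)
      ultimately have "\<forall>\<^sub>F s in nhds 0. x0 + s *\<^sub>R b \<in> box (- (R' *\<^sub>R One)) (R' *\<^sub>R One)"
        by (rule topological_tendstoD[OF _ open_box])
      then show "\<forall>\<^sub>F s in nhds 0. M (z0 + s *\<^sub>R (0, b)) + - (barrier R (snd (z0 + s *\<^sub>R (0, b))) + E (z0 + s *\<^sub>R (0, b)))
         \<le> M z0 + - (barrier R (snd z0) + E z0)"
      proof eventually_elim
        case (elim s)
        then have "z0 + s *\<^sub>R (0, b) \<in> K"
          using x0(2) box_subset_cbox by (auto simp: K_def Q_def z0_eq)
        from max[OF this] show ?case by (simp add: Z_def)
      qed
    qed
    then show ?thesis by simp
  qed
  then have "(\<Sum>b\<in>Basis. S b) \<le> (\<Sum>b\<in>Basis. d b) + (\<Sum>b\<in>Basis. S' b)"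
    unfolding sum.distrib[symmetric] by (intro sum_mono)
  \<comment> \<open>Superadditivity splits off \<open>f (m / 2)\<close>, the strict gain, from the
    part of the absorption that the Laplacian of the barrier cancels.\<close>
  moreover have "f (barrier R x0) + f (m / 2) \<le> F z0"
  proof -
    have V: "0 \<le> barrier R x0" using barrier_pos[OF x0(1)] by simp
    have le: "barrier R x0 + m / 2 \<le> W z0" using WZ E_nonneg[of z0] by (simp add: Z_def z0_eq)
    have "f (barrier R x0) + f (m / 2) \<le> f (barrier R x0 + m / 2)"
      using V m by (intro f_superadditive) auto
    also have "\<dots> \<le> f (W z0)" using V m le by (intro f_mono) auto
    also have "\<dots> \<le> F z0" using V m le z0 K by (intro F) auto
    finally show ?thesis .
  qed
  ultimately have "f (m / 2) \<le> e" using TS TS' d_le by linarith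
  also have "\<dots> \<le> f (m / 2) / 2" by (simp add: e_def)
  finally show False using f_pos[of "m / 2"] m by simp
qed

end

section \<open>The heat kernel and comparison of solutions\<close>

lemma lborel_integral_affine:
  fixes g :: "'a::euclidean_space \<Rightarrow> real"
  assumes g: "g \<in> borel_measurable borel" and c: "c \<noteq> 0"
  shows "(\<integral>y. g y \<partial>lborel) = \<bar>c\<bar> ^ DIM('a) * (\<integral>\<xi>. g (x + c *\<^sub>R \<xi>) \<partial>lborel)"
proof -
  have "(\<integral>y. g y \<partial>lborel) = (\<integral>y. g y \<partial>density (distr lborel borel (\<lambda>\<xi>. x + c *\<^sub>R \<xi>)) (\<lambda>_. ennreal (\<bar>c\<bar> ^ DIM('a))))"
    using lborel_affine[OF c, of x] by (simp add: ennreal_power)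
  also have "\<dots> = (\<integral>y. \<bar>c\<bar> ^ DIM('a) *\<^sub>R g y \<partial>distr lborel borel (\<lambda>\<xi>. x + c *\<^sub>R \<xi>))"
    using g by (intro integral_density) auto
  also have "\<dots> = (\<integral>\<xi>. \<bar>c\<bar> ^ DIM('a) *\<^sub>R g (x + c *\<^sub>R \<xi>) \<partial>lborel)"
    using g by (intro integral_distr) auto
  finally show ?thesis by simp
qed

text \<open>The Gaussian is a product over coordinates, so finiteness in one dimension is enough;
  there it lies below an exponential of \<open>- \<bar>s\<bar>\<close>.\<close>

lemma gauss_integrable: "integrable lborel (\<lambda>x::'a::euclidean_space. exp (- (norm x)\<^sup>2 / 4))"
proof (rule integrableI_nonneg)
  have half: "(\<integral>\<^sup>+x. ennreal (exp (1 - x)) * indicator {0..} x \<partial>lborel) = ennreal (0 - (- exp (1 - 0)))"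
  proof (rule nn_integral_FTC_atLeast)
    have "((\<lambda>x::real. - exp 1 * exp (- x)) \<longlongrightarrow> - exp 1 * 0) at_top"
      by (intro tendsto_intros filterlim_compose[OF exp_at_bot] filterlim_uminus_at_bot_at_top)
    then show "((\<lambda>x::real. - exp (1 - x)) \<longlongrightarrow> 0) at_top" by (simp add: exp_diff exp_minus divide_inverse)
  qed (auto intro!: derivative_eq_intros)
  have one: "(\<integral>\<^sup>+s. ennreal (exp (- s\<^sup>2 / 4)) \<partial>(lborel::real measure)) < \<infinity>"
  proof -
    have "ennreal (exp (- s\<^sup>2 / 4)) \<le> ennreal (exp (1 - s)) * indicator {0..} s + ennreal (exp (1 - - s)) * indicator {0..} (- s)" for s :: real
    proof -
      \<comment> \<open>Expanding this square gives exactly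
        \<open>- s\<^sup>2 / 4 \<le> 1 - \<bar>s\<bar>\<close>, the exponential majorant.\<close>
      have "0 \<le> (\<bar>s\<bar> / 2 - 1)\<^sup>2" by simp
      then have "- s\<^sup>2 / 4 \<le> 1 - \<bar>s\<bar>" by (simp add: power2_diff power_divide)
      then have "ennreal (exp (- s\<^sup>2 / 4)) \<le> ennreal (exp (1 - \<bar>s\<bar>))" by (intro ennreal_leI) simp
      then show ?thesis by (cases "0 \<le> s") (auto simp: indicator_def intro: order_trans add_increasing2)
    qed
    then have "(\<integral>\<^sup>+s. ennreal (exp (- s\<^sup>2 / 4)) \<partial>(lborel::real measure)) \<le>
        (\<integral>\<^sup>+s. ennreal (exp (1 - s)) * indicator {0..} s + ennreal (exp (1 - - s)) * indicator {0..} (- s) \<partial>(lborel::real measure))"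
      by (intro nn_integral_mono)
    also have "\<dots> = (\<integral>\<^sup>+s. ennreal (exp (1 - s)) * indicator {0..} s \<partial>lborel) + (\<integral>\<^sup>+s. ennreal (exp (1 - - s)) * indicator {0..} (- s) \<partial>(lborel::real measure))"
      by (intro nn_integral_add) auto
    also have "(\<integral>\<^sup>+s. ennreal (exp (1 - - s)) * indicator {0..} (- s) \<partial>(lborel::real measure)) = (\<integral>\<^sup>+s. ennreal (exp (1 - s)) * indicator {0..} s \<partial>lborel)"
      using nn_integral_real_affine[of "\<lambda>s. ennreal (exp (1 - s)) * indicator {0..} s" "-1" 0] by simp
    finally show ?thesis unfolding half by (auto simp: ennreal_add_eq_top top_unique less_top[symmetric] simp flip: ennreal_plus)
  qed
  have "(\<integral>\<^sup>+x. ennreal (exp (- (norm (x::'a))\<^sup>2 / 4)) \<partial>lborel) = (\<integral>\<^sup>+x. (\<Prod>b\<in>(Basis::'a set). ennreal (exp (- (x \<bullet> b)\<^sup>2 / 4))) \<partial>lborel)"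
  proof (rule nn_integral_cong)
    fix x :: 'a
    have "(norm x)\<^sup>2 = (\<Sum>b\<in>Basis. (x \<bullet> b)\<^sup>2)"
      unfolding power2_norm_eq_inner by (subst euclidean_inner) (simp add: power2_eq_square)
    then show "ennreal (exp (- (norm x)\<^sup>2 / 4)) = (\<Prod>b\<in>Basis. ennreal (exp (- (x \<bullet> b)\<^sup>2 / 4)))"
      by (simp add: prod_ennreal exp_sum[symmetric] sum_negf sum_divide_distrib[symmetric])
  qed
  also have "\<dots> = (\<Prod>b\<in>(Basis::'a set). \<integral>\<^sup>+s. ennreal (exp (- s\<^sup>2 / 4)) \<partial>lborel)"
    by (rule nn_integral_lborel_prod) auto
  also have "\<dots> < \<infinity>" using one by (auto simp: less_top_ennreal ennreal_power intro: zero_le_power)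
  finally show "(\<integral>\<^sup>+x. ennreal (exp (- (norm (x::'a))\<^sup>2 / 4)) \<partial>lborel) < \<infinity>" .
qed auto

text \<open>The constant \<open>(4 \<pi>)^(N/2)\<close>, left unevaluated.\<close>

definition gauss_mass :: "'a::euclidean_space itself \<Rightarrow> real" where
  "gauss_mass _ = (\<integral>x. exp (- (norm (x::'a))\<^sup>2 / 4) \<partial>lborel)"

lemma gauss_mass_pos: "0 < gauss_mass TYPE('a::euclidean_space)"
proof -
  have "gauss_mass TYPE('a) \<noteq> 0"
  proof
    assume "gauss_mass TYPE('a) = 0"
    then have "AE x::'a in lborel. exp (- (norm x)\<^sup>2 / 4) = 0"
      unfolding gauss_mass_def by (subst (asm) integral_nonneg_eq_0_iff_AE[OF gauss_integrable]) auto
    then have "AE x::'a in lborel. False" by simp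
    then show False by (simp add: AE_iff_null null_sets_def)
  qed
  moreover have "0 \<le> gauss_mass TYPE('a)" unfolding gauss_mass_def by simp
  ultimately show ?thesis by simp
qed

text \<open>The factor \<open>t\<^sup>-\<^sup>N\<^sup>/\<^sup>2\<close> is kept inside the exponential, where it is easier to differentiate.\<close>

definition heat_kernel :: "real \<Rightarrow> 'a::euclidean_space \<Rightarrow> real" where
  "heat_kernel t z = exp (- (z \<bullet> z) / (4 * t) - (DIM('a) / 2) * ln t) / gauss_mass TYPE('a)"

abbreviation gauss :: "'a::euclidean_space \<Rightarrow> real" where "gauss \<equiv> heat_kernel 1"

lemma gauss_eq: "gauss (x::'a::euclidean_space) = exp (- (norm x)\<^sup>2 / 4) / gauss_mass TYPE('a)"
  by (simp add: heat_kernel_def power2_norm_eq_inner)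

lemma integrable_gauss: "integrable lborel gauss"
  unfolding gauss_eq[abs_def] by (intro integrable_divide gauss_integrable)

lemma gauss_measurable [measurable]: "gauss \<in> borel_measurable borel"
  using borel_measurable_integrable[OF integrable_gauss] by simp

lemma integral_gauss: "(\<integral>x. gauss (x::'a::euclidean_space) \<partial>lborel) = 1"
  unfolding gauss_eq[abs_def] using gauss_mass_pos[where 'a='a] by (simp add: gauss_mass_def)

lemma heat_kernel_pos: "0 < heat_kernel t (z::'a::euclidean_space)"
  using gauss_mass_pos[where 'a='a] by (simp add: heat_kernel_def)

lemma nn_integral_gauss: "(\<integral>\<^sup>+x. ennreal (gauss (x::'a::euclidean_space)) \<partial>lborel) = 1"
  using nn_integral_eq_integral[of lborel "gauss :: 'a \<Rightarrow> real", OF integrable_gauss AE_I2[OF less_imp_le[OF heat_kernel_pos]]]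
  unfolding integral_gauss by simp

lemma sqrt_power_eq_exp:
  assumes "0 < t" shows "sqrt t ^ n = exp (real n / 2 * ln t)"
proof -
  have "sqrt t = exp (ln t / 2)" using assms by (simp add: ln_sqrt[symmetric])
  then show ?thesis using exp_of_nat_mult[of n "ln t / 2"] by simp
qed

lemma heat_kernel_scale:
  assumes "0 < t"
  shows "sqrt t ^ DIM('a) * heat_kernel t (sqrt t *\<^sub>R (z::'a::euclidean_space)) = gauss z"
proof -
  have "(sqrt t *\<^sub>R z) \<bullet> (sqrt t *\<^sub>R z) = t * (z \<bullet> z)" using assms by (simp add: mult.assoc[symmetric])
  then have "- ((sqrt t *\<^sub>R z) \<bullet> (sqrt t *\<^sub>R z)) / (4 * t) = - (z \<bullet> z) / 4"
    using assms by (simp only: minus_mult_right[symmetric]) simp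
  then show ?thesis unfolding heat_kernel_def sqrt_power_eq_exp[OF assms]
    by (simp only: exp_diff) simp
qed

lemma heat_kernel_le:
  assumes "0 < t"
  shows "heat_kernel t (z::'a::euclidean_space) \<le> 1 / (gauss_mass TYPE('a) * sqrt t ^ DIM('a))"
proof -
  have "exp (- (z \<bullet> z) / (4 * t) - (DIM('a) / 2) * ln t) \<le> exp (- ((DIM('a) / 2) * ln t))"
    using assms by simp
  also have "\<dots> = 1 / sqrt t ^ DIM('a)" unfolding sqrt_power_eq_exp[OF assms] by (simp only: exp_minus inverse_eq_divide)
  finally have "exp (- (z \<bullet> z) / (4 * t) - (DIM('a) / 2) * ln t) / gauss_mass TYPE('a) \<le> 1 / sqrt t ^ DIM('a) / gauss_mass TYPE('a)"
    using gauss_mass_pos[where 'a='a] by (intro divide_right_mono) auto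
  then show ?thesis unfolding heat_kernel_def divide_divide_eq_left by (simp only: mult.commute)
qed

definition heat_kernel_t :: "real \<Rightarrow> 'a::euclidean_space \<Rightarrow> real" where
  "heat_kernel_t t z = heat_kernel t z * ((z \<bullet> z) / (4 * t\<^sup>2) - DIM('a) / (2 * t))"

definition heat_kernel_x :: "real \<Rightarrow> 'a::euclidean_space \<Rightarrow> 'a \<Rightarrow> real" where
  "heat_kernel_x t z e = - heat_kernel t z * ((z \<bullet> e) / (2 * t))"

definition heat_kernel_xx :: "real \<Rightarrow> 'a::euclidean_space \<Rightarrow> 'a \<Rightarrow> real" where
  "heat_kernel_xx t z e = heat_kernel t z * ((z \<bullet> e)\<^sup>2 / (4 * t\<^sup>2) - (e \<bullet> e) / (2 * t))"

lemma heat_kernel_equation: "(\<Sum>b\<in>Basis. heat_kernel_xx t z b) = heat_kernel_t t (z::'a::euclidean_space)"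
proof -
  have "(z \<bullet> z) = (\<Sum>b\<in>Basis. (z \<bullet> b)\<^sup>2)" by (subst euclidean_inner) (simp add: power2_eq_square)
  moreover have "(\<Sum>b\<in>(Basis::'a set). b \<bullet> b) = DIM('a)" by (simp add: inner_Basis)
  ultimately show ?thesis
    unfolding heat_kernel_xx_def heat_kernel_t_def
    by (simp add: sum_distrib_left[symmetric] sum_subtractf sum_divide_distrib[symmetric])
qed

lemma heat_kernel_deriv_t:
  assumes "0 < t" shows "((\<lambda>t. heat_kernel t z) has_real_derivative heat_kernel_t t z) (at t)"
proof -
  have "((\<lambda>t. - (z \<bullet> z) / (4 * t) - (DIM('a) / 2) * ln t) has_real_derivative (z \<bullet> z) / (4 * t\<^sup>2) - DIM('a) / (2 * t)) (at t)"
    using assms by (auto intro!: derivative_eq_intros simp: field_simps power2_eq_square)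
  from DERIV_cdivide[OF DERIV_chain2[OF DERIV_exp this], of "gauss_mass TYPE('a)"]
  show ?thesis unfolding heat_kernel_def heat_kernel_t_def by simp
qed

lemma heat_kernel_deriv_x:
  shows "((\<lambda>s. heat_kernel t (z + s *\<^sub>R e)) has_real_derivative heat_kernel_x t (z + s *\<^sub>R e) e) (at s)"
    and "((\<lambda>s. heat_kernel_x t (z + s *\<^sub>R e) e) has_real_derivative heat_kernel_xx t (z + s *\<^sub>R e) e) (at s)"
proof -
  define q where "q s = - ((z + s *\<^sub>R e) \<bullet> (z + s *\<^sub>R e)) / (4 * t) - (DIM('a) / 2) * ln t" for s
  define l where "l s = ((z + s *\<^sub>R e) \<bullet> e) / (2 * t)" for s
  have l: "(l has_real_derivative (e \<bullet> e) / (2 * t)) (at s)" for s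
    unfolding l_def divide_inverse by (auto intro!: derivative_eq_intros simp: inner_add_left)
  have q: "(q has_real_derivative - l s) (at s)" for s
  proof -
    have "(z + s *\<^sub>R e) \<bullet> (z + s *\<^sub>R e) = z \<bullet> z + 2 * s * (z \<bullet> e) + s\<^sup>2 * (e \<bullet> e)" for s
      by (simp add: inner_add_left inner_add_right inner_commute power2_eq_square)
    then have "q = (\<lambda>s. - (z \<bullet> z + 2 * s * (z \<bullet> e) + s\<^sup>2 * (e \<bullet> e)) * inverse (4 * t) - (DIM('a) / 2) * ln t)"
      unfolding q_def divide_inverse by simp
    moreover have "- (2 * (z \<bullet> e) + 2 * s * (e \<bullet> e)) * inverse (4 * t) = - l s"
      unfolding l_def divide_inverse by (simp add: inner_add_left algebra_simps)
    ultimately show ?thesis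
      by (auto intro!: derivative_eq_intros)
  qed
  define G where "G s = heat_kernel t (z + s *\<^sub>R e)" for s
  have G: "(G has_real_derivative G s * - l s) (at s)" for s
    using DERIV_cdivide[OF DERIV_chain2[OF DERIV_exp q], of "gauss_mass TYPE('a)"]
    unfolding G_def heat_kernel_def q_def[symmetric] by simp
  show "((\<lambda>s. heat_kernel t (z + s *\<^sub>R e)) has_real_derivative heat_kernel_x t (z + s *\<^sub>R e) e) (at s)"
    using G[of s] unfolding heat_kernel_x_def G_def[symmetric] l_def[symmetric] by simp
  have "((\<lambda>s. - G s * l s) has_real_derivative - (G s * - l s) * l s + (e \<bullet> e) / (2 * t) * - G s) (at s)"
    by (intro DERIV_mult DERIV_minus G l)
  moreover have "- (G s * - l s) * l s + (e \<bullet> e) / (2 * t) * - G s = G s * ((l s)\<^sup>2 - (e \<bullet> e) / (2 * t))"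
    by (simp add: algebra_simps power2_eq_square)
  moreover have "heat_kernel_xx t (z + s *\<^sub>R e) e = G s * ((l s)\<^sup>2 - (e \<bullet> e) / (2 * t))"
    by (simp add: heat_kernel_xx_def G_def l_def power_divide power2_eq_square)
  moreover have "(\<lambda>s. heat_kernel_x t (z + s *\<^sub>R e) e) = (\<lambda>s. - G s * l s)"
    by (simp add: heat_kernel_x_def G_def l_def)
  ultimately show "((\<lambda>s. heat_kernel_x t (z + s *\<^sub>R e) e) has_real_derivative heat_kernel_xx t (z + s *\<^sub>R e) e) (at s)"
    by simp
qed

lemma heat_kernel_cont [continuous_intros]:
  fixes q :: "'x::topological_space \<Rightarrow> 'a::euclidean_space"
  assumes "continuous_on S p" "continuous_on S q" "\<And>x. x \<in> S \<Longrightarrow> 0 < p x"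
  shows "continuous_on S (\<lambda>x. heat_kernel (p x) (q x))" "continuous_on S (\<lambda>x. heat_kernel_t (p x) (q x))"
    "continuous_on S (\<lambda>x. heat_kernel_x (p x) (q x) e)" "continuous_on S (\<lambda>x. heat_kernel_xx (p x) (q x) e)"
proof -
  have p0: "p x \<noteq> 0" if "x \<in> S" for x using assms(3)[OF that] by simp
  show 1: "continuous_on S (\<lambda>x. heat_kernel (p x) (q x))"
    unfolding heat_kernel_def using gauss_mass_pos[where 'a='a] p0
    by (intro continuous_intros assms(1,2)) (auto dest: assms(3))
  show "continuous_on S (\<lambda>x. heat_kernel_t (p x) (q x))"
    unfolding heat_kernel_t_def using p0 by (intro continuous_intros assms(1,2) 1) auto
  show "continuous_on S (\<lambda>x. heat_kernel_x (p x) (q x) e)"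
    unfolding heat_kernel_x_def using p0 by (intro continuous_intros assms(1,2) 1) auto
  show "continuous_on S (\<lambda>x. heat_kernel_xx (p x) (q x) e)"
    unfolding heat_kernel_xx_def using p0 by (intro continuous_intros assms(1,2) 1) auto
qed

section \<open>Heat extension of an initial datum\<close>

definition heat_ext :: "('a::euclidean_space \<Rightarrow> real) \<Rightarrow> real \<Rightarrow> 'a \<Rightarrow> real" where
  "heat_ext a t x = (\<integral>\<xi>. gauss \<xi> * a (x - sqrt t *\<^sub>R \<xi>) \<partial>lborel)"

lemma heat_ext_eq_convolution:
  fixes a :: "'a::euclidean_space \<Rightarrow> real"
  assumes a: "a \<in> borel_measurable borel" and t: "0 < t"
  shows "heat_ext a t x = (\<integral>y. heat_kernel t (x - y) * a y \<partial>lborel)"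
proof -
  have cont: "continuous_on UNIV (\<lambda>y. heat_kernel t (x - y))" using t by (intro continuous_intros) auto
  have [measurable]: "(\<lambda>y. heat_kernel t (x - y)) \<in> borel_measurable borel"
    by (rule borel_measurable_continuous_onI[OF cont])
  note [measurable] = a
  have "(\<integral>y. heat_kernel t (x - y) * a y \<partial>lborel)
      = \<bar>- sqrt t\<bar> ^ DIM('a) * (\<integral>\<xi>. heat_kernel t (x - (x + (- sqrt t) *\<^sub>R \<xi>)) * a (x + (- sqrt t) *\<^sub>R \<xi>) \<partial>lborel)"
    using t by (intro lborel_integral_affine) auto
  also have "\<dots> = (\<integral>\<xi>. sqrt t ^ DIM('a) * heat_kernel t (sqrt t *\<^sub>R \<xi>) * a (x - sqrt t *\<^sub>R \<xi>) \<partial>lborel)"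
    using t by (simp add: mult.assoc)
  also have "\<dots> = heat_ext a t x" unfolding heat_ext_def heat_kernel_scale[OF t] ..
  finally show ?thesis by simp
qed

lemma heat_ext_nonneg: "(\<And>y. 0 \<le> a y) \<Longrightarrow> 0 \<le> heat_ext a t x"
  unfolding heat_ext_def by (intro Bochner_Integration.integral_nonneg) (simp add: less_imp_le heat_kernel_pos)

lemma heat_ext_0: "heat_ext a 0 x = a x"
  unfolding heat_ext_def by (simp add: integral_gauss)

lemma heat_ext_integrable:
  assumes a: "a \<in> borel_measurable borel" and bnd: "\<And>y. \<bar>a y\<bar> \<le> C"
  shows "integrable lborel (\<lambda>\<xi>. gauss \<xi> * a (x - r *\<^sub>R \<xi>))"
proof (rule Bochner_Integration.integrable_bound)
  show "integrable lborel (\<lambda>\<xi>::'a. C * gauss \<xi>)" by (intro integrable_mult_right integrable_gauss)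
  show "(\<lambda>\<xi>. gauss \<xi> * a (x - r *\<^sub>R \<xi>)) \<in> borel_measurable lborel" using a by measurable
  show "AE \<xi>::'a in lborel. norm (gauss \<xi> * a (x - r *\<^sub>R \<xi>)) \<le> norm (C * gauss \<xi>)"
  proof (rule AE_I2)
    fix \<xi> :: 'a
    have "\<bar>a (x - r *\<^sub>R \<xi>)\<bar> \<le> \<bar>C\<bar>" using bnd[of "x - r *\<^sub>R \<xi>"] by linarith
    then show "norm (gauss \<xi> * a (x - r *\<^sub>R \<xi>)) \<le> norm (C * gauss \<xi>)"
      using heat_kernel_pos[of 1 \<xi>] by (simp add: abs_mult mult.commute mult_right_mono)
  qed
qed

text \<open>In the rescaled variable the Gaussian weight does not depend on time, so one dominating
  function serves all \<open>T n\<close>, and the limit time 0 is included. Continuity is asked only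
  at almost every sampled point, because truncated data jump across a sphere.\<close>

lemma heat_ext_tendsto:
  fixes a :: "'a::euclidean_space \<Rightarrow> real"
  assumes a: "a \<in> borel_measurable borel" and bnd: "\<And>y. \<bar>a y\<bar> \<le> C"
    and T: "T \<longlonglongrightarrow> t" and X: "X \<longlonglongrightarrow> x" and cont: "AE \<xi> in lborel. isCont a (x - sqrt t *\<^sub>R \<xi>)"
  shows "(\<lambda>n. heat_ext a (T n) (X n)) \<longlonglongrightarrow> heat_ext a t x"
  unfolding heat_ext_def
proof (rule integral_dominated_convergence)
  show "integrable lborel (\<lambda>\<xi>::'a. C * gauss \<xi>)" by (intro integrable_mult_right integrable_gauss)
  show "(\<lambda>\<xi>. gauss \<xi> * a (x - sqrt t *\<^sub>R \<xi>)) \<in> borel_measurable lborel" using a by measurable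
  show "(\<lambda>\<xi>. gauss \<xi> * a (X n - sqrt (T n) *\<^sub>R \<xi>)) \<in> borel_measurable lborel" for n using a by measurable
  show "AE \<xi>::'a in lborel. (\<lambda>n. gauss \<xi> * a (X n - sqrt (T n) *\<^sub>R \<xi>)) \<longlonglongrightarrow> gauss \<xi> * a (x - sqrt t *\<^sub>R \<xi>)"
    using cont
  proof eventually_elim
    case (elim \<xi>)
    show ?case by (intro tendsto_intros isCont_tendsto_compose[OF elim] X T)
  qed
  show "AE \<xi>::'a in lborel. norm (gauss \<xi> * a (X n - sqrt (T n) *\<^sub>R \<xi>)) \<le> C * gauss \<xi>" for n
  proof (rule AE_I2)
    fix \<xi> :: 'a
    show "norm (gauss \<xi> * a (X n - sqrt (T n) *\<^sub>R \<xi>)) \<le> C * gauss \<xi>"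
      using heat_kernel_pos[of 1 \<xi>] bnd by (simp add: abs_mult mult.commute mult_right_mono)
  qed
qed

lemma heat_ext_cont:
  fixes a :: "'a::euclidean_space \<Rightarrow> real"
  assumes a: "continuous_on UNIV a" and bnd: "\<And>y. \<bar>a y\<bar> \<le> C"
  shows "continuous_on UNIV (\<lambda>z. heat_ext a (fst z) (snd z))"
  unfolding continuous_on_sequentially
proof (intro allI ballI impI)
  fix X and z :: "real \<times> 'a" assume X: "(\<forall>n. X n \<in> UNIV) \<and> X \<longlonglongrightarrow> z"
  have "(\<lambda>n. heat_ext a (fst (X n)) (snd (X n))) \<longlonglongrightarrow> heat_ext a (fst z) (snd z)"
    using X a by (intro heat_ext_tendsto[OF borel_measurable_continuous_onI[OF a] bnd] tendsto_fst tendsto_snd AE_I2)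
      (auto simp: continuous_on_eq_continuous_at)
  then show "((\<lambda>z. heat_ext a (fst z) (snd z)) \<circ> X) \<longlonglongrightarrow> heat_ext a (fst z) (snd z)" by (simp add: o_def)
qed

text \<open>The smoothing estimate from \<open>L^1\<close> to pointwise bounds: at a positive time
  the kernel is bounded by its value at the origin. It turns small initial mass into small values
  later.\<close>

lemma heat_ext_le_mass:
  fixes a :: "'a::euclidean_space \<Rightarrow> real"
  assumes a: "integrable lborel a" "\<And>y. 0 \<le> a y" and t: "0 < t"
  shows "heat_ext a t x \<le> (\<integral>y. a y \<partial>lborel) / (gauss_mass TYPE('a) * sqrt t ^ DIM('a))"
proof -
  have "heat_ext a t x = (\<integral>y. heat_kernel t (x - y) * a y \<partial>lborel)"
    using borel_measurable_integrable[OF a(1)] by (intro heat_ext_eq_convolution t) simp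
  also have "\<dots> \<le> (\<integral>y. a y / (gauss_mass TYPE('a) * sqrt t ^ DIM('a)) \<partial>lborel)"
  proof (rule integral_mono')
    show "integrable lborel (\<lambda>y. a y / (gauss_mass TYPE('a) * sqrt t ^ DIM('a)))" using a(1) by simp
    fix y :: 'a
    show "heat_kernel t (x - y) * a y \<le> a y / (gauss_mass TYPE('a) * sqrt t ^ DIM('a))"
      using mult_right_mono[OF heat_kernel_le[OF t, of "x - y"] a(2)[of y]] by simp
    show "0 \<le> a y / (gauss_mass TYPE('a) * sqrt t ^ DIM('a))"
      using a(2)[of y] gauss_mass_pos[where 'a='a] t by simp
  qed
  also have "\<dots> = (\<integral>y. a y \<partial>lborel) / (gauss_mass TYPE('a) * sqrt t ^ DIM('a))" by simp
  finally show ?thesis .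
qed

text \<open>Compact support confines the convolution to a fixed box, so time and space derivatives
  pass to the kernel, which solves the heat equation itself.\<close>

lemma heat_ext_heat_equation:
  fixes a :: "'a::euclidean_space \<Rightarrow> real"
  assumes a: "continuous_on UNIV a" and supp: "\<And>y. y \<notin> cbox A B \<Longrightarrow> a y = 0" and t: "0 < t"
  shows "\<exists>T S. ((\<lambda>r. heat_ext a (t + r) x) has_real_derivative T) (at 0)
    \<and> (\<forall>b\<in>Basis. has_second_dir_deriv (heat_ext a t) x b (S b)) \<and> (\<Sum>b\<in>Basis. S b) = T"
proof -
  have aB: "continuous_on S a" for S using a continuous_on_subset by blast
  have eq: "heat_ext a s y = integral (cbox A B) (\<lambda>z. heat_kernel s (y - z) * a z)" if s: "0 < s" for s y
  proof -
    have c: "continuous_on (cbox A B) (\<lambda>z. heat_kernel s (y - z) * a z)"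
      using s by (intro continuous_intros aB) auto
    have "heat_ext a s y = (\<integral>z. heat_kernel s (y - z) * a z \<partial>lborel)"
      by (intro heat_ext_eq_convolution s borel_measurable_continuous_onI a)
    also have "\<dots> = (\<integral>z. indicator (cbox A B) z *\<^sub>R (heat_kernel s (y - z) * a z) \<partial>lborel)"
      by (intro Bochner_Integration.integral_cong) (auto simp: indicator_def supp)
    also have "\<dots> = integral (cbox A B) (\<lambda>z. heat_kernel s (y - z) * a z)"
      using set_borel_integral_eq_integral(2)[of "cbox A B" "\<lambda>z. heat_kernel s (y - z) * a z"]
        borel_integrable_compact[OF compact_cbox c]
      by (simp add: set_integrable_def set_lebesgue_integral_def)
    finally show ?thesis .
  qed
  define T where "T = integral (cbox A B) (\<lambda>z. heat_kernel_t t (x - z) * a z)"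
  define S where "S b = integral (cbox A B) (\<lambda>z. heat_kernel_xx t (x - z) b * a z)" for b
  have cS: "continuous_on (U \<times> cbox A B) (\<lambda>p. a (snd p))" for U :: "real set"
    by (rule continuous_on_compose2[OF a]) (auto intro!: continuous_intros)
  have "((\<lambda>r. integral (cbox A B) (\<lambda>z. heat_kernel r (x - z) * a z)) has_real_derivative T) (at t within {0<..})"
    unfolding T_def
  proof (rule leibniz_rule_field_derivative)
    show "((\<lambda>r. heat_kernel r (x - z) * a z) has_real_derivative heat_kernel_t r (x - z) * a z) (at r within {0<..})"
      if "r \<in> {0<..}" for r z
      using that by (intro has_field_derivative_at_within[OF DERIV_cmult_right[OF heat_kernel_deriv_t]]) simp
    show "(\<lambda>z. heat_kernel r (x - z) * a z) integrable_on cbox A B" if "r \<in> {0<..}" for r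
      using that by (intro integrable_continuous continuous_intros aB) auto
    show "continuous_on ({0<..} \<times> cbox A B) (\<lambda>(r, z). heat_kernel_t r (x - z) * a z)"
      unfolding split_beta by (intro continuous_intros cS) auto
  qed (use t in auto)
  then have "((\<lambda>r. integral (cbox A B) (\<lambda>z. heat_kernel r (x - z) * a z)) has_real_derivative T) (at t)"
    using at_within_open[of t "{0<..}"] t by simp
  then have "((\<lambda>r. heat_ext a r x) has_real_derivative T) (at t)"
    by (rule has_field_derivative_transform_within_open[of _ _ _ "{0<..}"]) (use t eq in auto)
  then have "((\<lambda>r. heat_ext a (t + r) x) has_real_derivative T) (at 0)"
    using DERIV_shift[of "\<lambda>r. heat_ext a r x" T 0 t] by (simp add: add.commute)
  moreover have "has_second_dir_deriv (heat_ext a t) x b (S b)" for b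
  proof -
    define S1 where "S1 s = integral (cbox A B) (\<lambda>z. heat_kernel_x t (x - z + s *\<^sub>R b) b * a z)" for s
    have h: "heat_ext a t (x + s *\<^sub>R b) = integral (cbox A B) (\<lambda>z. heat_kernel t (x - z + s *\<^sub>R b) * a z)" for s
      unfolding eq[OF t] by (simp add: algebra_simps)
    have "((\<lambda>s. heat_ext a t (x + s *\<^sub>R b)) has_real_derivative S1 s) (at s)" for s
      unfolding h S1_def
    proof (rule leibniz_rule_field_derivative)
      show "((\<lambda>s. heat_kernel t (x - z + s *\<^sub>R b) * a z) has_real_derivative heat_kernel_x t (x - z + s *\<^sub>R b) b * a z) (at s)" for s z
        by (rule DERIV_cmult_right[OF heat_kernel_deriv_x(1)])
      show "(\<lambda>z. heat_kernel t (x - z + s *\<^sub>R b) * a z) integrable_on cbox A B" for s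
        using t by (intro integrable_continuous continuous_intros aB) auto
      show "continuous_on (UNIV \<times> cbox A B) (\<lambda>(s, z). heat_kernel_x t (x - z + s *\<^sub>R b) b * a z)"
        unfolding split_beta using t by (intro continuous_intros cS) auto
    qed auto
    moreover have "(S1 has_real_derivative integral (cbox A B) (\<lambda>z. heat_kernel_xx t (x - z + 0 *\<^sub>R b) b * a z)) (at 0)"
      unfolding S1_def
    proof (rule leibniz_rule_field_derivative)
      show "((\<lambda>s. heat_kernel_x t (x - z + s *\<^sub>R b) b * a z) has_real_derivative heat_kernel_xx t (x - z + s *\<^sub>R b) b * a z) (at s)" for s z
        by (rule DERIV_cmult_right[OF heat_kernel_deriv_x(2)])
      show "(\<lambda>z. heat_kernel_x t (x - z + s *\<^sub>R b) b * a z) integrable_on cbox A B" for s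
        using t by (intro integrable_continuous continuous_intros aB) auto
      show "continuous_on (UNIV \<times> cbox A B) (\<lambda>(s, z). heat_kernel_xx t (x - z + s *\<^sub>R b) b * a z)"
        unfolding split_beta using t by (intro continuous_intros cS) auto
    qed auto
    ultimately show ?thesis
      unfolding has_second_dir_deriv_def S_def by (intro exI[of _ S1]) simp
  qed
  moreover have "(\<Sum>b\<in>Basis. S b) = T"
  proof -
    have "((\<lambda>z. \<Sum>b\<in>Basis. heat_kernel_xx t (x - z) b * a z) has_integral (\<Sum>b\<in>Basis. S b)) (cbox A B)"
      unfolding S_def using t
      by (intro has_integral_sum integrable_integral integrable_continuous continuous_intros aB) auto
    then show ?thesis
      unfolding T_def by (simp add: sum_distrib_right[symmetric] heat_kernel_equation integral_unique)
  qed
  ultimately show ?thesis by (intro exI[of _ T] exI[of _ S]) blast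
qed

section \<open>Comparison of two solutions\<close>

context absorption
begin

lemma weak_sol_continuous:
  assumes "weak_sol h u"
  shows "continuous_on {z. 0 < fst z} (\<lambda>z. u (fst z) (snd z))"
    and "continuous_on {z. 0 < fst z} (\<lambda>z. f (u (fst z) (snd z)))"
proof -
  have "{z :: real \<times> 'a. 0 < fst z} = {0<..} \<times> UNIV" by auto
  then show 1: "continuous_on {z. 0 < fst z} (\<lambda>z. u (fst z) (snd z))"
    using assms unfolding weak_sol_def by (simp add: split_beta)
  show "continuous_on {z. 0 < fst z} (\<lambda>z. f (u (fst z) (snd z)))"
    by (rule continuous_on_compose2[OF f_cont 1]) (use assms in \<open>auto simp: weak_sol_def\<close>)
qed

lemma weak_heat_difference:
  assumes u: "weak_sol h u" and v: "weak_sol h v"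
  shows "weak_heat (\<lambda>z. u (fst z) (snd z) - v (fst z) (snd z)) (\<lambda>z. f (u (fst z) (snd z)) - f (v (fst z) (snd z)))"
  unfolding weak_heat_def
proof (intro conjI allI impI continuous_on_diff weak_sol_continuous[OF u] weak_sol_continuous[OF v])
  fix \<phi> D D2 assume t: "test_fun (\<phi> :: real \<times> 'a \<Rightarrow> real) D D2"
  have *: "((\<lambda>z. w (fst z) (snd z) * (- dt_test D z - lap_test D2 z) + f (w (fst z) (snd z)) * \<phi> z) has_integral 0) UNIV"
    if "weak_sol h w" for w
  proof -
    have "((\<lambda>(t,x). w t x * (- dt_test D (t,x) - lap_test D2 (t,x)) + w t x * h (w t x) * \<phi> (t,x)) has_integral 0) UNIV"
      using that t unfolding weak_sol_def by blast
    then show ?thesis by (simp add: case_prod_unfold f_def)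
  qed
  from has_integral_diff[OF *[OF u] *[OF v]]
  show "((\<lambda>z. (u (fst z) (snd z) - v (fst z) (snd z)) * (- dt_test D z - lap_test D2 z)
      + (f (u (fst z) (snd z)) - f (v (fst z) (snd z))) * \<phi> z) has_integral 0) UNIV"
    by (simp add: algebra_simps)
qed

end

context keller_osserman
begin

text \<open>The difference of two solutions lies below the barrier plus the heat extension of its positive
  part at a small time \<open>\<tau>\<close>, and the heat extension is controlled by the \<open>L\<^sup>1\<close> norm.\<close>

lemma comparison_up_to_barrier:
  fixes u v :: "real \<Rightarrow> 'a::euclidean_space \<Rightarrow> real" and R :: real
  assumes u: "weak_sol h u" and v: "weak_sol h v" and R: "0 < R"
    and init: "((\<lambda>\<tau>. \<integral>\<^sup>+y\<in>cball 0 (R * DIM('a) + 1). ennreal (u \<tau> y - v \<tau> y) \<partial>lborel) \<longlongrightarrow> 0) (at_right 0)"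
    and t: "0 < t" and x: "x \<in> cube R"
  shows "u t x \<le> v t x + barrier R x"
proof (rule ccontr)
  assume "\<not> ?thesis"
  then have \<delta>: "0 < u t x - v t x - barrier R x" (is "0 < ?\<delta>") by simp
  \<comment> \<open>The cube of half-width \<open>R\<close> lies in the ball of radius
    \<open>R * DIM('a)\<close>, by the bound of the norm by the sum of coordinates; the extra 1 is
    the room in which \<open>cut\<close> falls from 1 to 0.\<close>
  define \<rho> where "\<rho> = R * DIM('a) + 1"
  \<comment> \<open>The denominator of \<open>heat_ext_le_mass\<close> at time \<open>t / 2\<close>;
    since \<open>\<tau> < t / 2\<close>, the heat extension is evaluated after a longer time
    \<open>t - \<tau>\<close>.\<close>
  define m where "m = gauss_mass TYPE('a) * sqrt (t / 2) ^ DIM('a)"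
  have m: "0 < m" using gauss_mass_pos[where 'a='a] t by (simp add: m_def)
  have "\<forall>\<^sub>F \<tau> in at_right 0. (\<integral>\<^sup>+y\<in>cball 0 \<rho>. ennreal (u \<tau> y - v \<tau> y) \<partial>lborel) < ennreal (?\<delta> * m)"
    using init m \<delta> unfolding \<rho>_def by (intro order_tendstoD(2)) auto
  moreover have "\<forall>\<^sub>F \<tau> in at_right 0. \<tau> \<in> {0<..<t / 2}"
    using t by (intro eventually_at_right_real) simp
  ultimately have "\<exists>\<tau>. (\<integral>\<^sup>+y\<in>cball 0 \<rho>. ennreal (u \<tau> y - v \<tau> y) \<partial>lborel) < ennreal (?\<delta> * m) \<and> \<tau> \<in> {0<..<t / 2}"
    using eventually_happens'[OF trivial_limit_at_right_real eventually_conj] by blast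
  then obtain \<tau> where small: "(\<integral>\<^sup>+y\<in>cball 0 \<rho>. ennreal (u \<tau> y - v \<tau> y) \<partial>lborel) < ennreal (?\<delta> * m)"
    and \<tau>: "0 < \<tau>" "\<tau> < t / 2" by auto
  define cut where "cut y = max 0 (min 1 (\<rho> - norm y))" for y :: 'a
  define a where "a y = cut y * max 0 (u \<tau> y - v \<tau> y)" for y
  have slice: "continuous_on UNIV (w \<tau>)" if "weak_sol h w" for w :: "real \<Rightarrow> 'a \<Rightarrow> real"
  proof -
    have "continuous_on UNIV (\<lambda>y::'a. (\<tau>, y))" by (intro continuous_on_Pair continuous_on_const continuous_on_id)
    moreover have "(\<lambda>y::'a. (\<tau>, y)) ` UNIV \<subseteq> {z. 0 < fst z}" using \<tau> by auto
    ultimately show ?thesis using continuous_on_compose2[OF weak_sol_continuous(1)[OF that]] by fastforce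
  qed
  have a_cont: "continuous_on UNIV a"
    unfolding a_def cut_def by (intro continuous_intros slice u v)
  have a_nonneg: "0 \<le> a y" for y by (simp add: a_def cut_def)
  have a_supp: "a y = 0" if "y \<notin> cball 0 \<rho>" for y using that by (simp add: a_def cut_def)
  obtain A B where AB: "cball 0 \<rho> \<subseteq> cbox A (B::'a)"
    using bounded_subset_cbox_symmetric[OF bounded_cball] by metis
  have a_supp': "a y = 0" if "y \<notin> cbox A B" for y using a_supp that AB by blast
  have a_int: "integrable lborel a"
  proof -
    have "integrable lborel (\<lambda>y. indicator (cball 0 \<rho>) y *\<^sub>R a y)"
      by (intro borel_integrable_compact compact_cball continuous_on_subset[OF a_cont]) simp
    moreover have "(\<lambda>y. indicator (cball 0 \<rho>) y *\<^sub>R a y) = a" using a_supp by (auto simp: indicator_def fun_eq_iff)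
    ultimately show ?thesis by simp
  qed
  obtain C where C: "\<And>y. \<bar>a y\<bar> \<le> C"
  proof -
    have "bounded (a ` cball 0 \<rho>)"
      by (intro compact_imp_bounded compact_continuous_image continuous_on_subset[OF a_cont]) auto
    then obtain C where "\<And>y. y \<in> cball 0 \<rho> \<Longrightarrow> \<bar>a y\<bar> \<le> C"
      unfolding bounded_iff real_norm_def by blast
    then have "\<bar>a y\<bar> \<le> max C 0" for y using a_supp[of y] by (cases "y \<in> cball 0 \<rho>") (auto simp: le_max_iff_disj)
    with that show thesis .
  qed
  have mass: "(\<integral>y. a y \<partial>lborel) < ?\<delta> * m"
  proof -
    have "ennreal (\<integral>y. a y \<partial>lborel) = (\<integral>\<^sup>+y. ennreal (a y) \<partial>lborel)"
      by (intro nn_integral_eq_integral[symmetric] a_int AE_I2 a_nonneg)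
    also have "\<dots> \<le> (\<integral>\<^sup>+y\<in>cball 0 \<rho>. ennreal (u \<tau> y - v \<tau> y) \<partial>lborel)"
    proof (rule nn_integral_mono)
      fix y :: 'a
      have "a y \<le> 1 * max 0 (u \<tau> y - v \<tau> y)" unfolding a_def cut_def by (intro mult_right_mono) auto
      then show "ennreal (a y) \<le> ennreal (u \<tau> y - v \<tau> y) * indicator (cball 0 \<rho>) y"
        using a_supp[of y] by (cases "y \<in> cball 0 \<rho>"; cases "0 \<le> u \<tau> y - v \<tau> y") (auto simp: ennreal_leI ennreal_neg)
    qed
    finally have "ennreal (\<integral>y. a y \<partial>lborel) < ennreal (?\<delta> * m)" using small by (rule le_less_trans)
    then show ?thesis by (simp add: ennreal_less_iff Bochner_Integration.integral_nonneg a_nonneg)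
  qed
  define E where "E z = heat_ext a (fst z - \<tau>) (snd z)" for z
  have "u t x - v t x \<le> barrier R x + E (t, x)"
  proof (rule barrier_comparison[OF weak_heat_difference[OF u v], of R \<tau> t, unfolded fst_conv snd_conv])
    fix z :: "real \<times> 'a"
    assume z: "0 < fst z" "0 \<le> u (fst z) (snd z) - v (fst z) (snd z)"
    then have "0 \<le> v (fst z) (snd z)" using v by (auto simp: weak_sol_def)
    then show "f (u (fst z) (snd z) - v (fst z) (snd z)) \<le> f (u (fst z) (snd z)) - f (v (fst z) (snd z))"
      using f_superadditive[OF z(2), of "v (fst z) (snd z)"] by simp
  next
    show "continuous_on ({\<tau>..t} \<times> UNIV) E"
    proof -
      have "continuous_on ({\<tau>..t} \<times> UNIV) (\<lambda>z::real \<times> 'a. (fst z - \<tau>, snd z))" by (intro continuous_intros)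
      from continuous_on_compose2[OF heat_ext_cont[OF a_cont C] this] show ?thesis unfolding E_def by simp
    qed
  next
    fix z show "0 \<le> E z" unfolding E_def by (intro heat_ext_nonneg a_nonneg)
  next
    fix s and y :: 'a assume s: "\<tau> < s" "s \<le> t"
    then have "0 < s - \<tau>" by simp
    from heat_ext_heat_equation[OF a_cont a_supp' this, where x=y] obtain T S where
      T: "((\<lambda>r. heat_ext a (s - \<tau> + r) y) has_real_derivative T) (at 0)" and
      S: "\<forall>b\<in>Basis. has_second_dir_deriv (heat_ext a (s - \<tau>)) y b (S b)" "(\<Sum>b\<in>Basis. S b) = T"
      by blast
    have "((\<lambda>r. E ((s, y) + r *\<^sub>R (1, 0))) has_real_derivative T) (at 0)"
      using T by (simp add: E_def algebra_simps)
    moreover have "\<forall>b\<in>Basis. has_second_dir_deriv E (s, y) (0, b) (S b)"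
      using S(1) by (simp add: E_def has_second_dir_deriv_def)
    ultimately show "\<exists>T S. ((\<lambda>r. E ((s, y) + r *\<^sub>R (1, 0))) has_real_derivative T) (at 0)
       \<and> (\<forall>b\<in>Basis. has_second_dir_deriv E (s, y) (0, b) (S b)) \<and> (\<Sum>b\<in>Basis. S b) \<le> T"
      using S(2) by (intro exI[of _ T] exI[of _ S]) auto
  next
    fix y :: 'a assume y: "y \<in> cube R"
    have "norm y \<le> (\<Sum>b\<in>Basis. \<bar>y \<bullet> b\<bar>)" by (rule norm_le_l1)
    also have "\<dots> \<le> (\<Sum>b\<in>(Basis::'a set). R)" using y by (intro sum_mono) (auto simp: cube_def less_imp_le)
    finally have "cut y = 1" by (simp add: cut_def \<rho>_def mult.commute)
    then show "u \<tau> y - v \<tau> y \<le> E (\<tau>, y)" by (simp add: E_def heat_ext_0 a_def)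
  qed (use R \<tau> x in auto)
  also have "E (t, x) \<le> (\<integral>y. a y \<partial>lborel) / (gauss_mass TYPE('a) * sqrt (t - \<tau>) ^ DIM('a))"
    unfolding E_def fst_conv snd_conv using \<tau> by (intro heat_ext_le_mass a_int a_nonneg) simp
  also have "\<dots> \<le> (\<integral>y. a y \<partial>lborel) / m"
    unfolding m_def using \<tau> gauss_mass_pos[where 'a='a]
    by (intro divide_left_mono mult_left_mono power_mono real_sqrt_le_mono Bochner_Integration.integral_nonneg a_nonneg) auto
  also have "\<dots> < ?\<delta>" using mass m by (simp add: pos_divide_less_eq)
  finally show False by simp
qed

text \<open>The barrier at a fixed point tends to 0 as the cube grows. Each cube needs its own ball
  of initial smallness, so no uniformity in \<open>r\<close> enters.\<close>

lemma comparison: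
  fixes u v :: "real \<Rightarrow> 'a::euclidean_space \<Rightarrow> real"
  assumes u: "weak_sol h u" and v: "weak_sol h v"
    and init: "\<And>r. ((\<lambda>\<tau>. \<integral>\<^sup>+y\<in>cball 0 r. ennreal (u \<tau> y - v \<tau> y) \<partial>lborel) \<longlongrightarrow> 0) (at_right 0)"
    and t: "0 < t"
  shows "u t x \<le> v t x"
proof (rule field_le_epsilon)
  fix e :: real assume "0 < e"
  then obtain R0 where "\<And>R y::'a. R0 \<le> R \<Longrightarrow> norm y \<le> norm x \<Longrightarrow> y \<in> cube R \<and> barrier R y < e"
    using barrier_decay by metis
  from this[of "max R0 1" x] have x: "x \<in> cube (max R0 1)" and "barrier (max R0 1) x < e" by auto
  moreover have "u t x \<le> v t x + barrier (max R0 1) x"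
    by (rule comparison_up_to_barrier[OF u v _ init t x]) simp
  ultimately show "u t x \<le> v t x + e" by simp
qed

end

section \<open>Representation of test functions by the heat kernel\<close>

lemma lborel_integral_translate:
  fixes w :: "'a::euclidean_space \<Rightarrow> real"
  assumes "w \<in> borel_measurable borel"
  shows "(\<integral>x. w (x + c) \<partial>lborel) = (\<integral>x. w x \<partial>lborel)"
  using lborel_integral_affine[OF assms, of 1 c] by (simp add: add.commute)

lemma compact_support_integrable:
  fixes w :: "'a::euclidean_space \<Rightarrow> real"
  assumes "continuous_on UNIV w" "\<And>x. x \<notin> cbox A B \<Longrightarrow> w x = 0"
  shows "integrable lborel w" "(\<integral>x. w x \<partial>lborel) = integral (cbox A B) w"
proof -
  have i: "integrable lborel (\<lambda>x. indicator (cbox A B) x *\<^sub>R w x)"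
    by (intro borel_integrable_compact compact_cbox continuous_on_subset[OF assms(1)]) simp
  have eq: "(\<lambda>x. indicator (cbox A B) x *\<^sub>R w x) = w" using assms(2) by (auto simp: indicator_def fun_eq_iff)
  show "integrable lborel w" using i unfolding eq .
  show "(\<integral>x. w x \<partial>lborel) = integral (cbox A B) w"
    using set_borel_integral_eq_integral(2)[of "cbox A B" w] i eq
    by (simp add: set_integrable_def set_lebesgue_integral_def)
qed

text \<open>The integral of \<open>F (x + s *\<^sub>R b)\<close> does not depend on
  \<open>s\<close>, and its derivative at 0 is the integral of \<open>F'\<close>. The box is
  enlarged so that it contains all supports for \<open>\<bar>s\<bar> < 1\<close>.\<close>

lemma integral_dir_deriv_eq_0:
  fixes F F' :: "'a::euclidean_space \<Rightarrow> real"
  assumes F: "continuous_on UNIV F" and F': "continuous_on UNIV F'"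
    and deriv: "\<And>x. ((\<lambda>s. F (x + s *\<^sub>R b)) has_real_derivative F' x) (at 0)"
    and supp: "\<And>x. x \<notin> cbox A B \<Longrightarrow> F x = 0" "\<And>x. x \<notin> cbox A B \<Longrightarrow> F' x = 0"
  shows "integral (cbox A B) F' = 0"
proof -
  have "bounded (\<Union>x\<in>cbox A B. cball x (norm b))"
    by (intro compact_imp_bounded compact_minkowski_sum_cball compact_cbox)
  then obtain A' B' where box: "(\<Union>x\<in>cbox A B. cball x (norm b)) \<subseteq> cbox A' B'"
    using bounded_subset_cbox_symmetric by metis
  have supp': "F (x + s *\<^sub>R b) = 0" if x: "x \<notin> cbox A' B'" and s: "\<bar>s\<bar> < 1" for x s
  proof (rule supp(1), rule notI)
    assume "x + s *\<^sub>R b \<in> cbox A B"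
    moreover have "\<bar>s\<bar> * norm b \<le> 1 * norm b" using s by (intro mult_right_mono) auto
    then have "x \<in> cball (x + s *\<^sub>R b) (norm b)" by (simp add: dist_norm)
    ultimately show False using box x by blast
  qed
  have cF: "continuous_on S (\<lambda>x. F (p x))" if "continuous_on S p" for p :: "'x::topological_space \<Rightarrow> 'a" and S
    by (rule continuous_on_compose2[OF F that]) simp
  have cF': "continuous_on S (\<lambda>x. F' (p x))" if "continuous_on S p" for p :: "'x::topological_space \<Rightarrow> 'a" and S
    by (rule continuous_on_compose2[OF F' that]) simp
  define U where "U = {-1<..<1::real}"
  define I where "I s = integral (cbox A' B') (\<lambda>x. F (x + s *\<^sub>R b))" for s
  have const: "I s = (\<integral>x. F x \<partial>lborel)" if "s \<in> U" for s
  proof -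
    have "I s = (\<integral>x. F (x + s *\<^sub>R b) \<partial>lborel)"
      unfolding I_def using that supp'
      by (intro compact_support_integrable(2)[symmetric] cF) (auto simp: U_def intro!: continuous_intros)
    also have "\<dots> = (\<integral>x. F x \<partial>lborel)"
      by (rule lborel_integral_translate[OF borel_measurable_continuous_onI[OF F]])
    finally show ?thesis .
  qed
  have deriv': "((\<lambda>s. F (x + s *\<^sub>R b)) has_real_derivative F' (x + s *\<^sub>R b)) (at s)" for x s
    using DERIV_shift[of "\<lambda>s. F (x + s *\<^sub>R b)" "F' (x + s *\<^sub>R b)" 0 s] deriv[of "x + s *\<^sub>R b"]
    by (simp add: algebra_simps)
  have "(I has_real_derivative integral (cbox A' B') (\<lambda>x. F' (x + 0 *\<^sub>R b))) (at 0 within U)"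
    unfolding I_def
  proof (rule leibniz_rule_field_derivative)
    show "((\<lambda>s. F (x + s *\<^sub>R b)) has_real_derivative F' (x + s *\<^sub>R b)) (at s within U)" for x s
      by (rule has_field_derivative_at_within[OF deriv'])
    show "(\<lambda>x. F (x + s *\<^sub>R b)) integrable_on cbox A' B'" for s
      by (intro integrable_continuous cF continuous_intros)
    show "continuous_on (U \<times> cbox A' B') (\<lambda>(s, x). F' (x + s *\<^sub>R b))"
      unfolding split_beta by (intro cF' continuous_intros)
  qed (auto simp: U_def)
  then have "(I has_real_derivative integral (cbox A' B') F') (at 0)"
    using at_within_open[of 0 U] by (simp add: U_def)
  moreover have "(I has_real_derivative 0) (at 0)"
    by (rule has_field_derivative_transform_within_open[of "\<lambda>_. \<integral>x. F x \<partial>lborel" _ _ U])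
      (auto simp: const, auto simp: U_def)
  ultimately have "integral (cbox A' B') F' = 0" by (rule DERIV_unique)
  moreover have "integral (cbox A' B') F' = integral (cbox A B) F'"
  proof -
    have "x \<in> (\<Union>y\<in>cbox A B. cball y (norm b))" if "x \<in> cbox A B" for x
      using that by (intro UN_I[of x]) auto
    then have "x \<notin> cbox A B" if "x \<notin> cbox A' B'" for x using box that by blast
    then have "integral UNIV F' = integral (cbox A' B') F'" using supp by (intro integral_superset) blast
    then show ?thesis using integral_superset[of "cbox A B" F', OF supp(2)] by simp
  qed
  ultimately show ?thesis by simp
qed

section \<open>Test functions and their heat averages\<close>

lemma test_fun_has_derivative:
  assumes "test_fun \<phi> D D2"
  shows "(\<phi> has_derivative blinfun_apply (D z)) (at z)" "(D has_derivative blinfun_apply (D2 z)) (at z)"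
  using assms unfolding test_fun_def by blast+

text \<open>The complement of the compact set is open and \<open>\<phi>\<close> vanishes on it, so
  the same set carries both derivatives.\<close>

lemma test_fun_support:
  assumes "test_fun \<phi> D D2"
  obtains K where "compact K" "K \<subseteq> {z. 0 < fst z}" "\<And>z. z \<notin> K \<Longrightarrow> \<phi> z = 0"
    "\<And>z. z \<notin> K \<Longrightarrow> D z = 0" "\<And>z. z \<notin> K \<Longrightarrow> D2 z = 0"
proof -
  obtain K where K: "compact K" "K \<subseteq> {z. 0 < fst z}" "\<And>z. z \<notin> K \<Longrightarrow> \<phi> z = 0"
    using assms unfolding test_fun_def by blast
  have op: "open (- K)" using K(1) by (simp add: compact_imp_closed open_Compl)
  have D: "D z = 0" if "z \<notin> K" for z
  proof (rule blinfun_eqI)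
    fix v
    have "(\<phi> has_derivative (\<lambda>_. 0)) (at z)"
      by (rule has_derivative_transform_within_open[OF has_derivative_const op]) (use that K(3) in auto)
    moreover note test_fun_has_derivative(1)[OF assms, of z]
    ultimately have "blinfun_apply (D z) = (\<lambda>_. 0)" by (metis has_derivative_unique)
    then show "blinfun_apply (D z) v = blinfun_apply 0 v" by simp
  qed
  have D2: "D2 z = 0" if "z \<notin> K" for z
  proof (rule blinfun_eqI)
    fix v
    have "(D has_derivative (\<lambda>_. 0)) (at z)"
      by (rule has_derivative_transform_within_open[OF has_derivative_const op]) (use that D in auto)
    moreover note test_fun_has_derivative(2)[OF assms, of z]
    ultimately have "blinfun_apply (D2 z) = (\<lambda>_. 0)" by (metis has_derivative_unique)
    then show "blinfun_apply (D2 z) v = blinfun_apply 0 v" by simp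
  qed
  show thesis using that K D D2 by blast
qed

lemma test_fun_continuous:
  assumes "test_fun \<phi> D D2"
  shows "continuous_on UNIV \<phi>" "continuous_on UNIV (\<lambda>z. blinfun_apply (D z) v)"
    "continuous_on UNIV (\<lambda>z. blinfun_apply (blinfun_apply (D2 z) v) w)"
    "continuous_on UNIV (dt_test D)" "continuous_on UNIV (lap_test D2)"
proof -
  show "continuous_on UNIV \<phi>"
    by (intro continuous_at_imp_continuous_on ballI has_derivative_continuous[OF test_fun_has_derivative(1)[OF assms]])
  have D: "continuous_on UNIV D"
    by (intro continuous_at_imp_continuous_on ballI has_derivative_continuous[OF test_fun_has_derivative(2)[OF assms]])
  show 1: "continuous_on UNIV (\<lambda>z. blinfun_apply (D z) v)" for v
    by (intro blinfun.continuous_on D continuous_on_const)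
  have D2: "continuous_on UNIV D2" using assms by (simp add: test_fun_def)
  show 2: "continuous_on UNIV (\<lambda>z. blinfun_apply (blinfun_apply (D2 z) v) w)" for v w
    by (intro blinfun.continuous_on D2 continuous_on_const)
  show "continuous_on UNIV (dt_test D)" unfolding dt_test_def[abs_def] by (rule 1)
  show "continuous_on UNIV (lap_test D2)" unfolding lap_test_def[abs_def] by (intro continuous_on_sum 2)
qed

lemma test_fun_line_derivs:
  assumes "test_fun \<phi> D D2"
  shows "((\<lambda>s. \<phi> (z + s *\<^sub>R v)) has_real_derivative blinfun_apply (D (z + s *\<^sub>R v)) v) (at s)"
    and "((\<lambda>s. blinfun_apply (D (z + s *\<^sub>R v)) w) has_real_derivative blinfun_apply (blinfun_apply (D2 (z + s *\<^sub>R v)) v) w) (at s)"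
proof -
  have line: "((\<lambda>s. z + s *\<^sub>R v) has_derivative (\<lambda>r. r *\<^sub>R v)) (at s)"
    by (auto intro!: derivative_eq_intros)
  from has_derivative_compose[OF line test_fun_has_derivative(1)[OF assms]]
  show "((\<lambda>s. \<phi> (z + s *\<^sub>R v)) has_real_derivative blinfun_apply (D (z + s *\<^sub>R v)) v) (at s)"
    by (rule has_derivative_imp_has_field_derivative) (simp add: blinfun.scaleR_right)
  from has_derivative_compose[OF line test_fun_has_derivative(2)[OF assms]]
  have "((\<lambda>s. D (z + s *\<^sub>R v)) has_derivative (\<lambda>r. blinfun_apply (D2 (z + s *\<^sub>R v)) (r *\<^sub>R v))) (at s)" .
  then have "((\<lambda>s. blinfun_apply (D (z + s *\<^sub>R v)) w) has_derivative
      (\<lambda>r. blinfun_apply (blinfun_apply (D2 (z + s *\<^sub>R v)) (r *\<^sub>R v)) w)) (at s)"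
    by (rule bounded_linear.has_derivative[OF blinfun.bounded_linear_left])
  then show "((\<lambda>s. blinfun_apply (D (z + s *\<^sub>R v)) w) has_real_derivative blinfun_apply (blinfun_apply (D2 (z + s *\<^sub>R v)) v) w) (at s)"
    by (rule has_derivative_imp_has_field_derivative) (simp add: blinfun.scaleR_right blinfun.scaleR_left)
qed

text \<open>Average over space at the later time \<open>fst z + r\<close> against the heat kernel of
  age \<open>r\<close>: the forward-looking companion of \<open>heat_ext\<close>, suited to the
  adjoint equation.\<close>

definition heat_avg :: "(real \<times> 'a::euclidean_space \<Rightarrow> real) \<Rightarrow> real \<times> 'a \<Rightarrow> real \<Rightarrow> real" where
  "heat_avg \<Phi> z r = (\<integral>\<xi>. gauss \<xi> * \<Phi> (z + (r, sqrt r *\<^sub>R \<xi>)) \<partial>lborel)"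

lemma heat_avg_cont:
  fixes \<Phi> :: "real \<times> 'a::euclidean_space \<Rightarrow> real"
  assumes \<Phi>: "continuous_on UNIV \<Phi>" and bnd: "\<And>z. \<bar>\<Phi> z\<bar> \<le> C"
  shows "continuous_on UNIV (heat_avg \<Phi> z)"
  unfolding continuous_on_sequentially
proof (intro allI ballI impI)
  fix R and r :: real assume "(\<forall>n. R n \<in> UNIV) \<and> R \<longlonglongrightarrow> r"
  then have R: "R \<longlonglongrightarrow> r" by simp
  have meas: "(\<lambda>\<xi>. gauss \<xi> * \<Phi> (z + (\<rho>, sqrt \<rho> *\<^sub>R \<xi>))) \<in> borel_measurable lborel" for \<rho>
  proof -
    have "continuous_on UNIV (\<lambda>\<xi>. \<Phi> (z + (\<rho>, sqrt \<rho> *\<^sub>R \<xi>)))"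
      by (rule continuous_on_compose2[OF \<Phi>]) (auto intro!: continuous_intros)
    then have "(\<lambda>\<xi>. \<Phi> (z + (\<rho>, sqrt \<rho> *\<^sub>R \<xi>))) \<in> borel_measurable lborel"
      using borel_measurable_continuous_onI by auto
    then show ?thesis by (intro borel_measurable_times) simp_all
  qed
  have "(\<lambda>n. heat_avg \<Phi> z (R n)) \<longlonglongrightarrow> heat_avg \<Phi> z r"
    unfolding heat_avg_def
  proof (rule integral_dominated_convergence)
    show "integrable lborel (\<lambda>\<xi>::'a. C * gauss \<xi>)" by (intro integrable_mult_right integrable_gauss)
    show "AE \<xi>::'a in lborel. (\<lambda>n. gauss \<xi> * \<Phi> (z + (R n, sqrt (R n) *\<^sub>R \<xi>))) \<longlonglongrightarrow> gauss \<xi> * \<Phi> (z + (r, sqrt r *\<^sub>R \<xi>))"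
    proof (rule AE_I2)
      fix \<xi> :: 'a
      have cont: "isCont \<Phi> (z + (r, sqrt r *\<^sub>R \<xi>))" using \<Phi> continuous_on_eq_continuous_at[OF open_UNIV] by blast
      show "(\<lambda>n. gauss \<xi> * \<Phi> (z + (R n, sqrt (R n) *\<^sub>R \<xi>))) \<longlonglongrightarrow> gauss \<xi> * \<Phi> (z + (r, sqrt r *\<^sub>R \<xi>))"
        by (intro tendsto_intros isCont_tendsto_compose[OF cont] R)
    qed
    show "AE \<xi>::'a in lborel. norm (gauss \<xi> * \<Phi> (z + (R n, sqrt (R n) *\<^sub>R \<xi>))) \<le> C * gauss \<xi>" for n
    proof (rule AE_I2)
      fix \<xi> :: 'a
      show "norm (gauss \<xi> * \<Phi> (z + (R n, sqrt (R n) *\<^sub>R \<xi>))) \<le> C * gauss \<xi>"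
        using heat_kernel_pos[of 1 \<xi>] bnd by (simp add: abs_mult mult.commute mult_right_mono)
    qed
  qed (rule meas)+
  then show "(heat_avg \<Phi> z \<circ> R) \<longlonglongrightarrow> heat_avg \<Phi> z r" by (simp add: o_def)
qed

lemma heat_avg_eq_integral:
  fixes \<Phi> :: "real \<times> 'a::euclidean_space \<Rightarrow> real"
  assumes \<Phi>: "continuous_on UNIV \<Phi>" and supp: "\<And>s x. x \<notin> cbox A B \<Longrightarrow> \<Phi> (s, x) = 0" and r: "0 < r"
  shows "heat_avg \<Phi> z r = integral (cbox A B) (\<lambda>x. heat_kernel r (x - snd z) * \<Phi> (fst z + r, x))"
proof -
  define w where "w x = heat_kernel r (x - snd z) * \<Phi> (fst z + r, x)" for x
  have w: "continuous_on UNIV w"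
    unfolding w_def using r by (intro continuous_intros continuous_on_compose2[OF \<Phi>]) auto
  have "(\<integral>x. w x \<partial>lborel) = \<bar>sqrt r\<bar> ^ DIM('a) * (\<integral>\<xi>. w (snd z + sqrt r *\<^sub>R \<xi>) \<partial>lborel)"
    using r by (intro lborel_integral_affine borel_measurable_continuous_onI[OF w]) auto
  also have "\<dots> = (\<integral>\<xi>. sqrt r ^ DIM('a) * heat_kernel r (sqrt r *\<^sub>R \<xi>) * \<Phi> (fst z + r, snd z + sqrt r *\<^sub>R \<xi>) \<partial>lborel)"
    using r by (simp add: w_def mult.assoc)
  also have "\<dots> = heat_avg \<Phi> z r"
    unfolding heat_avg_def heat_kernel_scale[OF r] by (cases z) simp
  finally show ?thesis
    using compact_support_integrable(2)[OF w, of A B] supp by (simp add: w_def[abs_def])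
qed

text \<open>The time derivative falls partly on \<open>\<phi>\<close> and partly on the kernel. The
  latter equals the Laplacian of the kernel, which integration by parts moves onto
  \<open>\<phi>\<close>.\<close>

lemma heat_avg_test_fun_deriv:
  fixes \<phi> :: "real \<times> 'a::euclidean_space \<Rightarrow> real"
  assumes t: "test_fun \<phi> D D2" and r: "0 < r"
  shows "(heat_avg \<phi> z has_real_derivative heat_avg (\<lambda>z. dt_test D z + lap_test D2 z) z r) (at r)"
proof -
  obtain K where K: "compact K" "\<And>z. z \<notin> K \<Longrightarrow> \<phi> z = 0" "\<And>z. z \<notin> K \<Longrightarrow> D z = 0" "\<And>z. z \<notin> K \<Longrightarrow> D2 z = 0"
    using test_fun_support[OF t] by metis
  obtain A B where AB: "snd ` K \<subseteq> cbox A B"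
    using bounded_subset_cbox_symmetric compact_imp_bounded[OF compact_continuous_image[OF _ K(1), of snd]] continuous_on_snd[OF continuous_on_id]
    by metis
  have out: "(s, x) \<notin> K" if "x \<notin> cbox A B" for s x using AB that by force
  note c = test_fun_continuous[OF t]
  have cc: "continuous_on S (\<lambda>x. w (p x))" if "continuous_on UNIV w" "continuous_on S p"
    for w :: "real \<times> 'a \<Rightarrow> real" and p :: "'x::topological_space \<Rightarrow> real \<times> 'a" and S
    by (rule continuous_on_compose2[OF that]) simp
  define y where "y = snd z"
  define s where "s = fst z"
  define I where "I \<rho> = integral (cbox A B) (\<lambda>x. heat_kernel \<rho> (x - y) * \<phi> (s + \<rho>, x))" for \<rho>
  have "(I has_real_derivative integral (cbox A B) (\<lambda>x. heat_kernel_t r (x - y) * \<phi> (s + r, x)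
      + D (s + r, x) (1, 0) * heat_kernel r (x - y))) (at r within {0<..})"
    unfolding I_def
  proof (rule leibniz_rule_field_derivative)
    fix \<rho> :: real and x assume "\<rho> \<in> {0<..}"
    then have "((\<lambda>\<rho>. heat_kernel \<rho> (x - y)) has_real_derivative heat_kernel_t \<rho> (x - y)) (at \<rho>)"
      by (intro heat_kernel_deriv_t) simp
    moreover have "((\<lambda>\<rho>. \<phi> (s + \<rho>, x)) has_real_derivative D (s + \<rho>, x) (1, 0)) (at \<rho>)"
      using test_fun_line_derivs(1)[OF t, of "(s, x)" "(1, 0)" \<rho>] by simp
    ultimately show "((\<lambda>\<rho>. heat_kernel \<rho> (x - y) * \<phi> (s + \<rho>, x)) has_real_derivative
       heat_kernel_t \<rho> (x - y) * \<phi> (s + \<rho>, x) + D (s + \<rho>, x) (1, 0) * heat_kernel \<rho> (x - y)) (at \<rho> within {0<..})"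
      by (intro has_field_derivative_at_within[OF DERIV_mult])
  next
    fix \<rho> :: real assume "\<rho> \<in> {0<..}"
    then show "(\<lambda>x. heat_kernel \<rho> (x - y) * \<phi> (s + \<rho>, x)) integrable_on cbox A B"
      by (intro integrable_continuous continuous_intros cc[OF c(1)]) auto
  next
    show "continuous_on ({0<..} \<times> cbox A B) (\<lambda>(\<rho>, x). heat_kernel_t \<rho> (x - y) * \<phi> (s + \<rho>, x)
        + D (s + \<rho>, x) (1, 0) * heat_kernel \<rho> (x - y))"
      unfolding split_beta by (intro continuous_intros cc[OF c(1)] cc[OF c(2)]) auto
  qed (use r in auto)
  then have "(I has_real_derivative integral (cbox A B) (\<lambda>x. heat_kernel_t r (x - y) * \<phi> (s + r, x)
      + D (s + r, x) (1, 0) * heat_kernel r (x - y))) (at r)"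
    using at_within_open[of r "{0<..}"] r by simp
  then have "(heat_avg \<phi> z has_real_derivative integral (cbox A B) (\<lambda>x. heat_kernel_t r (x - y) * \<phi> (s + r, x)
      + D (s + r, x) (1, 0) * heat_kernel r (x - y))) (at r)"
    by (rule has_field_derivative_transform_within_open[of _ _ _ "{0<..}"])
      (use r heat_avg_eq_integral[OF c(1) K(2)[OF out]] in \<open>auto simp: I_def s_def y_def\<close>)
  moreover have "integral (cbox A B) (\<lambda>x. heat_kernel_t r (x - y) * \<phi> (s + r, x) + D (s + r, x) (1, 0) * heat_kernel r (x - y))
     = heat_avg (\<lambda>z. dt_test D z + lap_test D2 z) z r"
  proof -
    define k where "k = (\<lambda>x. heat_kernel r (x - y))"
    define kx where "kx = (\<lambda>b x. heat_kernel_x r (x - y) b)"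
    define kxx where "kxx = (\<lambda>b x. heat_kernel_xx r (x - y) b)"
    define d2 where "d2 = (\<lambda>b x. blinfun_apply (blinfun_apply (D2 (s + r, x)) (0, b)) (0, b))"
    have ck: "continuous_on UNIV k" "continuous_on UNIV (kx b)" "continuous_on UNIV (kxx b)" for b
      unfolding k_def kx_def kxx_def using r by (intro continuous_intros; simp)+
    have cphi: "continuous_on UNIV (\<lambda>x. \<phi> (s + r, x))" "continuous_on UNIV (\<lambda>x. D (s + r, x) v)"
      "continuous_on UNIV (d2 b)" for v b
      unfolding d2_def by (intro cc[OF c(1)] cc[OF c(2)] cc[OF c(3)] continuous_intros)+
    \<comment> \<open>Green's identity in the single direction \<open>b\<close>: the integrand is
      the directional derivative of \<open>kx b\<close> times \<open>\<phi>\<close> minus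
      \<open>k\<close> times the derivative of \<open>\<phi>\<close>.\<close>
    have ibp: "integral (cbox A B) (\<lambda>x. kxx b x * \<phi> (s + r, x) - k x * d2 b x) = 0" for b
    proof (rule integral_dir_deriv_eq_0[where F = "\<lambda>x. kx b x * \<phi> (s + r, x) - k x * D (s + r, x) (0, b)" and b = b])
      fix x
      have "((\<lambda>\<sigma>. k (x + \<sigma> *\<^sub>R b)) has_real_derivative kx b x) (at 0)"
        "((\<lambda>\<sigma>. kx b (x + \<sigma> *\<^sub>R b)) has_real_derivative kxx b x) (at 0)"
        using heat_kernel_deriv_x[of r "x - y" b 0] by (simp_all add: k_def kx_def kxx_def algebra_simps)
      moreover have "((\<lambda>\<sigma>. \<phi> (s + r, x + \<sigma> *\<^sub>R b)) has_real_derivative D (s + r, x) (0, b)) (at 0)"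
        "((\<lambda>\<sigma>. D (s + r, x + \<sigma> *\<^sub>R b) (0, b)) has_real_derivative d2 b x) (at 0)"
        using test_fun_line_derivs(1)[OF t, where z="(s + r, x)" and v="(0, b)" and s=0]
          test_fun_line_derivs(2)[OF t, where z="(s + r, x)" and v="(0, b)" and w="(0, b)" and s=0]
        by (simp_all add: d2_def)
      ultimately have "((\<lambda>\<sigma>. kx b (x + \<sigma> *\<^sub>R b) * \<phi> (s + r, x + \<sigma> *\<^sub>R b) - k (x + \<sigma> *\<^sub>R b) * D (s + r, x + \<sigma> *\<^sub>R b) (0, b))
         has_real_derivative (kxx b x * \<phi> (s + r, x + 0 *\<^sub>R b) + D (s + r, x) (0, b) * kx b (x + 0 *\<^sub>R b))
           - (kx b x * D (s + r, x + 0 *\<^sub>R b) (0, b) + d2 b x * k (x + 0 *\<^sub>R b))) (at 0)"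
        by (intro DERIV_diff DERIV_mult)
      then show "((\<lambda>\<sigma>. kx b (x + \<sigma> *\<^sub>R b) * \<phi> (s + r, x + \<sigma> *\<^sub>R b) - k (x + \<sigma> *\<^sub>R b) * D (s + r, x + \<sigma> *\<^sub>R b) (0, b))
         has_real_derivative kxx b x * \<phi> (s + r, x) - k x * d2 b x) (at 0)"
        by (simp add: mult.commute)
    next
      fix x assume "x \<notin> cbox A B"
      then have "(s + r, x) \<notin> K" by (rule out)
      then show "kx b x * \<phi> (s + r, x) - k x * D (s + r, x) (0, b) = 0" "kxx b x * \<phi> (s + r, x) - k x * d2 b x = 0"
        using K by (auto simp: d2_def)
    qed (intro continuous_intros ck cphi)+
    have int: "w integrable_on cbox A B" if "continuous_on UNIV w" for w :: "'a \<Rightarrow> real"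
      using that by (intro integrable_continuous) (rule continuous_on_subset, auto)
    have "integral (cbox A B) (\<lambda>x. \<Sum>b\<in>Basis. kxx b x * \<phi> (s + r, x) - k x * d2 b x) = 0"
      by (subst integral_sum) (auto intro!: int continuous_intros ck cphi simp: ibp)
    then have "integral (cbox A B) (\<lambda>x. heat_kernel_t r (x - y) * \<phi> (s + r, x) - k x * lap_test D2 (s + r, x)) = 0"
      by (simp add: sum_subtractf sum_distrib_left[symmetric] sum_distrib_right[symmetric] kxx_def heat_kernel_equation
        d2_def lap_test_def)
    moreover have "integral (cbox A B) (\<lambda>x. heat_kernel_t r (x - y) * \<phi> (s + r, x) + D (s + r, x) (1, 0) * heat_kernel r (x - y))
        - integral (cbox A B) (\<lambda>x. k x * (dt_test D (s + r, x) + lap_test D2 (s + r, x)))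
      = integral (cbox A B) (\<lambda>x. heat_kernel_t r (x - y) * \<phi> (s + r, x) - k x * lap_test D2 (s + r, x))"
    proof (subst integral_diff[symmetric])
      show "(\<lambda>x. heat_kernel_t r (x - y) * \<phi> (s + r, x) + D (s + r, x) (1, 0) * heat_kernel r (x - y)) integrable_on cbox A B"
        using r by (intro int continuous_intros cphi) auto
      show "(\<lambda>x. k x * (dt_test D (s + r, x) + lap_test D2 (s + r, x))) integrable_on cbox A B"
        by (intro int continuous_intros ck cc[OF c(4)] cc[OF c(5)])
    qed (simp add: dt_test_def k_def algebra_simps)
    moreover have "heat_avg (\<lambda>z. dt_test D z + lap_test D2 z) z r = integral (cbox A B) (\<lambda>x. k x * (dt_test D (s + r, x) + lap_test D2 (s + r, x)))"
      unfolding k_def y_def s_def using c(4,5) out K r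
      by (intro heat_avg_eq_integral continuous_intros) (auto simp: dt_test_def lap_test_def)
    ultimately show ?thesis by simp
  qed
  ultimately show ?thesis by simp
qed

text \<open>The formal adjoint of \<open>\<partial>\<^sub>t - \<Delta> + L\<close> applied to the
  test function.\<close>

definition test_rhs where
  "test_rhs L \<phi> D D2 z = - dt_test D z - lap_test D2 z + L * \<phi> z"

lemma test_rhs_properties:
  assumes t: "test_fun \<phi> D D2"
  shows "continuous_on UNIV (test_rhs L \<phi> D D2)"
    and "\<exists>A B C. (\<forall>z. z \<notin> cbox A B \<longrightarrow> test_rhs L \<phi> D D2 z = 0 \<and> \<phi> z = 0) \<and> (\<forall>z. \<bar>test_rhs L \<phi> D D2 z\<bar> \<le> C \<and> \<bar>\<phi> z\<bar> \<le> C)"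
proof -
  note c = test_fun_continuous[OF t]
  show cr: "continuous_on UNIV (test_rhs L \<phi> D D2)"
    unfolding test_rhs_def[abs_def] by (intro continuous_intros c)
  obtain K where K: "compact K" "\<And>z. z \<notin> K \<Longrightarrow> \<phi> z = 0" "\<And>z. z \<notin> K \<Longrightarrow> D z = 0" "\<And>z. z \<notin> K \<Longrightarrow> D2 z = 0"
    using test_fun_support[OF t] by metis
  obtain A B where AB: "K \<subseteq> cbox A B"
    using bounded_subset_cbox_symmetric compact_imp_bounded[OF K(1)] by metis
  have z: "test_rhs L \<phi> D D2 z = 0 \<and> \<phi> z = 0" if "z \<notin> K" for z
    using K that by (simp add: test_rhs_def dt_test_def lap_test_def)
  have bd: "\<exists>C. \<forall>z\<in>K. \<bar>w z\<bar> \<le> C" if "continuous_on UNIV w" for w :: "real \<times> 'a \<Rightarrow> real"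
  proof -
    have "bounded (w ` K)"
      by (intro compact_imp_bounded compact_continuous_image K(1)) (rule continuous_on_subset[OF that], simp)
    then show ?thesis unfolding bounded_iff real_norm_def by blast
  qed
  obtain C1 C2 where C: "\<forall>z\<in>K. \<bar>test_rhs L \<phi> D D2 z\<bar> \<le> C1" "\<forall>z\<in>K. \<bar>\<phi> z\<bar> \<le> C2"
    using bd[OF cr] bd[OF c(1)] by blast
  have bnd: "\<bar>test_rhs L \<phi> D D2 z\<bar> \<le> \<bar>C1\<bar> + \<bar>C2\<bar> \<and> \<bar>\<phi> z\<bar> \<le> \<bar>C1\<bar> + \<bar>C2\<bar>" for z
  proof (cases "z \<in> K")
    case True
    then have "\<bar>test_rhs L \<phi> D D2 z\<bar> \<le> C1" "\<bar>\<phi> z\<bar> \<le> C2" using C by blast+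
    then show ?thesis by linarith
  next
    case False
    then show ?thesis using z[OF False] by simp
  qed
  have "\<forall>z. z \<notin> cbox A B \<longrightarrow> test_rhs L \<phi> D D2 z = 0 \<and> \<phi> z = 0"
    using z AB by (meson subsetD)
  moreover have "\<forall>z. \<bar>test_rhs L \<phi> D D2 z\<bar> \<le> \<bar>C1\<bar> + \<bar>C2\<bar> \<and> \<bar>\<phi> z\<bar> \<le> \<bar>C1\<bar> + \<bar>C2\<bar>"
    by (rule allI, rule bnd)
  ultimately show "\<exists>A B C. (\<forall>z. z \<notin> cbox A B \<longrightarrow> test_rhs L \<phi> D D2 z = 0 \<and> \<phi> z = 0) \<and> (\<forall>z. \<bar>test_rhs L \<phi> D D2 z\<bar> \<le> C \<and> \<bar>\<phi> z\<bar> \<le> C)"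
    by (rule_tac x=A in exI, rule_tac x=B in exI, rule_tac x="\<bar>C1\<bar> + \<bar>C2\<bar>" in exI, rule_tac conjI)
qed

text \<open>Along the backward heat flow, \<open>exp (- (L * r)) * heat_avg \<phi> z r\<close>
  decreases at the rate given by the average of \<open>test_rhs\<close>. Integrating from 0 to a
  time beyond the support recovers \<open>\<phi> z\<close>.\<close>

lemma test_fun_representation:
  fixes \<phi> :: "real \<times> 'a::euclidean_space \<Rightarrow> real"
  assumes t: "test_fun \<phi> D D2"
  obtains T where "0 \<le> T" "((\<lambda>r. exp (- (L * r)) * heat_avg (test_rhs L \<phi> D D2) z r) has_integral \<phi> z) {0..T}"
    "\<And>r. T < r \<Longrightarrow> heat_avg (test_rhs L \<phi> D D2) z r = 0"
proof -
  obtain A B C where out: "\<And>z. z \<notin> cbox A B \<Longrightarrow> test_rhs L \<phi> D D2 z = 0 \<and> \<phi> z = 0"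
    and bnd: "\<And>z. \<bar>test_rhs L \<phi> D D2 z\<bar> \<le> C" "\<And>z. \<bar>\<phi> z\<bar> \<le> C"
    using test_rhs_properties(2)[OF t] by metis
  note c = test_fun_continuous[OF t] test_rhs_properties(1)[OF t]
  \<comment> \<open>Past this age the time coordinate of \<open>z + (r, y)\<close> exceeds that of
    the upper corner of the box around the support.\<close>
  define T where "T = \<bar>fst B - fst z\<bar> + 1"
  have T: "z + (r, y) \<notin> cbox A B" if "T \<le> r" for r y
  proof
    assume "z + (r, y) \<in> cbox A B"
    moreover have "(1, 0) \<in> (Basis :: (real \<times> 'a) set)" by (simp add: Basis_prod_def)
    ultimately have "(z + (r, y)) \<bullet> (1, 0) \<le> B \<bullet> (1, 0)"
      unfolding mem_box by blast
    then have "fst z + r \<le> fst B" by (cases z; cases B) simp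
    then show False using that by (simp add: T_def)
  qed
  have far: "heat_avg \<phi> z r = 0 \<and> heat_avg (test_rhs L \<phi> D D2) z r = 0" if "T \<le> r" for r
    unfolding heat_avg_def using out[OF T[OF that]] by simp
  \<comment> \<open>The derivative is known for positive ages only, because of the square root in
    the scaling; at age 0 continuity is enough.\<close>
  have "((\<lambda>r. - (exp (- (L * r)) * heat_avg (test_rhs L \<phi> D D2) z r)) has_integral
      exp (- (L * T)) * heat_avg \<phi> z T - exp (- (L * 0)) * heat_avg \<phi> z 0) {0..T}"
  proof (rule fundamental_theorem_of_calculus_interior)
    show "0 \<le> T" by (simp add: T_def)
    show "continuous_on {0..T} (\<lambda>r. exp (- (L * r)) * heat_avg \<phi> z r)"
      by (intro continuous_intros continuous_on_subset[OF heat_avg_cont[OF c(1) bnd(2)]]) auto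
    fix r assume "r \<in> {0<..<T}"
    then have r: "0 < r" by simp
    have cont: "continuous_on UNIV (\<lambda>\<xi>. w (z + (r, sqrt r *\<^sub>R \<xi>)))" if "continuous_on UNIV w" for w :: "real \<times> 'a \<Rightarrow> real"
      by (rule continuous_on_compose2[OF that]) (auto intro!: continuous_intros)
    have int: "integrable lborel (\<lambda>\<xi>. gauss \<xi> * w (z + (r, sqrt r *\<^sub>R \<xi>)))"
      if w: "continuous_on UNIV w" "\<And>z. \<bar>w z\<bar> \<le> C" for w :: "real \<times> 'a \<Rightarrow> real"
      using heat_ext_integrable[OF borel_measurable_continuous_onI[OF cont[OF w(1)]] w(2), of 0 "-1"] by simp
    have "heat_avg (\<lambda>z. dt_test D z + lap_test D2 z) z r = heat_avg (\<lambda>z. L * \<phi> z - test_rhs L \<phi> D D2 z) z r"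
      by (simp add: test_rhs_def)
    also have "\<dots> = L * heat_avg \<phi> z r - heat_avg (test_rhs L \<phi> D D2) z r"
      unfolding heat_avg_def
      by (subst integral_mult_right_zero[symmetric], subst Bochner_Integration.integral_diff[symmetric])
        (auto intro!: int c bnd integrable_mult_right simp: algebra_simps)
    finally have eq: "heat_avg (\<lambda>z. dt_test D z + lap_test D2 z) z r = L * heat_avg \<phi> z r - heat_avg (test_rhs L \<phi> D D2) z r" .
    have "((\<lambda>r. exp (- (L * r))) has_real_derivative exp (- (L * r)) * - L) (at r)"
      by (auto intro!: derivative_eq_intros)
    from DERIV_mult[OF this heat_avg_test_fun_deriv[OF t r, of z]]
    have "((\<lambda>r. exp (- (L * r)) * heat_avg \<phi> z r) has_real_derivative - (exp (- (L * r)) * heat_avg (test_rhs L \<phi> D D2) z r)) (at r)"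
      unfolding eq by (simp add: algebra_simps)
    then show "((\<lambda>r. exp (- (L * r)) * heat_avg \<phi> z r) has_vector_derivative - (exp (- (L * r)) * heat_avg (test_rhs L \<phi> D D2) z r)) (at r)"
      by (simp add: has_real_derivative_iff_has_vector_derivative)
  qed
  from has_integral_neg[OF this]
  have "((\<lambda>r. exp (- (L * r)) * heat_avg (test_rhs L \<phi> D D2) z r) has_integral heat_avg \<phi> z 0) {0..T}"
    using far[of T] by simp
  moreover have "heat_avg \<phi> z 0 = \<phi> z"
    unfolding heat_avg_def using integral_gauss[where 'a='a] by (simp add: zero_prod_def[symmetric])
  ultimately show thesis using that[of T] far by (simp add: T_def)
qed

section \<open>Duhamel's formula\<close>

text \<open>The age of the kernel is weighted by the decay of the zero-order term, which makes the
  total mass finite. Without that decay the age measure would be Lebesgue measure on the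
  half-line.\<close>

definition decay_measure :: "real \<Rightarrow> real measure" where
  "decay_measure L = density lborel (\<lambda>r. ennreal (indicator {0<..} r * exp (- (L * r))))"

definition gauss_measure :: "'a::euclidean_space measure" where
  "gauss_measure = density lborel (\<lambda>\<xi>. ennreal (gauss \<xi>))"

definition kernel_measure :: "real \<Rightarrow> (real \<times> 'a::euclidean_space) measure" where
  "kernel_measure L = decay_measure L \<Otimes>\<^sub>M gauss_measure"

definition parabolic :: "real \<times> 'a::euclidean_space \<Rightarrow> real \<times> 'a" where
  "parabolic w = (fst w, sqrt (fst w) *\<^sub>R snd w)"

text \<open>Convolution with the fundamental solution of \<open>\<partial>\<^sub>t - \<Delta> + L\<close>, which is the image of the
  kernel measure under the parabolic scaling.\<close>

definition duhamel :: "real \<Rightarrow> (real \<times> 'a::euclidean_space \<Rightarrow> real) \<Rightarrow> real \<times> 'a \<Rightarrow> real" where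
  "duhamel L F z = (\<integral>w. F (z - parabolic w) \<partial>kernel_measure L)"

lemma parabolic_cont [continuous_intros]: "continuous_on S p \<Longrightarrow> continuous_on S (\<lambda>x. parabolic (p x))"
  unfolding parabolic_def by (intro continuous_intros)

lemma borel_comp_continuous:
  "F \<in> borel_measurable borel \<Longrightarrow> continuous_on UNIV p \<Longrightarrow> (\<lambda>x. F (p x)) \<in> borel_measurable borel"
  by (rule measurable_compose[OF borel_measurable_continuous_onI])

lemma sets_decay [simp, measurable_cong]: "sets (decay_measure L) = sets borel"
  by (simp add: decay_measure_def)

lemma sets_gauss [simp, measurable_cong]: "sets gauss_measure = sets borel"
  by (simp add: gauss_measure_def)

lemma sets_borel_pair:
  "sets (borel \<Otimes>\<^sub>M borel) = sets (borel :: ('b::euclidean_space \<times> 'c::euclidean_space) measure)"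
proof -
  have "sets (borel \<Otimes>\<^sub>M borel :: ('b \<times> 'c) measure) = sets (lborel \<Otimes>\<^sub>M lborel)"
    by (intro sets_pair_measure_cong) simp_all
  then show ?thesis unfolding lborel_prod by simp
qed

lemma sets_kernel [simp, measurable_cong]: "sets (kernel_measure L) = sets borel"
  unfolding kernel_measure_def sets_pair_measure_cong[OF sets_decay sets_gauss] by (rule sets_borel_pair)

lemma space_kernel [simp]: "space (kernel_measure L) = UNIV" "space (decay_measure L) = UNIV" "space gauss_measure = UNIV"
  using sets_eq_imp_space_eq[OF sets_kernel] sets_eq_imp_space_eq[OF sets_decay] sets_eq_imp_space_eq[OF sets_gauss]
  by simp_all

text \<open>The mass of ages below \<open>t\<close> is all that acts on a source vanishing before
  time 0. Times \<open>L\<close> it is \<open>1 - exp (- (L * t))\<close>: below 1, which gives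
  contraction and invariant bounds, and tending to 0 with \<open>t\<close>, which gives the initial
  value.\<close>

lemma emeasure_decay_lessThan:
  assumes L: "0 < L" and t: "0 \<le> t"
  shows "emeasure (decay_measure L) {..<t} = ennreal ((1 - exp (- (L * t))) / L)"
proof -
  have "emeasure (decay_measure L) {..<t} = (\<integral>\<^sup>+r. ennreal (indicator {0<..} r * exp (- (L * r))) * indicator {..<t} r \<partial>lborel)"
    unfolding decay_measure_def by (subst emeasure_density) auto
  also have "\<dots> = (\<integral>\<^sup>+r. ennreal (exp (- (L * r))) * indicator {0..t} r \<partial>lborel)"
  proof (rule nn_integral_cong_AE)
    have "AE r::real in lborel. r \<noteq> 0 \<and> r \<noteq> t" using AE_lborel_singleton[of 0] AE_lborel_singleton[of t] by eventually_elim simp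
    then show "AE r in lborel. ennreal (indicator {0<..} r * exp (- (L * r))) * indicator {..<t} r = ennreal (exp (- (L * r))) * indicator {0..t} r"
      by eventually_elim (auto simp: indicator_def)
  qed
  also have "\<dots> = ennreal (- (exp (- (L * t)) / L) - - (exp (- (L * 0)) / L))"
    using L t by (intro nn_integral_FTC_Icc) (auto intro!: derivative_eq_intros)
  finally show ?thesis using L by (simp add: diff_divide_distrib)
qed

lemma emeasure_decay_UNIV:
  assumes L: "0 < L" shows "emeasure (decay_measure L) UNIV = ennreal (1 / L)"
proof -
  have "emeasure (decay_measure L) UNIV = (\<integral>\<^sup>+r. ennreal (indicator {0<..} r * exp (- (L * r))) * indicator UNIV r \<partial>lborel)"
    unfolding decay_measure_def by (subst emeasure_density) auto
  also have "\<dots> = (\<integral>\<^sup>+r. ennreal (exp (- (L * r))) * indicator {0..} r \<partial>lborel)"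
  proof (rule nn_integral_cong_AE)
    show "AE r in lborel. ennreal (indicator {0<..} r * exp (- (L * r))) * indicator UNIV r = ennreal (exp (- (L * r))) * indicator {0..} r"
      using AE_lborel_singleton[of 0] by eventually_elim (auto simp: indicator_def)
  qed
  also have "\<dots> = ennreal (0 - - (exp (- (L * 0)) / L))"
  proof (rule nn_integral_FTC_atLeast)
    have "((\<lambda>r. - (exp (- (L * r)) * inverse L)) \<longlongrightarrow> - (0 * inverse L)) at_top"
      using L by (intro tendsto_intros filterlim_compose[OF exp_at_bot] filterlim_compose[OF filterlim_uminus_at_bot_at_top]
        filterlim_tendsto_pos_mult_at_top[OF tendsto_const] filterlim_ident) auto
    then show "((\<lambda>r. - (exp (- (L * r)) / L)) \<longlongrightarrow> 0) at_top" by (simp add: divide_inverse)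
  qed (use L in \<open>auto intro!: derivative_eq_intros\<close>)
  finally show ?thesis by simp
qed

lemma emeasure_gauss_UNIV: "emeasure (gauss_measure :: 'a::euclidean_space measure) UNIV = 1"
  unfolding gauss_measure_def using nn_integral_gauss[where 'a='a] by (simp add: emeasure_density)

lemma finite_decay: "0 < L \<Longrightarrow> finite_measure (decay_measure L)"
  by (rule finite_measureI) (simp add: emeasure_decay_UNIV)

lemma finite_gauss: "finite_measure gauss_measure"
  by (rule finite_measureI) (simp add: emeasure_gauss_UNIV)

lemma finite_kernel: "0 < L \<Longrightarrow> finite_measure (kernel_measure L)"
  unfolding kernel_measure_def by (intro finite_measure_pair_measure finite_decay finite_gauss)

lemma pair_decay_gauss: "0 < L \<Longrightarrow> pair_sigma_finite (decay_measure L) gauss_measure"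
  by (intro pair_sigma_finite.intro finite_measure.axioms(1) finite_decay finite_gauss)

lemma emeasure_kernel_lessThan:
  assumes L: "0 < L" and t: "0 \<le> t"
  shows "emeasure (kernel_measure L :: (real \<times> 'a::euclidean_space) measure) ({..<t} \<times> UNIV) = ennreal ((1 - exp (- (L * t))) / L)"
proof -
  interpret gauss: finite_measure "gauss_measure :: 'a measure" by (rule finite_gauss)
  show ?thesis unfolding kernel_measure_def
    by (subst gauss.emeasure_pair_measure_Times) (simp_all add: emeasure_gauss_UNIV emeasure_decay_lessThan L t)
qed

text \<open>Age 0 and any single prescribed age are negligible. The choice \<open>t = fst z\<close>
  removes the ages that land on time 0, where sources may jump.\<close>

lemma kernel_AE:
  assumes L: "0 < L"
  shows "AE w in (kernel_measure L :: (real \<times> 'a::euclidean_space) measure). 0 < fst w \<and> fst w \<noteq> t"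
proof -
  interpret pair_sigma_finite "decay_measure L" "gauss_measure :: 'a measure" by (rule pair_decay_gauss[OF L])
  have "AE r in decay_measure L. 0 < r \<and> r \<noteq> t"
    unfolding decay_measure_def
  proof (subst AE_density)
    show "AE r in lborel. 0 < ennreal (indicator {0<..} r * exp (- (L * r))) \<longrightarrow> 0 < r \<and> r \<noteq> t"
      using AE_lborel_singleton[of t] by eventually_elim (auto simp: indicator_def)
  qed auto
  then have "AE r in decay_measure L. AE \<xi> in (gauss_measure :: 'a measure). 0 < fst (r, \<xi>) \<and> fst (r, \<xi>) \<noteq> t" by eventually_elim simp
  moreover have "{w :: real \<times> 'a. 0 < fst w \<and> fst w \<noteq> t} \<in> sets (kernel_measure L)"
    unfolding sets_kernel
    by (intro borel_open open_Collect_conj open_Collect_less open_Collect_neq continuous_intros)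
  ultimately show ?thesis
    unfolding kernel_measure_def using AE_pair_measure[of "\<lambda>w. 0 < fst w \<and> fst w \<noteq> t"]
    by (simp add: kernel_measure_def space_pair_measure)
qed

lemma integral_gauss_measure:
  "w \<in> borel_measurable borel \<Longrightarrow> (\<integral>\<xi>. w \<xi> \<partial>gauss_measure) = (\<integral>\<xi>. gauss \<xi> * (w \<xi> :: real) \<partial>lborel)"
  unfolding gauss_measure_def by (subst integral_density) (auto simp: heat_kernel_pos less_imp_le)

lemma integral_decay_measure:
  "w \<in> borel_measurable borel \<Longrightarrow> (\<integral>r. w r \<partial>decay_measure L) = (\<integral>r. indicator {0<..} r * exp (- (L * r)) * (w r :: real) \<partial>lborel)"
  unfolding decay_measure_def by (subst integral_density) auto

lemma kernel_integrable:
  assumes "0 < L" "w \<in> borel_measurable borel" "\<And>x. \<bar>w x\<bar> \<le> C"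
  shows "integrable (kernel_measure L) (w :: real \<times> 'a::euclidean_space \<Rightarrow> real)"
  using assms by (intro finite_measure.integrable_const_bound[OF finite_kernel, where B=C] AE_I2)
    (auto simp: measurable_cong_sets[OF sets_kernel refl])

lemma integral_kernel_iterated:
  fixes w :: "real \<times> 'a::euclidean_space \<Rightarrow> real"
  assumes L: "0 < L" and w: "w \<in> borel_measurable borel" "\<And>x. \<bar>w x\<bar> \<le> C"
  shows "(\<integral>x. w x \<partial>kernel_measure L) = (\<integral>r. (\<integral>\<xi>. w (r, \<xi>) \<partial>gauss_measure) \<partial>decay_measure L)"
proof -
  interpret pair_sigma_finite "decay_measure L" "gauss_measure :: 'a measure" by (rule pair_decay_gauss[OF L])
  show ?thesis using integral_fst'[of w] kernel_integrable[OF L w] by (simp add: kernel_measure_def)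
qed

section \<open>Duality and the weak form of Duhamel's formula\<close>

lemma kernel_represents_test_fun:
  fixes \<phi> :: "real \<times> 'a::euclidean_space \<Rightarrow> real"
  assumes t: "test_fun \<phi> D D2" and L: "0 < L"
  shows "(\<integral>w. test_rhs L \<phi> D D2 (z + parabolic w) \<partial>kernel_measure L) = \<phi> z"
proof -
  let ?\<psi> = "test_rhs L \<phi> D D2"
  obtain C where C: "\<And>z. \<bar>?\<psi> z\<bar> \<le> C" using test_rhs_properties(2)[OF t] by metis
  have c: "continuous_on UNIV ?\<psi>" by (rule test_rhs_properties(1)[OF t])
  have cc: "continuous_on UNIV (\<lambda>x. ?\<psi> (p x))" if "continuous_on UNIV p" for p :: "'x::topological_space \<Rightarrow> real \<times> 'a"
    by (rule continuous_on_compose2[OF c that]) simp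
  obtain T where T: "0 \<le> T" "((\<lambda>r. exp (- (L * r)) * heat_avg ?\<psi> z r) has_integral \<phi> z) {0..T}"
    "\<And>r. T < r \<Longrightarrow> heat_avg ?\<psi> z r = 0"
    using test_fun_representation[OF t] by blast
  have ha: "continuous_on UNIV (heat_avg ?\<psi> z)" by (rule heat_avg_cont[OF c C])
  have "(\<integral>w. ?\<psi> (z + parabolic w) \<partial>kernel_measure L) = (\<integral>r. (\<integral>\<xi>. ?\<psi> (z + parabolic (r, \<xi>)) \<partial>gauss_measure) \<partial>decay_measure L)"
    by (intro integral_kernel_iterated[OF L _ C] borel_measurable_continuous_onI cc continuous_intros)
  also have "\<dots> = (\<integral>r. heat_avg ?\<psi> z r \<partial>decay_measure L)"
  proof (intro Bochner_Integration.integral_cong refl)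
    fix r :: real
    have "continuous_on UNIV (\<lambda>\<xi>::'a. ?\<psi> (z + parabolic (r, \<xi>)))" by (intro cc continuous_intros)
    from integral_gauss_measure[OF borel_measurable_continuous_onI[OF this]]
    show "(\<integral>\<xi>. ?\<psi> (z + parabolic (r, \<xi>)) \<partial>gauss_measure) = heat_avg ?\<psi> z r"
      by (simp add: heat_avg_def parabolic_def)
  qed
  also have "\<dots> = (\<integral>r. indicator {0<..} r * exp (- (L * r)) * heat_avg ?\<psi> z r \<partial>lborel)"
    by (rule integral_decay_measure[OF borel_measurable_continuous_onI[OF ha]])
  \<comment> \<open>The endpoint 0 is a null set, and for ages beyond \<open>T\<close> the average
    vanishes.\<close>
  also have "\<dots> = (\<integral>r. indicator {0..T} r *\<^sub>R (exp (- (L * r)) * heat_avg ?\<psi> z r) \<partial>lborel)"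
  proof (rule integral_cong_AE)
    have [measurable]: "heat_avg ?\<psi> z \<in> borel_measurable borel" by (rule borel_measurable_continuous_onI[OF ha])
    show "(\<lambda>r. indicator {0<..} r * exp (- (L * r)) * heat_avg ?\<psi> z r) \<in> borel_measurable lborel"
      "(\<lambda>r. indicator {0..T} r *\<^sub>R (exp (- (L * r)) * heat_avg ?\<psi> z r)) \<in> borel_measurable lborel"
      by measurable
    show "AE r in lborel. indicator {0<..} r * exp (- (L * r)) * heat_avg ?\<psi> z r = indicator {0..T} r *\<^sub>R (exp (- (L * r)) * heat_avg ?\<psi> z r)"
      using AE_lborel_singleton[of 0] by eventually_elim (auto simp: indicator_def T(3))
  qed
  also have "\<dots> = integral {0..T} (\<lambda>r. exp (- (L * r)) * heat_avg ?\<psi> z r)"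
  proof -
    have "integrable lborel (\<lambda>r. indicator {0..T} r *\<^sub>R (exp (- (L * r)) * heat_avg ?\<psi> z r))"
      by (intro borel_integrable_compact compact_Icc continuous_intros continuous_on_subset[OF ha]) simp
    then show ?thesis
      using set_borel_integral_eq_integral(2)[of "{0..T}" "\<lambda>r. exp (- (L * r)) * heat_avg ?\<psi> z r"]
      by (simp add: set_integrable_def set_lebesgue_integral_def)
  qed
  also have "\<dots> = \<phi> z" by (rule integral_unique[OF T(2)])
  finally show ?thesis .
qed

text \<open>Over a finite measure a uniform bound on the inner \<open>L^1\<close> norms is already
  integrable, which is the hypothesis of Fubini's theorem.\<close>

lemma integrable_finite_times:
  fixes w :: "'b \<times> 'c \<Rightarrow> real"
  assumes M: "finite_measure M" and N: "sigma_finite_measure N"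
    and w: "w \<in> borel_measurable (M \<Otimes>\<^sub>M N)" and int: "\<And>x. x \<in> space M \<Longrightarrow> integrable N (\<lambda>y. w (x, y))"
    and bnd: "\<And>x. x \<in> space M \<Longrightarrow> (\<integral>y. \<bar>w (x, y)\<bar> \<partial>N) \<le> C"
  shows "integrable (M \<Otimes>\<^sub>M N) w"
proof -
  interpret M: finite_measure M by fact
  interpret N: sigma_finite_measure N by fact
  interpret pair_sigma_finite M N by standard
  note [measurable] = w
  show ?thesis
  proof (rule Fubini_integrable[OF w])
    show "integrable M (\<lambda>x. \<integral>y. norm (w (x, y)) \<partial>N)"
    proof (rule M.integrable_const_bound[where B=C])
      show "AE x in M. norm (\<integral>y. norm (w (x, y)) \<partial>N) \<le> C"
        using bnd by (intro AE_I2) simp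
      show "(\<lambda>x. \<integral>y. norm (w (x, y)) \<partial>N) \<in> borel_measurable M" by measurable
    qed
    show "AE x in M. integrable N (\<lambda>y. w (x, y))" using int by (intro AE_I2) simp
  qed
qed

lemma sets_kernel_lborel: "sets (kernel_measure L \<Otimes>\<^sub>M (lborel :: 'b::euclidean_space measure)) = sets borel"
  unfolding sets_pair_measure_cong[OF sets_kernel sets_lborel] by (rule sets_borel_pair)

text \<open>Adjointness: translating \<open>z\<close> by \<open>parabolic w\<close> moves the kernel from \<open>F\<close> onto \<open>\<psi>\<close>.\<close>

lemma kernel_duality:
  fixes F \<psi> :: "'b::euclidean_space \<Rightarrow> real" and p :: "real \<times> 'a::euclidean_space \<Rightarrow> 'b" and \<Psi> :: "real \<times> 'a \<Rightarrow> 'b \<Rightarrow> real"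
  assumes L: "0 < L" and F: "F \<in> borel_measurable borel"
    and \<Psi>: "continuous_on UNIV (\<lambda>x. \<Psi> (fst x) (snd x))" and p: "continuous_on UNIV p"
    and int: "\<And>w. integrable lborel (\<lambda>z. \<Psi> w z * F (z - p w))"
    and bnd: "\<And>w. (\<integral>z. \<bar>\<Psi> w z * F (z - p w)\<bar> \<partial>lborel) \<le> C"
  shows "(\<integral>z. (\<integral>w. \<Psi> w z * F (z - p w) \<partial>kernel_measure L) \<partial>lborel) = (\<integral>w. (\<integral>z. \<Psi> w z * F (z - p w) \<partial>lborel) \<partial>kernel_measure L)"
    and "(\<integral>w. (\<integral>z. \<Psi> w z * F (z - p w) \<partial>lborel) \<partial>kernel_measure L) = (\<integral>z. F z * (\<integral>w. \<Psi> w (z + p w) \<partial>kernel_measure L) \<partial>lborel)"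
proof -
  interpret K: finite_measure "kernel_measure L :: (real \<times> 'a) measure" by (rule finite_kernel[OF L])
  interpret pair_sigma_finite "kernel_measure L :: (real \<times> 'a) measure" "lborel :: 'b measure" by standard
  have p': "continuous_on UNIV (\<lambda>x::(real \<times> 'a) \<times> 'b. p (fst x))"
    by (rule continuous_on_compose2[OF p]) (auto intro!: continuous_intros)
  have m1: "(\<lambda>x. \<Psi> (fst x) (snd x) * F (snd x - p (fst x))) \<in> borel_measurable (kernel_measure L \<Otimes>\<^sub>M lborel)"
    unfolding measurable_cong_sets[OF sets_kernel_lborel refl]
    by (intro borel_measurable_times borel_measurable_continuous_onI[OF \<Psi>] borel_comp_continuous[OF F] continuous_intros p')
  have i1: "integrable (kernel_measure L \<Otimes>\<^sub>M lborel) (\<lambda>x. \<Psi> (fst x) (snd x) * F (snd x - p (fst x)))"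
    by (rule integrable_finite_times[OF K.finite_measure_axioms lborel.sigma_finite_measure_axioms m1]) (use int bnd in auto)
  show "(\<integral>z. (\<integral>w. \<Psi> w z * F (z - p w) \<partial>kernel_measure L) \<partial>lborel) = (\<integral>w. (\<integral>z. \<Psi> w z * F (z - p w) \<partial>lborel) \<partial>kernel_measure L)"
    using Fubini_integral[of "\<lambda>w z. \<Psi> w z * F (z - p w)"] i1 by (simp add: split_beta')
  have slice: "(\<lambda>z. \<Psi> w z) \<in> borel_measurable borel" for w
    using borel_comp_continuous[OF borel_measurable_continuous_onI[OF \<Psi>], of "\<lambda>z. (w, z)"] by (simp add: continuous_intros)
  have sm: "(\<lambda>z. \<Psi> w z * F (z - p w)) \<in> borel_measurable borel" for w
    by (intro borel_measurable_times slice borel_comp_continuous[OF F] continuous_intros)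
  \<comment> \<open>Stated for a general \<open>G\<close>: the identity gives equality of the inner
    integrals, the absolute value transfers the bound \<open>C\<close> to the translated
    integrand.\<close>
  have tr: "(\<integral>z. G (\<Psi> w (z + p w) * F z) \<partial>lborel) = (\<integral>z. G (\<Psi> w z * F (z - p w)) \<partial>lborel)"
    if [measurable]: "G \<in> borel_measurable borel" for w and G :: "real \<Rightarrow> real"
  proof -
    note [measurable] = sm[of w]
    have "(\<lambda>z. G (\<Psi> w z * F (z - p w))) \<in> borel_measurable borel" by measurable
    from lborel_integral_translate[OF this, of "p w"] show ?thesis by simp
  qed
  have cont2: "continuous_on UNIV (\<lambda>x::(real \<times> 'a) \<times> 'b. \<Psi> (fst x) (snd x + p (fst x)))"
  proof -
    have "continuous_on UNIV (\<lambda>x::(real \<times> 'a) \<times> 'b. (fst x, snd x + p (fst x)))" by (intro continuous_intros p')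
    from continuous_on_compose2[OF \<Psi> this] show ?thesis by simp
  qed
  have m2: "(\<lambda>x. \<Psi> (fst x) (snd x + p (fst x)) * F (snd x)) \<in> borel_measurable (kernel_measure L \<Otimes>\<^sub>M lborel)"
    unfolding measurable_cong_sets[OF sets_kernel_lborel refl]
    by (intro borel_measurable_times borel_measurable_continuous_onI[OF cont2] borel_comp_continuous[OF F] continuous_intros)
  have int2: "integrable lborel (\<lambda>z. \<Psi> w (z + p w) * F z)" for w
  proof -
    have "integrable (distr lborel borel ((+) (p w))) (\<lambda>z. \<Psi> w z * F (z - p w))"
      using int[of w] by (simp add: lborel_distr_plus)
    then have "integrable lborel (\<lambda>z. \<Psi> w (p w + z) * F (p w + z - p w))"
      by (subst (asm) integrable_distr_eq) (auto simp: sm)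
    then show ?thesis by (simp add: add.commute)
  qed
  have i2: "integrable (kernel_measure L \<Otimes>\<^sub>M lborel) (\<lambda>x. \<Psi> (fst x) (snd x + p (fst x)) * F (snd x))"
    by (rule integrable_finite_times[OF K.finite_measure_axioms lborel.sigma_finite_measure_axioms m2])
      (use int2 bnd tr[of abs] in auto)
  have "(\<integral>w. (\<integral>z. \<Psi> w z * F (z - p w) \<partial>lborel) \<partial>kernel_measure L) = (\<integral>w. (\<integral>z. \<Psi> w (z + p w) * F z \<partial>lborel) \<partial>kernel_measure L)"
    using tr[of "\<lambda>x. x"] by simp
  also have "\<dots> = (\<integral>z. (\<integral>w. \<Psi> w (z + p w) * F z \<partial>kernel_measure L) \<partial>lborel)"
    using Fubini_integral[of "\<lambda>w z. \<Psi> w (z + p w) * F z"] i2 by (simp add: split_beta')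
  also have "\<dots> = (\<integral>z. F z * (\<integral>w. \<Psi> w (z + p w) \<partial>kernel_measure L) \<partial>lborel)" by (simp add: mult.commute)
  finally show "(\<integral>w. (\<integral>z. \<Psi> w z * F (z - p w) \<partial>lborel) \<partial>kernel_measure L) = (\<integral>z. F z * (\<integral>w. \<Psi> w (z + p w) \<partial>kernel_measure L) \<partial>lborel)" .
qed

lemma bounded_times_integrable:
  fixes a b :: "'b::euclidean_space \<Rightarrow> real"
  assumes a: "integrable lborel a" and b: "b \<in> borel_measurable borel" "\<And>x. \<bar>b x\<bar> \<le> C"
  shows "integrable lborel (\<lambda>x. a x * b x)" "(\<integral>x. \<bar>a x * b x\<bar> \<partial>lborel) \<le> C * (\<integral>x. \<bar>a x\<bar> \<partial>lborel)"
proof -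
  have am: "a \<in> borel_measurable borel" using borel_measurable_integrable[OF a] by simp
  have le: "\<bar>a x * b x\<bar> \<le> C * \<bar>a x\<bar>" for x
    using mult_right_mono[OF b(2)[of x], of "\<bar>a x\<bar>"] by (simp add: abs_mult mult.commute)
  have i: "integrable lborel (\<lambda>x. C * \<bar>a x\<bar>)" using a by simp
  show *: "integrable lborel (\<lambda>x. a x * b x)"
    using am b(1) le by (intro Bochner_Integration.integrable_bound[OF i]) (auto intro!: AE_I2 order_trans[OF le])
  show "(\<integral>x. \<bar>a x * b x\<bar> \<partial>lborel) \<le> C * (\<integral>x. \<bar>a x\<bar> \<partial>lborel)"
    using integral_mono[OF integrable_abs[OF *] i le] by simp
qed

text \<open>In weak form, \<open>duhamel L F\<close> solves the equation for
  \<open>\<partial>\<^sub>t - \<Delta> + L\<close> with source \<open>F\<close>: duality moves the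
  kernel onto \<open>test_rhs\<close>, and the kernel turns that back into
  \<open>\<phi>\<close>.\<close>

lemma duhamel_weak:
  fixes F :: "real \<times> 'a::euclidean_space \<Rightarrow> real"
  assumes t: "test_fun \<phi> D D2" and L: "0 < L" and F: "F \<in> borel_measurable borel" "\<And>z. \<bar>F z\<bar> \<le> C"
  shows "(\<integral>z. test_rhs L \<phi> D D2 z * duhamel L F z \<partial>lborel) = (\<integral>z. F z * \<phi> z \<partial>lborel)"
proof -
  let ?\<psi> = "test_rhs L \<phi> D D2"
  have c: "continuous_on UNIV ?\<psi>" by (rule test_rhs_properties(1)[OF t])
  obtain A B where "\<And>z. z \<notin> cbox A B \<Longrightarrow> ?\<psi> z = 0" using test_rhs_properties(2)[OF t] by metis
  then have i: "integrable lborel ?\<psi>" by (intro compact_support_integrable(1)[OF c])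
  have Fm: "(\<lambda>z. F (z - parabolic w)) \<in> borel_measurable borel" for w
    by (intro borel_comp_continuous[OF F(1)] continuous_intros)
  have c': "continuous_on UNIV (\<lambda>x::(real \<times> 'a) \<times> (real \<times> 'a). ?\<psi> (snd x))"
    by (rule continuous_on_compose2[OF c]) (auto intro!: continuous_intros)
  note dual = kernel_duality[OF L F(1), of "\<lambda>w. ?\<psi>" parabolic, OF c' parabolic_cont[OF continuous_on_id]
    bounded_times_integrable(1)[OF i Fm F(2)] bounded_times_integrable(2)[OF i Fm F(2)]]
  have "(\<integral>z. ?\<psi> z * duhamel L F z \<partial>lborel) = (\<integral>z. (\<integral>w. ?\<psi> z * F (z - parabolic w) \<partial>kernel_measure L) \<partial>lborel)"
    by (simp add: duhamel_def)
  also have "\<dots> = (\<integral>z. F z * (\<integral>w. ?\<psi> (z + parabolic w) \<partial>kernel_measure L) \<partial>lborel)"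
    using dual by simp
  also have "\<dots> = (\<integral>z. F z * \<phi> z \<partial>lborel)" by (simp add: kernel_represents_test_fun[OF t L])
  finally show ?thesis .
qed

text \<open>The solution of the homogeneous equation for
  \<open>\<partial>\<^sub>t - \<Delta> + L\<close> with datum \<open>g\<close>, extended by 0 to
  nonpositive times.\<close>

definition initial_part :: "real \<Rightarrow> ('a::euclidean_space \<Rightarrow> real) \<Rightarrow> real \<times> 'a \<Rightarrow> real" where
  "initial_part L g z = (if 0 < fst z then exp (- (L * fst z)) * heat_ext g (fst z) (snd z) else 0)"

lemma sets_borel_lborel: "sets (borel \<Otimes>\<^sub>M lborel) = sets (borel :: ('b::euclidean_space \<times> 'c::euclidean_space) measure)"
  unfolding sets_pair_measure_cong[OF refl sets_lborel] by (rule sets_borel_pair)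

lemma heat_ext_measurable:
  fixes g :: "'a::euclidean_space \<Rightarrow> real"
  assumes "g \<in> borel_measurable borel"
  shows "(\<lambda>z. heat_ext g (fst z) (snd z)) \<in> borel_measurable borel"
  unfolding heat_ext_def
proof (rule lborel.borel_measurable_lebesgue_integral)
  show "(\<lambda>(z, \<xi>). gauss \<xi> * g (snd z - sqrt (fst z) *\<^sub>R \<xi>)) \<in> borel_measurable (borel \<Otimes>\<^sub>M lborel)"
    unfolding split_beta' measurable_cong_sets[OF sets_borel_lborel refl]
    by (intro borel_measurable_times borel_comp_continuous[OF assms] borel_comp_continuous[OF gauss_measurable] continuous_intros)
qed

lemma heat_ext_abs_le:
  fixes g :: "'a::euclidean_space \<Rightarrow> real"
  assumes "g \<in> borel_measurable borel" "\<And>x. \<bar>g x\<bar> \<le> C"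
  shows "\<bar>heat_ext g t x\<bar> \<le> C"
proof -
  have "\<bar>heat_ext g t x\<bar> \<le> (\<integral>\<xi>. C * gauss (\<xi>::'a) \<partial>lborel)"
    unfolding heat_ext_def real_norm_def[symmetric]
  proof (rule Bochner_Integration.integral_norm_bound_integral)
    show "integrable lborel (\<lambda>\<xi>. gauss \<xi> * g (x - sqrt t *\<^sub>R \<xi>))" by (rule heat_ext_integrable[OF assms])
    show "integrable lborel (\<lambda>\<xi>::'a. C * gauss \<xi>)" by (intro integrable_mult_right integrable_gauss)
    fix \<xi> :: 'a
    show "norm (gauss \<xi> * g (x - sqrt t *\<^sub>R \<xi>)) \<le> C * gauss \<xi>"
      using heat_kernel_pos[of 1 \<xi>] assms(2) by (simp add: abs_mult mult.commute mult_right_mono)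
  qed
  then show ?thesis by (simp add: integral_gauss)
qed

lemma initial_part_measurable:
  fixes g :: "'a::euclidean_space \<Rightarrow> real"
  assumes "g \<in> borel_measurable borel"
  shows "initial_part L g \<in> borel_measurable borel"
proof -
  note [measurable] = heat_ext_measurable[OF assms]
  have [measurable]: "(\<lambda>z::real \<times> 'a. fst z) \<in> borel_measurable borel"
    by (intro borel_measurable_continuous_onI continuous_intros)
  show ?thesis unfolding initial_part_def[abs_def] by measurable
qed

lemma initial_part_le:
  assumes "0 < L" "g \<in> borel_measurable borel" "\<And>x. 0 \<le> g x" "\<And>x. g x \<le> C"
  shows "0 \<le> initial_part L g z" "0 \<le> fst z \<Longrightarrow> initial_part L g z \<le> exp (- (L * fst z)) * C" "\<bar>initial_part L g z\<bar> \<le> C"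
proof -
  have C: "0 \<le> C" using assms(3,4) order_trans by blast
  have h: "0 \<le> heat_ext g t x" "heat_ext g t x \<le> C" for t x
    using heat_ext_nonneg[of g t x] heat_ext_abs_le[of g C t x] assms by (auto simp: abs_le_iff)
  show nn: "0 \<le> initial_part L g z" by (simp add: initial_part_def h)
  show le: "0 \<le> fst z \<Longrightarrow> initial_part L g z \<le> exp (- (L * fst z)) * C"
    using h C by (simp add: initial_part_def mult_left_mono)
  show "\<bar>initial_part L g z\<bar> \<le> C"
  proof (cases "0 < fst z")
    case True
    then have "exp (- (L * fst z)) * C \<le> 1 * C" using assms(1) C by (intro mult_right_mono) auto
    then show ?thesis using le nn True by simp
  qed (simp add: initial_part_def C)
qed

text \<open>Duality with a shift in space alone brings in the representation of
  \<open>\<phi>\<close> at the points \<open>(0, y)\<close>, where \<open>\<phi>\<close> vanishes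
  because its support lies in positive times. The remaining steps identify the other side with the
  integral of the initial part.\<close>

lemma initial_part_weak:
  fixes g :: "'a::euclidean_space \<Rightarrow> real"
  assumes t: "test_fun \<phi> D D2" and L: "0 < L" and g: "g \<in> borel_measurable borel" "integrable lborel g"
    and g_nonneg: "\<And>x. 0 \<le> g x" and g_le: "\<And>x. g x \<le> M"
  shows "(\<integral>z. test_rhs L \<phi> D D2 z * initial_part L g z \<partial>lborel) = 0"
proof -
  let ?\<psi> = "test_rhs L \<phi> D D2"
  let ?p = "\<lambda>w::real \<times> 'a. sqrt (fst w) *\<^sub>R snd w"
  have c: "continuous_on UNIV ?\<psi>" by (rule test_rhs_properties(1)[OF t])
  have cc: "continuous_on UNIV (\<lambda>x. ?\<psi> (p x))" if "continuous_on UNIV p" for p :: "'x::topological_space \<Rightarrow> real \<times> 'a"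
    by (rule continuous_on_compose2[OF c that]) simp
  obtain A B C where supp: "\<And>z. z \<notin> cbox A B \<Longrightarrow> ?\<psi> z = 0" and C: "\<And>z. \<bar>?\<psi> z\<bar> \<le> C"
    using test_rhs_properties(2)[OF t] by metis
  then have \<psi>_int: "integrable lborel ?\<psi>" by (intro compact_support_integrable(1)[OF c])
  have g_abs: "\<bar>g x\<bar> \<le> M" for x using g_nonneg[of x] g_le[of x] by simp
  have shift_int: "integrable lborel (\<lambda>x. g (x - a))" "(\<integral>x. \<bar>g (x - a)\<bar> \<partial>lborel) = (\<integral>x. \<bar>g x\<bar> \<partial>lborel)" for a
  proof -
    have "integrable (distr lborel borel ((+) (- a))) g" using g(2) by (simp add: lborel_distr_plus)
    then show "integrable lborel (\<lambda>x. g (x - a))"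
      by (subst (asm) integrable_distr_eq) (auto simp: g(1) add.commute)
    show "(\<integral>x. \<bar>g (x - a)\<bar> \<partial>lborel) = (\<integral>x. \<bar>g x\<bar> \<partial>lborel)"
      using lborel_integral_translate[of "\<lambda>x. \<bar>g x\<bar>" "- a"] g(1) by simp
  qed
  have slice: "(\<lambda>x. ?\<psi> (r, x)) \<in> borel_measurable borel" for r
    by (intro borel_measurable_continuous_onI cc continuous_intros)
  have int: "integrable lborel (\<lambda>x. ?\<psi> (r, x) * g (x - a))"
    and bnd: "(\<integral>x. \<bar>?\<psi> (r, x) * g (x - a)\<bar> \<partial>lborel) \<le> C * (\<integral>x. \<bar>g x\<bar> \<partial>lborel)" for r a
    using bounded_times_integrable[OF shift_int(1)[of a] slice[of r] C] unfolding shift_int(2) by (simp_all add: mult.commute)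
  define J where "J w = (\<integral>x. ?\<psi> (fst w, x) * g (x - ?p w) \<partial>lborel)" for w
  have J_meas: "J \<in> borel_measurable borel"
    unfolding J_def[abs_def]
  proof (rule lborel.borel_measurable_lebesgue_integral)
    show "(\<lambda>(w, x). ?\<psi> (fst w, x) * g (x - ?p w)) \<in> borel_measurable (borel \<Otimes>\<^sub>M lborel)"
      unfolding split_beta' measurable_cong_sets[OF sets_borel_lborel refl]
      by (intro borel_measurable_times borel_comp_continuous[OF g(1)] borel_measurable_continuous_onI[OF cc] continuous_intros)
  qed
  have J_bnd: "\<bar>J w\<bar> \<le> C * (\<integral>x. \<bar>g x\<bar> \<partial>lborel)" for w
    unfolding J_def using order_trans[OF integral_abs_bound bnd] .
  \<comment> \<open>The age \<open>fst w\<close> also serves as the time at which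
    \<open>test_rhs\<close> is evaluated, so the shifted argument is
    \<open>(0, y) + parabolic w\<close>.\<close>
  have "(\<integral>w. J w \<partial>kernel_measure L) = (\<integral>y. g y * (\<integral>w. ?\<psi> (fst w, y + ?p w) \<partial>kernel_measure L) \<partial>lborel)"
    unfolding J_def
    by (rule kernel_duality(2)[OF L g(1), where \<Psi>="\<lambda>w x. ?\<psi> (fst w, x)" and C="C * (\<integral>x. \<bar>g x\<bar> \<partial>lborel)"]) (intro cc continuous_intros int bnd)+
  also have "\<dots> = (\<integral>y. g y * \<phi> (0, y) \<partial>lborel)"
    using kernel_represents_test_fun[OF t L, of "(0, _)"] by (simp add: parabolic_def)
  also have "\<dots> = 0"
  proof -
    obtain K where "K \<subseteq> {z. 0 < fst z}" "\<And>z. z \<notin> K \<Longrightarrow> \<phi> z = 0" using test_fun_support[OF t] by metis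
    then have "\<phi> (0, y) = 0" for y by force
    then show ?thesis by simp
  qed
  finally have "0 = (\<integral>w. J w \<partial>kernel_measure L)" by simp
  also have "\<dots> = (\<integral>r. (\<integral>\<xi>. J (r, \<xi>) \<partial>gauss_measure) \<partial>decay_measure L)"
    by (rule integral_kernel_iterated[OF L J_meas J_bnd])
  \<comment> \<open>For fixed \<open>r\<close> the spatial and Gaussian integrals are exchanged, and
    the Gaussian one is the heat extension.\<close>
  also have "\<dots> = (\<integral>r. (\<integral>x. ?\<psi> (r, x) * heat_ext g r x \<partial>lborel) \<partial>decay_measure L)"
  proof (rule Bochner_Integration.integral_cong[OF refl])
    fix r :: real
    interpret G: finite_measure "gauss_measure :: 'a measure" by (rule finite_gauss)
    interpret pair_sigma_finite "gauss_measure :: 'a measure" "lborel :: 'a measure" by standard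
    have sets_gl: "sets ((gauss_measure :: 'a measure) \<Otimes>\<^sub>M (lborel :: 'a measure)) = sets borel"
      unfolding sets_pair_measure_cong[OF sets_gauss sets_lborel] by (rule sets_borel_pair)
    have "integrable (gauss_measure \<Otimes>\<^sub>M lborel) (\<lambda>q. ?\<psi> (r, snd q) * g (snd q - sqrt r *\<^sub>R fst q))"
    proof (rule integrable_finite_times[OF G.finite_measure_axioms lborel.sigma_finite_measure_axioms])
      show "(\<lambda>q. ?\<psi> (r, snd q) * g (snd q - sqrt r *\<^sub>R fst q)) \<in> borel_measurable ((gauss_measure :: 'a measure) \<Otimes>\<^sub>M lborel)"
        unfolding measurable_cong_sets[OF sets_gl refl]
        by (intro borel_measurable_times borel_comp_continuous[OF g(1)] borel_measurable_continuous_onI[OF cc] continuous_intros)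
    qed (use int bnd in auto)
    then have "(\<integral>\<xi>. J (r, \<xi>) \<partial>gauss_measure) = (\<integral>x. (\<integral>\<xi>. ?\<psi> (r, x) * g (x - sqrt r *\<^sub>R \<xi>) \<partial>gauss_measure) \<partial>lborel)"
      using Fubini_integral[of "\<lambda>\<xi> x. ?\<psi> (r, x) * g (x - sqrt r *\<^sub>R \<xi>)"] by (simp add: J_def split_beta')
    also have "\<dots> = (\<integral>x. ?\<psi> (r, x) * heat_ext g r x \<partial>lborel)"
    proof (intro Bochner_Integration.integral_cong refl)
      fix x :: 'a
      have "(\<lambda>\<xi>. g (x - sqrt r *\<^sub>R \<xi>)) \<in> borel_measurable borel"
        by (intro borel_comp_continuous[OF g(1)] continuous_intros)
      from integral_gauss_measure[OF this]
      show "(\<integral>\<xi>. ?\<psi> (r, x) * g (x - sqrt r *\<^sub>R \<xi>) \<partial>gauss_measure) = ?\<psi> (r, x) * heat_ext g r x"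
        by (simp add: heat_ext_def)
    qed
    finally show "(\<integral>\<xi>. J (r, \<xi>) \<partial>gauss_measure) = (\<integral>x. ?\<psi> (r, x) * heat_ext g r x \<partial>lborel)" .
  qed
  also have "\<dots> = (\<integral>r. indicator {0<..} r * exp (- (L * r)) * (\<integral>x. ?\<psi> (r, x) * heat_ext g r x \<partial>lborel) \<partial>lborel)"
  proof (rule integral_decay_measure, rule lborel.borel_measurable_lebesgue_integral)
    have "(\<lambda>x. ?\<psi> x * heat_ext g (fst x) (snd x)) \<in> borel_measurable borel"
      by (intro borel_measurable_times borel_measurable_continuous_onI[OF c] heat_ext_measurable g)
    then show "(\<lambda>(r, x). ?\<psi> (r, x) * heat_ext g r x) \<in> borel_measurable (borel \<Otimes>\<^sub>M lborel)"
      unfolding split_beta' measurable_cong_sets[OF sets_borel_lborel refl] by simp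
  qed
  also have "\<dots> = (\<integral>r. (\<integral>x. ?\<psi> (r, x) * initial_part L g (r, x) \<partial>lborel) \<partial>lborel)"
  proof (intro Bochner_Integration.integral_cong refl)
    fix r :: real
    show "indicator {0<..} r * exp (- (L * r)) * (\<integral>x. ?\<psi> (r, x) * heat_ext g r x \<partial>lborel) = (\<integral>x. ?\<psi> (r, x) * initial_part L g (r, x) \<partial>lborel)"
      unfolding initial_part_def by (cases "0 < r") (simp_all add: mult.left_commute)
  qed
  also have "\<dots> = (\<integral>z. ?\<psi> z * initial_part L g z \<partial>lborel)"
  proof -
    have "integrable lborel (\<lambda>z. ?\<psi> z * initial_part L g z)"
      by (rule bounded_times_integrable(1)[OF \<psi>_int initial_part_measurable[OF g(1)] initial_part_le(3)[OF L g(1) g_nonneg g_le]])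
    then show ?thesis using lborel_pair.integral_fst'[of "\<lambda>z. ?\<psi> z * initial_part L g z"] unfolding lborel_prod by simp
  qed
  finally show ?thesis by simp
qed

section \<open>Bounds, continuity and mass of Duhamel's integral\<close>

lemma duhamel_integrand_measurable:
  assumes "F \<in> borel_measurable borel"
  shows "(\<lambda>w. F (z - parabolic w)) \<in> borel_measurable (kernel_measure L)"
  unfolding measurable_cong_sets[OF sets_kernel refl]
  by (intro borel_comp_continuous[OF assms] continuous_intros)

lemma duhamel_integrable:
  fixes F :: "real \<times> 'a::euclidean_space \<Rightarrow> real"
  assumes "0 < L" "F \<in> borel_measurable borel" "\<And>z. \<bar>F z\<bar> \<le> C"
  shows "integrable (kernel_measure L) (\<lambda>w. F (z - parabolic w))"
  by (rule kernel_integrable[OF assms(1), where C=C])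
    (rule borel_comp_continuous[OF assms(2)], intro continuous_intros, rule assms(3))

lemma duhamel_measurable:
  fixes F :: "real \<times> 'a::euclidean_space \<Rightarrow> real"
  assumes L: "0 < L" and F: "F \<in> borel_measurable borel"
  shows "duhamel L F \<in> borel_measurable borel"
proof -
  interpret K: finite_measure "kernel_measure L :: (real \<times> 'a) measure" by (rule finite_kernel[OF L])
  have s: "sets (borel \<Otimes>\<^sub>M kernel_measure L) = sets (borel :: ((real \<times> 'a) \<times> (real \<times> 'a)) measure)"
    unfolding sets_pair_measure_cong[OF refl sets_kernel] by (rule sets_borel_pair)
  show ?thesis unfolding duhamel_def[abs_def]
  proof (rule K.borel_measurable_lebesgue_integral)
    show "(\<lambda>(z, w). F (z - parabolic w)) \<in> borel_measurable (borel \<Otimes>\<^sub>M kernel_measure L)"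
      unfolding split_beta' measurable_cong_sets[OF s refl]
      by (intro borel_comp_continuous[OF F] continuous_intros)
  qed
qed

text \<open>The source vanishes at nonpositive times, so only ages below \<open>fst z\<close>
  contribute, and these have mass \<open>(1 - exp (- (L * fst z))) / L\<close>. A bound on
  \<open>F\<close> at times before \<open>fst z\<close> is enough, because almost every age is
  positive.\<close>

lemma duhamel_abs_le:
  fixes F :: "real \<times> 'a::euclidean_space \<Rightarrow> real"
  assumes L: "0 < L" and F: "F \<in> borel_measurable borel" and zero: "\<And>z. fst z \<le> 0 \<Longrightarrow> F z = 0"
    and le: "\<And>y. fst y < fst z \<Longrightarrow> \<bar>F y\<bar> \<le> C" and z: "0 \<le> fst z" and C: "0 \<le> C"
  shows "\<bar>duhamel L F z\<bar> \<le> C * ((1 - exp (- (L * fst z))) / L)"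
proof -
  interpret K: finite_measure "kernel_measure L :: (real \<times> 'a) measure" by (rule finite_kernel[OF L])
  let ?S = "{..<fst z} \<times> (UNIV :: 'a set)"
  have S: "?S \<in> sets (kernel_measure L)"
    by (simp add: borel_open open_Times)
  have AE: "AE w in (kernel_measure L :: (real \<times> 'a) measure). \<bar>F (z - parabolic w)\<bar> \<le> C * indicator ?S w"
    using kernel_AE[OF L, of 0]
  proof eventually_elim
    case (elim w)
    show ?case
    proof (cases "fst w < fst z")
      case True
      then show ?thesis using elim le[of "z - parabolic w"] by (cases w) (simp add: parabolic_def)
    next
      case False
      then show ?thesis using zero[of "z - parabolic w"] by (cases w) (simp add: parabolic_def)
    qed
  qed
  have "\<bar>duhamel L F z\<bar> \<le> (\<integral>w. \<bar>F (z - parabolic w)\<bar> \<partial>kernel_measure L)"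
    unfolding duhamel_def by (rule integral_abs_bound)
  also have "\<dots> \<le> (\<integral>w. C * indicator ?S w \<partial>kernel_measure L)"
  proof (rule integral_mono_AE[OF _ _ AE])
    show "integrable (kernel_measure L) (\<lambda>w. C * indicator ?S w)" using S by (simp add: K.emeasure_finite less_top[symmetric])
    show "integrable (kernel_measure L) (\<lambda>w. \<bar>F (z - parabolic w)\<bar>)"
    proof (rule K.integrable_const_bound[where B=C])
      show "AE w in kernel_measure L. norm \<bar>F (z - parabolic w)\<bar> \<le> C"
        using AE
      proof eventually_elim
        case (elim w)
        have "C * indicator ?S w \<le> C * 1" using C by (intro mult_left_mono) (auto simp: indicator_def)
        with elim show ?case by simp
      qed
    qed (use duhamel_integrand_measurable[OF F] in simp)
  qed
  also have "\<dots> = C * measure (kernel_measure L) ?S" using S by simp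
  also have "measure (kernel_measure L) ?S = (1 - exp (- (L * fst z))) / L"
    unfolding measure_def emeasure_kernel_lessThan[OF L z] using L z by (simp add: divide_nonneg_pos)
  finally show ?thesis .
qed

lemma duhamel_eq_0:
  assumes L: "0 < L" and zero: "\<And>z. fst z \<le> 0 \<Longrightarrow> F z = 0" and z: "fst z \<le> 0"
  shows "duhamel L F z = 0"
  unfolding duhamel_def
proof (rule integral_eq_zero_AE)
  show "AE w in kernel_measure L. F (z - parabolic w) = 0"
    using kernel_AE[OF L, of 0] by eventually_elim (use z in \<open>auto intro!: zero simp: parabolic_def\<close>)
qed

text \<open>Dominated convergence holds even though \<open>F\<close> may jump at time 0: the ages
  that bring the argument there form a null set, and otherwise the argument is a point of continuity
  or stays in negative times.\<close>

lemma duhamel_cont: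
  fixes F :: "real \<times> 'a::euclidean_space \<Rightarrow> real"
  assumes L: "0 < L" and F: "F \<in> borel_measurable borel" "\<And>z. \<bar>F z\<bar> \<le> C" and zero: "\<And>z. fst z \<le> 0 \<Longrightarrow> F z = 0"
    and cont: "continuous_on {z. 0 < fst z} F"
  shows "continuous_on UNIV (duhamel L F)"
  unfolding continuous_on_sequentially
proof (intro allI ballI impI)
  fix X and z :: "real \<times> 'a" assume "(\<forall>n. X n \<in> UNIV) \<and> X \<longlonglongrightarrow> z"
  then have X: "X \<longlonglongrightarrow> z" by simp
  interpret K: finite_measure "kernel_measure L :: (real \<times> 'a) measure" by (rule finite_kernel[OF L])
  have op: "open {z :: real \<times> 'a. 0 < fst z}" by (intro open_Collect_less continuous_intros)
  have "(\<lambda>n. duhamel L F (X n)) \<longlonglongrightarrow> duhamel L F z"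
    unfolding duhamel_def
  proof (rule integral_dominated_convergence[where w="\<lambda>_. C"])
    show "AE w in kernel_measure L. (\<lambda>n. F (X n - parabolic w)) \<longlonglongrightarrow> F (z - parabolic w)"
      using kernel_AE[OF L, of "fst z"]
    proof eventually_elim
      case (elim w)
      have lim: "(\<lambda>n. X n - parabolic w) \<longlonglongrightarrow> z - parabolic w" by (intro tendsto_intros X)
      show ?case
      proof (cases "fst w < fst z")
        case True
        then have "z - parabolic w \<in> {z. 0 < fst z}" by (simp add: parabolic_def)
        then have "isCont F (z - parabolic w)"
          using cont continuous_on_eq_continuous_at[OF op] by blast
        then show ?thesis using lim by (rule isCont_tendsto_compose)
      next
        case False
        then have neg: "fst (z - parabolic w) < 0" using elim by (simp add: parabolic_def)
        then have "\<forall>\<^sub>F n in sequentially. fst (X n - parabolic w) < 0"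
          by (rule order_tendstoD(2)[OF tendsto_fst[OF lim]])
        then have "\<forall>\<^sub>F n in sequentially. F (z - parabolic w) = F (X n - parabolic w)"
        proof eventually_elim
          case (elim n)
          then show ?case using neg zero[of "X n - parabolic w"] zero[of "z - parabolic w"] by simp
        qed
        then show ?thesis by (rule Lim_transform_eventually[OF tendsto_const])
      qed
    qed
    show "AE w in kernel_measure L. norm (F (X n - parabolic w)) \<le> C" for n using F(2) by simp
  qed (auto intro: duhamel_integrand_measurable[OF F(1)])
  then show "(duhamel L F \<circ> X) \<longlonglongrightarrow> duhamel L F z" by (simp add: o_def)
qed

lemma nn_integral_translate:
  fixes w :: "'a::euclidean_space \<Rightarrow> ennreal"
  assumes "w \<in> borel_measurable borel"
  shows "(\<integral>\<^sup>+x. w (x - a) \<partial>lborel) = (\<integral>\<^sup>+x. w x \<partial>lborel)"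
proof -
  have "(\<integral>\<^sup>+x. w x \<partial>lborel) = (\<integral>\<^sup>+x. w x \<partial>distr lborel borel ((+) (- a)))" by (simp add: lborel_distr_plus)
  also have "\<dots> = (\<integral>\<^sup>+x. w (x - a) \<partial>lborel)" using assms by (subst nn_integral_distr) auto
  finally show ?thesis by simp
qed

text \<open>For a fixed kernel point the spatial shift preserves the mass of the slice of
  \<open>F\<close>; only ages below \<open>t\<close> see a nonzero slice.\<close>

lemma duhamel_mass:
  fixes F :: "real \<times> 'a::euclidean_space \<Rightarrow> real"
  assumes L: "0 < L" and F: "F \<in> borel_measurable borel" "\<And>z. 0 \<le> F z" "\<And>z. F z \<le> C" and zero: "\<And>z. fst z \<le> 0 \<Longrightarrow> F z = 0"
    and mass: "\<And>s. 0 < s \<Longrightarrow> (\<integral>\<^sup>+x. ennreal (F (s, x)) \<partial>lborel) \<le> ennreal B" and t: "0 \<le> t"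
  shows "(\<integral>\<^sup>+x. ennreal (duhamel L F (t, x)) \<partial>lborel) \<le> ennreal B * ennreal ((1 - exp (- (L * t))) / L)"
proof -
  interpret K: finite_measure "kernel_measure L :: (real \<times> 'a) measure" by (rule finite_kernel[OF L])
  interpret pair_sigma_finite "kernel_measure L :: (real \<times> 'a) measure" "lborel :: 'a measure" by standard
  have Fabs: "\<bar>F z\<bar> \<le> C" for z using F(2)[of z] F(3)[of z] by simp
  have "(\<integral>\<^sup>+x. ennreal (duhamel L F (t, x)) \<partial>lborel) = (\<integral>\<^sup>+x. (\<integral>\<^sup>+w. ennreal (F ((t, x) - parabolic w)) \<partial>kernel_measure L) \<partial>lborel)"
    unfolding duhamel_def
    by (intro nn_integral_cong nn_integral_eq_integral[symmetric] duhamel_integrable[OF L F(1) Fabs] AE_I2 F(2))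
  also have "\<dots> = (\<integral>\<^sup>+w. (\<integral>\<^sup>+x. ennreal (F ((t, x) - parabolic w)) \<partial>lborel) \<partial>kernel_measure L)"
  proof -
    have s: "sets (kernel_measure L \<Otimes>\<^sub>M lborel) = sets (borel :: ((real \<times> 'a) \<times> 'a) measure)" by (rule sets_kernel_lborel)
    have "(\<lambda>q::(real \<times> 'a) \<times> 'a. F ((t, snd q) - parabolic (fst q))) \<in> borel_measurable borel"
      by (intro borel_comp_continuous[OF F(1)] continuous_intros)
    then have "(\<lambda>q::(real \<times> 'a) \<times> 'a. ennreal (F ((t, snd q) - parabolic (fst q)))) \<in> borel_measurable (kernel_measure L \<Otimes>\<^sub>M lborel)"
      unfolding measurable_cong_sets[OF s refl] by simp
    from Fubini[OF this] show ?thesis by simp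
  qed
  also have "\<dots> \<le> (\<integral>\<^sup>+w. ennreal B * indicator ({..<t} \<times> UNIV) w \<partial>(kernel_measure L :: (real \<times> 'a) measure))"
  proof (rule nn_integral_mono)
    fix w :: "real \<times> 'a"
    have "(\<lambda>x. F (t - fst w, x)) \<in> borel_measurable borel"
      by (intro borel_comp_continuous[OF F(1)] continuous_intros)
    then have "(\<integral>\<^sup>+x. ennreal (F ((t, x) - parabolic w)) \<partial>lborel) = (\<integral>\<^sup>+x. ennreal (F (t - fst w, x)) \<partial>lborel)"
      using nn_integral_translate[of "\<lambda>x. ennreal (F (t - fst w, x))" "sqrt (fst w) *\<^sub>R snd w"] by (simp add: parabolic_def)
    also have "\<dots> \<le> ennreal B * indicator ({..<t} \<times> UNIV) w"
      using mass[of "t - fst w"] zero by (cases w; cases "fst w < t") auto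
    finally show "(\<integral>\<^sup>+x. ennreal (F ((t, x) - parabolic w)) \<partial>lborel) \<le> ennreal B * indicator ({..<t} \<times> UNIV) w" .
  qed
  also have "\<dots> = ennreal B * emeasure (kernel_measure L :: (real \<times> 'a) measure) ({..<t} \<times> UNIV)"
    by (rule nn_integral_cmult_indicator) (simp add: borel_open open_Times)
  finally show ?thesis unfolding emeasure_kernel_lessThan[OF L t] .
qed

lemma heat_ext_mass:
  fixes g :: "'a::euclidean_space \<Rightarrow> real"
  assumes g: "g \<in> borel_measurable borel" "\<And>x. 0 \<le> g x" "\<And>x. g x \<le> C"
  shows "(\<integral>\<^sup>+x. ennreal (heat_ext g t x) \<partial>lborel) = (\<integral>\<^sup>+x. ennreal (g x) \<partial>lborel)"
proof -
  have gabs: "\<bar>g x\<bar> \<le> C" for x using g(2)[of x] g(3)[of x] by simp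
  have "(\<integral>\<^sup>+x. ennreal (heat_ext g t x) \<partial>lborel) = (\<integral>\<^sup>+x. (\<integral>\<^sup>+\<xi>. ennreal (gauss \<xi> * g (x - sqrt t *\<^sub>R \<xi>)) \<partial>lborel) \<partial>lborel)"
    unfolding heat_ext_def
    by (intro nn_integral_cong nn_integral_eq_integral[symmetric] heat_ext_integrable[OF g(1) gabs] AE_I2 mult_nonneg_nonneg g(2)
      less_imp_le[OF heat_kernel_pos])
  also have "\<dots> = (\<integral>\<^sup>+\<xi>. (\<integral>\<^sup>+x. ennreal (gauss \<xi> * g (x - sqrt t *\<^sub>R \<xi>)) \<partial>lborel) \<partial>lborel)"
  proof -
    have "(\<lambda>q::'a \<times> 'a. gauss (fst q) * g (snd q - sqrt t *\<^sub>R fst q)) \<in> borel_measurable borel"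
      by (intro borel_measurable_times borel_comp_continuous[OF g(1)] borel_comp_continuous[OF gauss_measurable] continuous_intros)
    then have "(\<lambda>q::'a \<times> 'a. ennreal (gauss (fst q) * g (snd q - sqrt t *\<^sub>R fst q))) \<in> borel_measurable (lborel \<Otimes>\<^sub>M lborel)"
      unfolding lborel_prod by simp
    from lborel_pair.Fubini[OF this] show ?thesis by simp
  qed
  also have "\<dots> = (\<integral>\<^sup>+\<xi>. ennreal (gauss (\<xi>::'a)) * (\<integral>\<^sup>+x. ennreal (g x) \<partial>lborel) \<partial>lborel)"
  proof (intro nn_integral_cong)
    fix \<xi> :: 'a
    have gs: "(\<lambda>x. g (x - sqrt t *\<^sub>R \<xi>)) \<in> borel_measurable borel" by (intro borel_comp_continuous[OF g(1)] continuous_intros)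
    have "(\<integral>\<^sup>+x. ennreal (gauss \<xi> * g (x - sqrt t *\<^sub>R \<xi>)) \<partial>lborel) = (\<integral>\<^sup>+x. ennreal (gauss \<xi>) * ennreal (g (x - sqrt t *\<^sub>R \<xi>)) \<partial>lborel)"
      using heat_kernel_pos[of 1 \<xi>] g(2) by (intro nn_integral_cong ennreal_mult) auto
    also have "\<dots> = ennreal (gauss \<xi>) * (\<integral>\<^sup>+x. ennreal (g (x - sqrt t *\<^sub>R \<xi>)) \<partial>lborel)"
      using gs by (intro nn_integral_cmult) simp
    also have "(\<integral>\<^sup>+x. ennreal (g (x - sqrt t *\<^sub>R \<xi>)) \<partial>lborel) = (\<integral>\<^sup>+x. ennreal (g x) \<partial>lborel)"
      using g(1) by (intro nn_integral_translate) simp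
    finally show "(\<integral>\<^sup>+x. ennreal (gauss \<xi> * g (x - sqrt t *\<^sub>R \<xi>)) \<partial>lborel) = ennreal (gauss \<xi>) * (\<integral>\<^sup>+x. ennreal (g x) \<partial>lborel)" .
  qed
  also have "\<dots> = (\<integral>\<^sup>+\<xi>. ennreal (gauss (\<xi>::'a)) \<partial>lborel) * (\<integral>\<^sup>+x. ennreal (g x) \<partial>lborel)"
    by (intro nn_integral_multc) simp
  finally show ?thesis by (simp add: nn_integral_gauss)
qed

section \<open>Bounded solutions by monotone iteration\<close>

text \<open>Invertible affine maps preserve null sets. It lets Gaussian averages at positive times
  ignore the set where the datum is discontinuous.\<close>

lemma AE_affine_not_in_null:
  fixes N :: "'a::euclidean_space set"
  assumes N: "N \<in> null_sets lborel" and c: "c \<noteq> 0"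
  shows "AE \<xi> in lborel. x + c *\<^sub>R \<xi> \<notin> N"
proof -
  have Nb: "N \<in> sets borel" using null_setsD2[OF N] by simp
  define D where "D = density (distr lborel borel (\<lambda>\<xi>. x + c *\<^sub>R \<xi>)) (\<lambda>_. ennreal (\<bar>c\<bar> ^ DIM('a)))"
  have "lborel = D" unfolding D_def by (rule lborel_affine[OF c])
  then have "AE y in D. y \<notin> N" using AE_not_in[OF N] by metis
  then have "AE y in distr lborel borel (\<lambda>\<xi>. x + c *\<^sub>R \<xi>). y \<notin> N"
    unfolding D_def using c by (subst (asm) AE_density) auto
  then show ?thesis
    using Nb by (subst (asm) AE_distr_iff) (auto simp: pred_def)
qed

text \<open>The exceptional null set \<open>N\<close> is there for truncated data, which are
  discontinuous on the sphere where they are cut off.\<close>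

locale bounded_datum = absorption h for h :: "real \<Rightarrow> real" +
  fixes g :: "'a::euclidean_space \<Rightarrow> real" and M :: real and N :: "'a set"
  assumes g_meas: "g \<in> borel_measurable borel" and g_int: "integrable lborel g"
    and g_nonneg: "\<And>x. 0 \<le> g x" and g_le: "\<And>x. g x \<le> M"
    and N: "N \<in> null_sets lborel" and g_cont: "\<And>x. x \<notin> N \<Longrightarrow> isCont g x"
begin

lemma M_nonneg: "0 \<le> M"
  using g_nonneg g_le order_trans by blast

lemma g_abs: "\<bar>g x\<bar> \<le> M"
  using g_nonneg[of x] g_le[of x] by simp

text \<open>A Lipschitz constant of \<open>f\<close> on \<open>[0, M]\<close>; it makes \<open>r \<mapsto> L r - f r\<close> nondecreasing there, so that
  the iteration for \<open>\<partial>\<^sub>t u - \<Delta> u + L u = L u - f u\<close> is monotone.\<close>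

definition L :: real where "L = f (M + 1)"

definition source :: "real \<Rightarrow> real" where "source r = L * r - f (max 0 r)"

lemma L_pos: "0 < L"
  unfolding L_def using M_nonneg by (intro f_pos) simp

lemma source_cont: "continuous_on UNIV source"
proof -
  have "continuous_on UNIV (\<lambda>r::real. f (max 0 r))"
    by (rule continuous_on_compose2[OF f_cont]) (auto intro!: continuous_intros)
  then show ?thesis unfolding source_def[abs_def] by (intro continuous_intros)
qed

lemma source_0: "source 0 = 0"
  by (simp add: source_def)

lemma source_mono: "0 \<le> a \<Longrightarrow> a \<le> b \<Longrightarrow> b \<le> M \<Longrightarrow> source a \<le> source b"
  using f_lipschitz[of a b M] by (simp add: source_def L_def algebra_simps)

lemma source_le: "0 \<le> a \<Longrightarrow> source a \<le> L * a"
  using f_nonneg[of a] by (simp add: source_def)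

text \<open>Both \<open>f\<close> and \<open>source\<close> are nondecreasing on
  \<open>[0, M]\<close> and they add up to \<open>L * r\<close>, so the slopes of
  \<open>source\<close> lie between 0 and \<open>L\<close>.\<close>

lemma source_lipschitz:
  assumes "0 \<le> a" "a \<le> M" "0 \<le> b" "b \<le> M"
  shows "\<bar>source a - source b\<bar> \<le> L * \<bar>a - b\<bar>"
proof -
  have *: "\<bar>source a - source b\<bar> \<le> L * \<bar>a - b\<bar>" if "0 \<le> a" "a \<le> b" "b \<le> M" for a b
  proof -
    have "source b - source a \<le> L * (b - a)"
      using f_mono[OF that(1,2)] that by (simp add: source_def algebra_simps)
    then show ?thesis using source_mono[OF that] that by simp
  qed
  show ?thesis using *[of a b] *[of b a] assms by (cases "a \<le> b") (auto simp: abs_minus_commute)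
qed

section \<open>The monotone iteration\<close>

definition admissible :: "(real \<times> 'a \<Rightarrow> real) \<Rightarrow> bool" where
  "admissible v \<longleftrightarrow> v \<in> borel_measurable borel \<and> (\<forall>z. 0 \<le> v z \<and> v z \<le> M) \<and> (\<forall>z. fst z \<le> 0 \<longrightarrow> v z = 0)"

lemma admissibleD:
  assumes "admissible v"
  shows "v \<in> borel_measurable borel" "0 \<le> v z" "v z \<le> M" "fst z \<le> 0 \<Longrightarrow> v z = 0"
  using assms unfolding admissible_def by blast+

text \<open>Duhamel's formula for \<open>\<partial>\<^sub>t u - \<Delta> u + L u = source v\<close>
  with datum \<open>g\<close>; a fixed point solves the nonlinear equation. Vanishing of
  \<open>v\<close> at nonpositive times limits the Duhamel term to the interval from 0 to the
  current time.\<close>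

definition step :: "(real \<times> 'a \<Rightarrow> real) \<Rightarrow> real \<times> 'a \<Rightarrow> real" where
  "step v z = initial_part L g z + duhamel L (\<lambda>y. source (v y)) z"

lemma admissible_source:
  assumes v: "admissible v"
  shows "(\<lambda>z. source (v z)) \<in> borel_measurable borel" "0 \<le> source (v z)" "source (v z) \<le> L * M"
    "\<bar>source (v z)\<bar> \<le> L * M" "fst z \<le> 0 \<Longrightarrow> source (v z) = 0"
proof -
  show "(\<lambda>z. source (v z)) \<in> borel_measurable borel"
    by (rule measurable_compose[OF admissibleD(1)[OF v] borel_measurable_continuous_onI[OF source_cont]])
  note b = admissibleD(2,3)[OF v, of z]
  show *: "0 \<le> source (v z)" using source_mono[of 0 "v z"] b source_0 by simp
  have "source (v z) \<le> L * v z" by (rule source_le[OF b(1)])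
  also have "\<dots> \<le> L * M" using b L_pos by simp
  finally show "source (v z) \<le> L * M" .
  with * show "\<bar>source (v z)\<bar> \<le> L * M" by simp
  show "fst z \<le> 0 \<Longrightarrow> source (v z) = 0" using admissibleD(4)[OF v] source_0 by simp
qed

lemma duhamel_source_nonneg: "admissible v \<Longrightarrow> 0 \<le> duhamel L (\<lambda>y. source (v y)) z"
  unfolding duhamel_def by (intro Bochner_Integration.integral_nonneg admissible_source(2))

lemma duhamel_source_le:
  assumes v: "admissible v" and z: "0 \<le> fst z"
  shows "duhamel L (\<lambda>y. source (v y)) z \<le> M * (1 - exp (- (L * fst z)))"
proof -
  have "\<bar>duhamel L (\<lambda>y. source (v y)) z\<bar> \<le> L * M * ((1 - exp (- (L * fst z))) / L)"
    using admissible_source[OF v] L_pos M_nonneg z by (intro duhamel_abs_le) auto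
  then show ?thesis using L_pos by (simp add: abs_le_iff mult.commute)
qed

lemma step_eq_0: "admissible v \<Longrightarrow> fst z \<le> 0 \<Longrightarrow> step v z = 0"
  unfolding step_def by (subst duhamel_eq_0[OF L_pos]) (auto simp: initial_part_def admissible_source(5))

text \<open>The two upper bounds are \<open>M\<close> with weights \<open>exp (- (L * t))\<close>
  and \<open>1 - exp (- (L * t))\<close>, which add up to \<open>M\<close>; so the range
  \<open>[0, M]\<close> is preserved.\<close>

lemma step_admissible:
  assumes v: "admissible v" shows "admissible (step v)"
  unfolding admissible_def
proof (intro conjI allI impI)
  show "step v \<in> borel_measurable borel"
    unfolding step_def[abs_def]
    by (intro borel_measurable_add initial_part_measurable g_meas duhamel_measurable L_pos admissible_source(1)[OF v])
  fix z :: "real \<times> 'a"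
  show "0 \<le> step v z"
    unfolding step_def using initial_part_le(1)[OF L_pos g_meas g_nonneg g_le] duhamel_source_nonneg[OF v]
    by (intro add_nonneg_nonneg)
  show "step v z \<le> M"
  proof (cases "0 \<le> fst z")
    case True
    have "step v z \<le> exp (- (L * fst z)) * M + M * (1 - exp (- (L * fst z)))"
      unfolding step_def
      by (intro add_mono initial_part_le(2)[OF L_pos g_meas g_nonneg g_le True] duhamel_source_le[OF v True])
    then show ?thesis by (simp add: algebra_simps)
  next
    case False
    then show ?thesis using step_eq_0[OF v, of z] M_nonneg by simp
  qed
  show "step v z = 0" if "fst z \<le> 0" using step_eq_0[OF v that] .
qed

lemma duhamel_source_diff:
  assumes v: "admissible v" and w: "admissible w"
  shows "step w z - step v z = duhamel L (\<lambda>y. source (w y) - source (v y)) z"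
  unfolding step_def duhamel_def
  by (subst Bochner_Integration.integral_diff)
    (auto intro!: duhamel_integrable[OF L_pos admissible_source(1,4)] v w)

lemma step_mono:
  assumes v: "admissible v" and w: "admissible w" and le: "\<And>z. v z \<le> w z"
  shows "step v z \<le> step w z"
proof -
  have "0 \<le> source (w y) - source (v y)" for y
    using source_mono[OF admissibleD(2)[OF v] le admissibleD(3)[OF w], of y] by simp
  then have "0 \<le> step w z - step v z"
    unfolding duhamel_source_diff[OF v w] duhamel_def by (intro Bochner_Integration.integral_nonneg)
  then show ?thesis by simp
qed

text \<open>The Lipschitz constant \<open>L\<close> of \<open>source\<close> cancels the factor
  \<open>1 / L\<close> of the kernel mass. What remains is a factor below 1 on each bounded time
  interval, though not uniformly in \<open>T\<close>.\<close>

lemma step_contraction: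
  assumes v: "admissible v" and w: "admissible w" and le: "\<And>y. fst y \<le> T \<Longrightarrow> \<bar>w y - v y\<bar> \<le> C"
    and z: "fst z \<le> T" and T: "0 \<le> T" and C: "0 \<le> C"
  shows "\<bar>step w z - step v z\<bar> \<le> C * (1 - exp (- (L * T)))"
proof (cases "0 \<le> fst z")
  case True
  have "\<bar>source (w y) - source (v y)\<bar> \<le> L * C" if "fst y < fst z" for y
  proof -
    have "\<bar>source (w y) - source (v y)\<bar> \<le> L * \<bar>w y - v y\<bar>"
      by (intro source_lipschitz admissibleD v w)
    also have "\<dots> \<le> L * C" using le[of y] that z L_pos by (intro mult_left_mono) auto
    finally show ?thesis .
  qed
  then have "\<bar>duhamel L (\<lambda>y. source (w y) - source (v y)) z\<bar> \<le> L * C * ((1 - exp (- (L * fst z))) / L)"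
    using admissible_source[OF v] admissible_source[OF w] L_pos C True
    by (intro duhamel_abs_le borel_measurable_diff) auto
  also have "\<dots> = C * (1 - exp (- (L * fst z)))" using L_pos by simp
  also have "\<dots> \<le> C * (1 - exp (- (L * T)))" using z L_pos C by (intro mult_left_mono) auto
  finally show ?thesis unfolding duhamel_source_diff[OF v w] .
next
  case False
  then show ?thesis using step_eq_0[OF v, of z] step_eq_0[OF w, of z] C T L_pos by simp
qed

text \<open>At positive times the set of Gaussian variables that hit the discontinuities of
  \<open>g\<close> is null, so the extension is continuous although \<open>g\<close> is not.\<close>

lemma heat_ext_datum_cont: "continuous_on {z. 0 < fst z} (\<lambda>z. heat_ext g (fst z) (snd z))"
  unfolding continuous_on_sequentially
proof (intro allI ballI impI)
  fix X and z :: "real \<times> 'a" assume z: "z \<in> {z. 0 < fst z}" and "(\<forall>n. X n \<in> {z. 0 < fst z}) \<and> X \<longlonglongrightarrow> z"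
  then have X: "X \<longlonglongrightarrow> z" by simp
  have "- sqrt (fst z) \<noteq> 0" using z by simp
  from AE_affine_not_in_null[OF N this, of "snd z"]
  have "AE \<xi> in lborel. isCont g (snd z - sqrt (fst z) *\<^sub>R \<xi>)"
    by eventually_elim (intro g_cont, simp)
  then show "((\<lambda>z. heat_ext g (fst z) (snd z)) \<circ> X) \<longlonglongrightarrow> heat_ext g (fst z) (snd z)"
    unfolding o_def by (intro heat_ext_tendsto[OF g_meas g_abs] tendsto_fst tendsto_snd X)
qed

lemma step_cont:
  assumes v: "admissible v" and c: "continuous_on {z. 0 < fst z} v"
  shows "continuous_on {z. 0 < fst z} (step v)"
proof -
  have 1: "continuous_on {z. 0 < fst z} (initial_part L g)"
  proof (rule continuous_on_eq)
    show "continuous_on {z. 0 < fst z} (\<lambda>z. exp (- (L * fst z)) * heat_ext g (fst z) (snd z))"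
      by (intro continuous_intros heat_ext_datum_cont)
  qed (simp add: initial_part_def)
  have "continuous_on {z. 0 < fst z} (\<lambda>z. source (v z))"
    by (rule continuous_on_compose2[OF source_cont c]) simp
  then have "continuous_on UNIV (duhamel L (\<lambda>y. source (v y)))"
    using admissible_source[OF v] by (intro duhamel_cont[OF L_pos]) auto
  then have "continuous_on {z. 0 < fst z} (duhamel L (\<lambda>y. source (v y)))"
    by (rule continuous_on_subset) simp
  then show ?thesis unfolding step_def[abs_def] by (intro continuous_on_add 1)
qed

primrec iter :: "nat \<Rightarrow> real \<times> 'a \<Rightarrow> real" where
  "iter 0 = (\<lambda>_. 0)"
| "iter (Suc k) = step (iter k)"

lemma iter_admissible: "admissible (iter k)"
proof (induction k)
  case 0 then show ?case using M_nonneg by (simp add: admissible_def)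
qed (simp add: step_admissible)

lemma iter_cont: "continuous_on {z. 0 < fst z} (iter k)"
  by (induction k) (simp_all add: step_cont iter_admissible)

lemma iter_mono: "iter k z \<le> iter (Suc k) z"
proof (induction k arbitrary: z)
  case 0 then show ?case using admissibleD(2)[OF iter_admissible[of 1]] by simp
next
  case (Suc k)
  have "step (iter k) z \<le> step (iter (Suc k)) z"
    by (rule step_mono[OF iter_admissible iter_admissible Suc.IH])
  then show ?case by simp
qed

definition sol :: "real \<times> 'a \<Rightarrow> real" where "sol z = lim (\<lambda>k. iter k z)"

lemma iter_LIMSEQ: "(\<lambda>k. iter k z) \<longlonglongrightarrow> sol z"
proof -
  have "incseq (\<lambda>k. iter k z)" by (intro incseq_SucI iter_mono)
  moreover have "\<forall>k. iter k z \<le> M" using admissibleD(3)[OF iter_admissible] by simp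
  ultimately obtain l where "(\<lambda>k. iter k z) \<longlonglongrightarrow> l" by (rule incseq_convergent)
  then show ?thesis unfolding sol_def by (simp add: limI)
qed

lemma sol_admissible: "admissible sol"
  unfolding admissible_def
proof (intro conjI allI impI)
  show "sol \<in> borel_measurable borel"
    by (rule borel_measurable_LIMSEQ_real[OF iter_LIMSEQ]) (rule admissibleD(1)[OF iter_admissible])
  fix z :: "real \<times> 'a"
  show "0 \<le> sol z" by (rule LIMSEQ_le_const[OF iter_LIMSEQ]) (use admissibleD(2)[OF iter_admissible] in blast)
  show "sol z \<le> M" by (rule LIMSEQ_le_const2[OF iter_LIMSEQ]) (use admissibleD(3)[OF iter_admissible] in blast)
  assume "fst z \<le> 0"
  then have "iter k z = 0" for k by (rule admissibleD(4)[OF iter_admissible])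
  then show "sol z = 0" using LIMSEQ_unique[OF iter_LIMSEQ[of z]] by simp
qed

lemma sol_fixed_point: "sol z = step sol z"
proof (rule LIMSEQ_unique)
  show "(\<lambda>k. iter (Suc k) z) \<longlonglongrightarrow> sol z" by (rule LIMSEQ_Suc[OF iter_LIMSEQ])
  interpret K: finite_measure "kernel_measure L :: (real \<times> 'a) measure" by (rule finite_kernel[OF L_pos])
  have "(\<lambda>k. duhamel L (\<lambda>y. source (iter k y)) z) \<longlonglongrightarrow> duhamel L (\<lambda>y. source (sol y)) z"
    unfolding duhamel_def
  proof (rule integral_dominated_convergence[where w="\<lambda>_. L * M"])
    show "AE w in kernel_measure L. (\<lambda>k. source (iter k (z - parabolic w))) \<longlonglongrightarrow> source (sol (z - parabolic w))"
    proof (rule AE_I2)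
      fix w
      have "isCont source (sol (z - parabolic w))"
        using source_cont continuous_on_eq_continuous_at[OF open_UNIV] by blast
      then show "(\<lambda>k. source (iter k (z - parabolic w))) \<longlonglongrightarrow> source (sol (z - parabolic w))"
        using iter_LIMSEQ by (rule isCont_tendsto_compose)
    qed
    show "AE w in kernel_measure L. norm (source (iter k (z - parabolic w))) \<le> L * M" for k
      using admissible_source(4)[OF iter_admissible] by (intro AE_I2) simp
  qed (auto intro: duhamel_integrand_measurable[OF admissible_source(1)] iter_admissible sol_admissible)
  then show "(\<lambda>k. iter (Suc k) z) \<longlonglongrightarrow> step sol z"
    unfolding iter.simps step_def by (intro tendsto_add tendsto_const)
qed

text \<open>Monotone convergence is only pointwise; the contraction upgrades it to a geometric rate
  on time strips, which carries continuity over to the limit.\<close>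

lemma iter_error:
  assumes T: "0 \<le> T" and z: "fst z \<le> T"
  shows "\<bar>sol z - iter k z\<bar> \<le> M * (1 - exp (- (L * T))) ^ k"
  using z
proof (induction k arbitrary: z)
  case 0 then show ?case using admissibleD(2,3)[OF sol_admissible, of z] by simp
next
  case (Suc k)
  have q: "0 \<le> 1 - exp (- (L * T))" using L_pos T by simp
  have "\<bar>step sol z - step (iter k) z\<bar> \<le> M * (1 - exp (- (L * T))) ^ k * (1 - exp (- (L * T)))"
    using Suc M_nonneg T q by (intro step_contraction[OF iter_admissible sol_admissible]) auto
  then show ?case unfolding sol_fixed_point[of z, symmetric] by (simp add: mult_ac)
qed

lemma sol_cont: "continuous_on {z. 0 < fst z} sol"
proof -
  have cont: "continuous_on {z. 0 < fst z \<and> fst z < T} sol" if T: "0 < T" for T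
  proof (rule uniform_limit_theorem)
    show "\<forall>\<^sub>F k in sequentially. continuous_on {z. 0 < fst z \<and> fst z < T} (iter k)"
      by (intro always_eventually allI continuous_on_subset[OF iter_cont]) auto
    have q: "\<bar>1 - exp (- (L * T))\<bar> < 1" using L_pos T by simp
    have lim: "(\<lambda>k. M * (1 - exp (- (L * T))) ^ k) \<longlonglongrightarrow> M * 0"
      by (intro tendsto_mult tendsto_const LIMSEQ_power_zero) (use q in simp)
    show "uniform_limit {z. 0 < fst z \<and> fst z < T} iter sol sequentially"
    proof (rule uniform_limitI)
      fix e :: real assume "0 < e"
      then have "\<forall>\<^sub>F k in sequentially. M * (1 - exp (- (L * T))) ^ k < e"
        using order_tendstoD(2)[OF lim] by simp
      then show "\<forall>\<^sub>F k in sequentially. \<forall>z\<in>{z. 0 < fst z \<and> fst z < T}. dist (iter k z) (sol z) < e"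
      proof eventually_elim
        case (elim k)
        have "dist (iter k z) (sol z) < e" if "fst z < T" for z
          using iter_error[of T z k] T that elim by (simp add: dist_real_def abs_minus_commute)
        then show ?case by blast
      qed
    qed
  qed simp
  have op: "open {z :: real \<times> 'a. 0 < fst z \<and> fst z < T}" for T
    by (intro open_Collect_conj open_Collect_less continuous_intros)
  have "isCont sol z" if z: "0 < fst z" for z
  proof -
    have "\<forall>y\<in>{y. 0 < fst y \<and> fst y < fst z + 1}. isCont sol y"
      by (rule continuous_on_eq_continuous_at[OF op, THEN iffD1, OF cont]) (use z in simp)
    then show ?thesis by (rule bspec) (use z in simp)
  qed
  then show ?thesis by (simp add: continuous_at_imp_continuous_on)
qed

text \<open>The weak forms of the initial part and the Duhamel term are added. In the resulting
  identity the terms with \<open>L\<close> from \<open>test_rhs\<close> and from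
  \<open>source\<close> cancel, leaving the original equation.\<close>

lemma sol_weak: "weak_sol h (\<lambda>t x. sol (t, x))"
  unfolding weak_sol_def
proof (intro conjI allI impI)
  have "{z :: real \<times> 'a. 0 < fst z} = {0<..} \<times> UNIV" by auto
  then show "continuous_on ({0<..} \<times> UNIV) (\<lambda>(t, x). sol (t, x))" using sol_cont by simp
  show "0 \<le> sol (t, x)" for t x by (rule admissibleD(2)[OF sol_admissible])
  fix \<phi> D D2 assume t: "test_fun (\<phi> :: real \<times> 'a \<Rightarrow> real) D D2"
  let ?\<psi> = "test_rhs L \<phi> D D2"
  obtain A B C where supp: "\<And>z. z \<notin> cbox A B \<Longrightarrow> ?\<psi> z = 0 \<and> \<phi> z = 0"
    using test_rhs_properties(2)[OF t] by metis
  have i: "integrable lborel ?\<psi>" "integrable lborel \<phi>"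
    using supp test_rhs_properties(1)[OF t] test_fun_continuous(1)[OF t] by (auto intro!: compact_support_integrable(1))
  have sol_m: "sol \<in> borel_measurable borel" "\<bar>sol z\<bar> \<le> M" for z
    using admissibleD(1)[OF sol_admissible] admissibleD(2,3)[OF sol_admissible, of z] by simp_all
  note s = admissible_source[OF sol_admissible]
  have i1: "integrable lborel (\<lambda>z. ?\<psi> z * sol z)" by (rule bounded_times_integrable(1)[OF i(1) sol_m])
  have i2: "integrable lborel (\<lambda>z. \<phi> z * source (sol z))" by (rule bounded_times_integrable(1)[OF i(2) s(1,4)])
  have i3: "integrable lborel (\<lambda>z. ?\<psi> z * initial_part L g z)"
    by (rule bounded_times_integrable(1)[OF i(1) initial_part_measurable[OF g_meas] initial_part_le(3)[OF L_pos g_meas g_nonneg g_le]])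
  \<comment> \<open>By the fixed point equation this product is a difference of two functions
    already known to be integrable.\<close>
  have i4: "integrable lborel (\<lambda>z. ?\<psi> z * duhamel L (\<lambda>y. source (sol y)) z)"
  proof -
    have "(\<lambda>z. ?\<psi> z * duhamel L (\<lambda>y. source (sol y)) z) = (\<lambda>z. ?\<psi> z * sol z - ?\<psi> z * initial_part L g z)"
      using sol_fixed_point unfolding step_def by (intro ext) (metis add_diff_cancel_left' right_diff_distrib)
    then show ?thesis using i1 i3 by simp
  qed
  have "(\<integral>z. ?\<psi> z * sol z \<partial>lborel) = (\<integral>z. ?\<psi> z * initial_part L g z + ?\<psi> z * duhamel L (\<lambda>y. source (sol y)) z \<partial>lborel)"
    using sol_fixed_point unfolding step_def by (intro Bochner_Integration.integral_cong refl) (metis distrib_left)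
  also have "\<dots> = (\<integral>z. \<phi> z * source (sol z) \<partial>lborel)"
    using i3 i4 initial_part_weak[OF t L_pos g_meas g_int g_nonneg g_le] duhamel_weak[OF t L_pos s(1,4)]
    by (simp add: mult.commute)
  finally have "(\<integral>z. ?\<psi> z * sol z - \<phi> z * source (sol z) \<partial>lborel) = 0" using i1 i2 by simp
  moreover have "(\<lambda>z. ?\<psi> z * sol z - \<phi> z * source (sol z)) =
      (\<lambda>(t, x). sol (t, x) * (- dt_test D (t, x) - lap_test D2 (t, x)) + sol (t, x) * h (sol (t, x)) * \<phi> (t, x))"
  proof
    fix z :: "real \<times> 'a"
    have "max 0 (sol z) = sol z" using admissibleD(2)[OF sol_admissible, of z] by simp
    then show "?\<psi> z * sol z - \<phi> z * source (sol z) =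
      (case z of (t, x) \<Rightarrow> sol (t, x) * (- dt_test D (t, x) - lap_test D2 (t, x)) + sol (t, x) * h (sol (t, x)) * \<phi> (t, x))"
      by (cases z) (simp add: test_rhs_def source_def f_def algebra_simps)
  qed
  moreover have "integrable lborel (\<lambda>z. ?\<psi> z * sol z - \<phi> z * source (sol z))" using i1 i2 by simp
  ultimately show "((\<lambda>(t, x). sol (t, x) * (- dt_test D (t, x) - lap_test D2 (t, x)) + sol (t, x) * h (sol (t, x)) * \<phi> (t, x)) has_integral 0) UNIV"
    using has_integral_integral_lborel[of "\<lambda>z. ?\<psi> z * sol z - \<phi> z * source (sol z)"] by simp
qed

section \<open>Attainment of the initial datum\<close>

lemma sol_initial_limit:
  assumes T: "\<And>n. 0 < T n" "T \<longlonglongrightarrow> 0" and X: "X \<longlonglongrightarrow> x" and cont: "isCont g x"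
  shows "(\<lambda>n. sol (T n, X n)) \<longlonglongrightarrow> g x"
proof -
  have "(\<lambda>n. heat_ext g (T n) (X n)) \<longlonglongrightarrow> heat_ext g 0 x"
    by (rule heat_ext_tendsto[OF g_meas g_abs T(2) X]) (simp add: cont)
  then have H: "(\<lambda>n. heat_ext g (T n) (X n)) \<longlonglongrightarrow> g x" unfolding heat_ext_0 .
  have e: "(\<lambda>n. exp (- (L * T n))) \<longlonglongrightarrow> 1"
    using tendsto_exp[OF tendsto_minus[OF tendsto_mult[OF tendsto_const[of L] T(2)]]] by simp
  have "(\<lambda>n. exp (- (L * T n)) * heat_ext g (T n) (X n)) \<longlonglongrightarrow> g x"
    using tendsto_mult[OF e H] by simp
  then have 1: "(\<lambda>n. initial_part L g (T n, X n)) \<longlonglongrightarrow> g x" by (simp add: initial_part_def T(1))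
  \<comment> \<open>The nonlinear contribution is controlled by the kernel mass of ages below
    \<open>T n\<close>, wherever the points \<open>X n\<close> are; only the linear part needs
    continuity of \<open>g\<close> at \<open>x\<close>.\<close>
  have bound: "(\<lambda>n. M * (1 - exp (- (L * T n)))) \<longlonglongrightarrow> 0"
    using tendsto_mult[OF tendsto_const[of M] tendsto_diff[OF tendsto_const[of 1] e]] by simp
  have le: "duhamel L (\<lambda>y. source (sol y)) (T n, X n) \<le> M * (1 - exp (- (L * T n)))" for n
    using duhamel_source_le[OF sol_admissible, of "(T n, X n)"] T(1)[of n] by simp
  have "(\<lambda>n. duhamel L (\<lambda>y. source (sol y)) (T n, X n)) \<longlonglongrightarrow> 0"
    by (rule tendsto_sandwich[OF always_eventually always_eventually tendsto_const bound])
      (rule allI, rule duhamel_source_nonneg[OF sol_admissible], rule allI, rule le)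
  from tendsto_add[OF 1 this]
  have "(\<lambda>n. initial_part L g (T n, X n) + duhamel L (\<lambda>y. source (sol y)) (T n, X n)) \<longlonglongrightarrow> g x" by simp
  moreover have "(\<lambda>n. sol (T n, X n)) = (\<lambda>n. initial_part L g (T n, X n) + duhamel L (\<lambda>y. source (sol y)) (T n, X n))"
    by (rule ext) (rule sol_fixed_point[unfolded step_def])
  ultimately show ?thesis by argo
qed

text \<open>Since \<open>source r \<le> L * r\<close>, a mass bound \<open>B\<close> for one iterate
  yields \<open>B\<close> for the next, by the same weights \<open>exp (- (L * t))\<close> and
  \<open>1 - exp (- (L * t))\<close> as for the pointwise bound.\<close>

lemma iter_mass:
  assumes "0 < t"
  shows "(\<integral>\<^sup>+x. ennreal (iter k (t, x)) \<partial>lborel) \<le> ennreal (\<integral>x. g x \<partial>lborel)"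
  using assms
proof (induction k arbitrary: t)
  case (Suc k)
  define B where "B = (\<integral>x. g x \<partial>lborel)"
  have B: "0 \<le> B" unfolding B_def by (intro Bochner_Integration.integral_nonneg g_nonneg)
  have gB: "(\<integral>\<^sup>+x. ennreal (g x) \<partial>lborel) = ennreal B"
    unfolding B_def by (intro nn_integral_eq_integral g_int AE_I2 g_nonneg)
  let ?S = "\<lambda>y. source (iter k y)"
  note s = admissible_source[OF iter_admissible[of k]]
  have slice: "(\<lambda>x. F (t, x)) \<in> borel_measurable borel" if "F \<in> borel_measurable borel" for F :: "real \<times> 'a \<Rightarrow> real" and t
    by (intro borel_comp_continuous[OF that] continuous_intros)
  have nn: "0 \<le> initial_part L g z" "0 \<le> duhamel L ?S z" for z
    by (rule initial_part_le(1)[OF L_pos g_meas g_nonneg g_le], rule duhamel_source_nonneg[OF iter_admissible])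
  have "(\<integral>\<^sup>+x. ennreal (iter (Suc k) (t, x)) \<partial>lborel)
      = (\<integral>\<^sup>+x. ennreal (initial_part L g (t, x)) + ennreal (duhamel L ?S (t, x)) \<partial>lborel)"
    unfolding iter.simps step_def using nn by (intro nn_integral_cong ennreal_plus) auto
  also have "\<dots> = (\<integral>\<^sup>+x. ennreal (initial_part L g (t, x)) \<partial>lborel) + (\<integral>\<^sup>+x. ennreal (duhamel L ?S (t, x)) \<partial>lborel)"
    using slice[OF initial_part_measurable[OF g_meas]] slice[OF duhamel_measurable[OF L_pos s(1)]]
    by (intro nn_integral_add) simp_all
  also have "(\<integral>\<^sup>+x. ennreal (initial_part L g (t, x)) \<partial>lborel) = ennreal (exp (- (L * t))) * ennreal B"
  proof -
    have "(\<integral>\<^sup>+x. ennreal (initial_part L g (t, x)) \<partial>lborel) = (\<integral>\<^sup>+x. ennreal (exp (- (L * t))) * ennreal (heat_ext g t x) \<partial>lborel)"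
      using Suc.prems by (intro nn_integral_cong) (simp add: initial_part_def ennreal_mult heat_ext_nonneg g_nonneg)
    also have "\<dots> = ennreal (exp (- (L * t))) * (\<integral>\<^sup>+x. ennreal (heat_ext g t x) \<partial>lborel)"
      using borel_comp_continuous[OF heat_ext_measurable[OF g_meas], of "\<lambda>x. (t, x)"]
      by (intro nn_integral_cmult) (simp add: continuous_on_Pair)
    finally show ?thesis unfolding heat_ext_mass[OF g_meas g_nonneg g_le] gB .
  qed
  also have "(\<integral>\<^sup>+x. ennreal (duhamel L ?S (t, x)) \<partial>lborel) \<le> ennreal (L * B) * ennreal ((1 - exp (- (L * t))) / L)"
  proof (rule duhamel_mass[OF L_pos s(1,2,3,5)])
    fix r :: real assume r: "0 < r"
    have "(\<integral>\<^sup>+x. ennreal (source (iter k (r, x))) \<partial>lborel) \<le> (\<integral>\<^sup>+x. ennreal L * ennreal (iter k (r, x)) \<partial>lborel)"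
    proof (rule nn_integral_mono)
      fix x
      have "0 \<le> iter k (r, x)" by (rule admissibleD(2)[OF iter_admissible])
      then show "ennreal (source (iter k (r, x))) \<le> ennreal L * ennreal (iter k (r, x))"
        using source_le[of "iter k (r, x)"] L_pos by (simp add: ennreal_mult[symmetric] ennreal_leI)
    qed
    also have "\<dots> = ennreal L * (\<integral>\<^sup>+x. ennreal (iter k (r, x)) \<partial>lborel)"
      using slice[OF admissibleD(1)[OF iter_admissible], of k r] by (intro nn_integral_cmult) simp
    also have "\<dots> \<le> ennreal L * ennreal B" using Suc.IH[OF r] unfolding B_def by (rule mult_left_mono) simp
    finally show "(\<integral>\<^sup>+x. ennreal (source (iter k (r, x))) \<partial>lborel) \<le> ennreal (L * B)"
      using L_pos B by (simp add: ennreal_mult)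
  qed (assumption, rule less_imp_le[OF Suc.prems])
  also have "ennreal (exp (- (L * t))) * ennreal B + ennreal (L * B) * ennreal ((1 - exp (- (L * t))) / L) = ennreal B"
  proof -
    have "ennreal (L * B) * ennreal ((1 - exp (- (L * t))) / L) = ennreal (B * (1 - exp (- (L * t))))"
      using L_pos B Suc.prems by (subst ennreal_mult[symmetric]) auto
    moreover have "ennreal (exp (- (L * t))) * ennreal B = ennreal (exp (- (L * t)) * B)"
      using B by (simp add: ennreal_mult)
    moreover have "ennreal (exp (- (L * t)) * B) + ennreal (B * (1 - exp (- (L * t)))) = ennreal (exp (- (L * t)) * B + B * (1 - exp (- (L * t))))"
      using B L_pos Suc.prems by (intro ennreal_plus[symmetric] mult_nonneg_nonneg) auto
    ultimately show ?thesis by (simp add: algebra_simps)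
  qed
  finally show ?case unfolding B_def by (auto intro: add_left_mono)
qed simp

lemma sol_mass:
  assumes "0 < t"
  shows "(\<integral>\<^sup>+x. ennreal (sol (t, x)) \<partial>lborel) \<le> ennreal (\<integral>x. g x \<partial>lborel)"
proof -
  have m: "(\<lambda>x. iter k (t, x)) \<in> borel_measurable borel" for k
    by (intro borel_comp_continuous[OF admissibleD(1)[OF iter_admissible]] continuous_intros)
  have "(\<lambda>k. \<integral>\<^sup>+x. ennreal (iter k (t, x)) \<partial>lborel) \<longlonglongrightarrow> (\<integral>\<^sup>+x. ennreal (sol (t, x)) \<partial>lborel)"
  proof (rule nn_integral_LIMSEQ)
    show "incseq (\<lambda>k x. ennreal (iter k (t, x)))"
      by (intro incseq_SucI le_funI ennreal_leI iter_mono)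
    show "(\<lambda>k. ennreal (iter k (t, x))) \<longlonglongrightarrow> ennreal (sol (t, x))" for x
      by (intro tendsto_ennrealI iter_LIMSEQ)
  qed (use m in simp)
  then show ?thesis by (rule LIMSEQ_le_const2) (use iter_mass[OF assms] in auto)
qed

text \<open>Scheffe's lemma: almost everywhere convergence to \<open>g\<close> together with masses
  never exceeding that of \<open>g\<close> forces convergence in \<open>L^1\<close>.\<close>

lemma sol_bounded_L1: "bounded_L1_solution h g (\<lambda>t x. sol (t, x))"
  unfolding bounded_L1_solution_def
proof (intro conjI sol_weak)
  show "\<exists>M. \<forall>t>0. \<forall>x. sol (t, x) \<le> M" using admissibleD(3)[OF sol_admissible] by blast
  show "((\<lambda>t. \<integral>\<^sup>+x. ennreal \<bar>sol (t, x) - g x\<bar> \<partial>lborel) \<longlongrightarrow> 0) (at_right 0)"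
  proof (rule tendsto_at_right_sequentially[of 0 1])
    fix T :: "nat \<Rightarrow> real" assume T: "\<And>n. 0 < T n" "T \<longlonglongrightarrow> 0"
    have "(\<lambda>n. \<integral>\<^sup>+x. norm (sol (T n, x) - g x) \<partial>lborel) \<longlonglongrightarrow> 0"
    proof (rule Scheffe_lemma2[OF _ g_int])
      show "(\<lambda>x. sol (T n, x)) \<in> borel_measurable lborel" for n
        using borel_comp_continuous[OF admissibleD(1)[OF sol_admissible], of "\<lambda>x. (T n, x)"]
        by (simp add: continuous_on_Pair)
      show "AE x in lborel. (\<lambda>n. sol (T n, x)) \<longlonglongrightarrow> g x"
        using AE_not_in[OF N] by eventually_elim (intro sol_initial_limit T tendsto_const g_cont)
      fix n
      have "(\<integral>\<^sup>+x. norm (sol (T n, x)) \<partial>lborel) = (\<integral>\<^sup>+x. ennreal (sol (T n, x)) \<partial>lborel)"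
        using admissibleD(2)[OF sol_admissible] by (intro nn_integral_cong) simp
      also have "\<dots> \<le> ennreal (\<integral>x. g x \<partial>lborel)" by (rule sol_mass[OF T(1)])
      also have "\<dots> = (\<integral>\<^sup>+x. ennreal (g x) \<partial>lborel)"
        by (intro nn_integral_eq_integral[symmetric] g_int AE_I2 g_nonneg)
      also have "\<dots> = (\<integral>\<^sup>+x. norm (g x) \<partial>lborel)" using g_nonneg by simp
      finally show "(\<integral>\<^sup>+x. norm (sol (T n, x)) \<partial>lborel) \<le> (\<integral>\<^sup>+x. norm (g x) \<partial>lborel)" .
    qed
    then show "(\<lambda>n. \<integral>\<^sup>+x. ennreal \<bar>sol (T n, x) - g x\<bar> \<partial>lborel) \<longlonglongrightarrow> 0" by simp
  qed simp
qed

end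

section \<open>The minimal solution\<close>

text \<open>A common weakening of the two ways in which initial data are attained, so that truncated
  solutions and locally uniform ones can be compared with each other.\<close>

definition local_init :: "(real \<Rightarrow> 'a::euclidean_space \<Rightarrow> real) \<Rightarrow> ('a \<Rightarrow> real) \<Rightarrow> real \<Rightarrow> bool" where
  "local_init u a r \<longleftrightarrow> ((\<lambda>\<tau>. \<integral>\<^sup>+y\<in>cball 0 r. ennreal \<bar>u \<tau> y - a y\<bar> \<partial>lborel) \<longlongrightarrow> 0) (at_right 0)"

lemma bounded_L1_solution_local_init:
  assumes "bounded_L1_solution h a u" shows "local_init u a r"
  unfolding local_init_def
proof (rule tendsto_sandwich[OF always_eventually always_eventually tendsto_const])
  show "((\<lambda>t. \<integral>\<^sup>+x. ennreal \<bar>u t x - a x\<bar> \<partial>lborel) \<longlongrightarrow> 0) (at_right 0)"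
    using assms by (simp add: bounded_L1_solution_def)
  show "\<forall>\<tau>. (\<integral>\<^sup>+y\<in>cball 0 r. ennreal \<bar>u \<tau> y - a y\<bar> \<partial>lborel) \<le> (\<integral>\<^sup>+x. ennreal \<bar>u \<tau> x - a x\<bar> \<partial>lborel)"
    by (intro allI nn_integral_mono) (simp add: indicator_def)
qed simp

lemma is_solution_local_init:
  fixes u :: "real \<Rightarrow> 'a::euclidean_space \<Rightarrow> real"
  assumes "is_solution h g u" shows "local_init u g r"
  unfolding local_init_def
proof (rule order_tendstoI)
  \<comment> \<open>The added 1 keeps the divisor positive when the ball has measure 0.\<close>
  define V where "V = measure lborel (cball (0::'a) r) + 1"
  have V: "0 < V" by (simp add: V_def add_nonneg_pos)
  fix e :: ennreal assume "0 < e"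
  then obtain \<epsilon> where \<epsilon>: "0 < \<epsilon>" "ennreal \<epsilon> < e"
    using dense[of 0 e] by (metis ennreal_cases ennreal_less_zero_iff less_top_ennreal not_less_iff_gr_or_eq top.not_eq_extremum)
  have "0 < \<epsilon> / V" using \<epsilon> V by simp
  then obtain d where d: "0 < d" "\<And>t x. 0 < t \<Longrightarrow> t < d \<Longrightarrow> x \<in> cball 0 r \<Longrightarrow> \<bar>u t x - g x\<bar> < \<epsilon> / V"
    using assms unfolding is_solution_def by (metis compact_cball)
  have "\<forall>\<^sub>F \<tau> in at_right 0. \<tau> \<in> {0<..<d}" by (rule eventually_at_right_real[OF d(1)])
  then show "\<forall>\<^sub>F \<tau> in at_right 0. (\<integral>\<^sup>+y\<in>cball 0 r. ennreal \<bar>u \<tau> y - g y\<bar> \<partial>lborel) < e"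
  proof eventually_elim
    case (elim \<tau>)
    have "(\<integral>\<^sup>+y\<in>cball 0 r. ennreal \<bar>u \<tau> y - g y\<bar> \<partial>lborel) \<le> (\<integral>\<^sup>+y. ennreal (\<epsilon> / V) * indicator (cball (0::'a) r) y \<partial>lborel)"
    proof (rule nn_integral_mono)
      fix y :: 'a
      show "ennreal \<bar>u \<tau> y - g y\<bar> * indicator (cball 0 r) y \<le> ennreal (\<epsilon> / V) * indicator (cball 0 r) y"
        using d(2)[of \<tau> y] elim by (cases "y \<in> cball 0 r") (auto intro!: ennreal_leI less_imp_le)
    qed
    also have "\<dots> = ennreal (\<epsilon> / V) * emeasure lborel (cball (0::'a) r)" by (intro nn_integral_cmult_indicator) simp
    also have "\<dots> = ennreal (\<epsilon> / V * measure lborel (cball (0::'a) r))"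
    proof -
      have "emeasure lborel (cball (0::'a) r) \<noteq> top"
        using emeasure_lborel_cball_finite[of "0::'a" r] by auto
      then have "emeasure lborel (cball (0::'a) r) = ennreal (measure lborel (cball (0::'a) r))"
        by (rule emeasure_eq_ennreal_measure)
      then show ?thesis using \<epsilon> V by (subst ennreal_mult) auto
    qed
    also have "\<dots> \<le> ennreal \<epsilon>"
    proof (rule ennreal_leI)
      have "\<epsilon> / V * measure lborel (cball (0::'a) r) \<le> \<epsilon> / V * V"
        using \<epsilon> V by (intro mult_left_mono) (auto simp: V_def)
      then show "\<epsilon> / V * measure lborel (cball (0::'a) r) \<le> \<epsilon>" using V by simp
    qed
    finally show ?case using \<epsilon>(2) by (rule le_less_trans)
  qed
qed simp

lemma weak_sol_slice_measurable:
  fixes u :: "real \<Rightarrow> 'a::euclidean_space \<Rightarrow> real"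
  assumes "weak_sol h u" "0 < t" shows "u t \<in> borel_measurable borel"
proof -
  have "continuous_on UNIV (\<lambda>y::'a. (t, y))" by (intro continuous_on_Pair continuous_on_const continuous_on_id)
  moreover have "(\<lambda>y. (t, y)) ` UNIV \<subseteq> {0<..} \<times> (UNIV :: 'a set)" using assms(2) by auto
  moreover have "continuous_on ({0<..} \<times> UNIV) (\<lambda>(t, x). u t x)" using assms(1) by (simp add: weak_sol_def)
  ultimately have "continuous_on UNIV (\<lambda>y. case (t, y) of (t, x) \<Rightarrow> u t x)" by (rule continuous_on_compose2[rotated])
  then show ?thesis by (intro borel_measurable_continuous_onI) simp
qed

text \<open>Where \<open>a \<le> b\<close>, the difference \<open>u - v\<close> is at most
  \<open>\<bar>u - a\<bar> + \<bar>v - b\<bar>\<close>, and both integrals tend to 0. The conversion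
  of negative reals to 0 in \<open>ennreal\<close> takes the positive part.\<close>

lemma local_init_positive_part:
  fixes u v :: "real \<Rightarrow> 'a::euclidean_space \<Rightarrow> real"
  assumes u: "weak_sol h u" "local_init u a r" and v: "weak_sol h v" "local_init v b r"
    and a: "a \<in> borel_measurable borel" and b: "b \<in> borel_measurable borel"
    and le: "\<And>x. x \<in> cball 0 r \<Longrightarrow> a x \<le> b x"
  shows "((\<lambda>\<tau>. \<integral>\<^sup>+y\<in>cball 0 r. ennreal (u \<tau> y - v \<tau> y) \<partial>lborel) \<longlongrightarrow> 0) (at_right 0)"
proof (rule tendsto_sandwich[OF always_eventually _ tendsto_const])
  let ?I = "\<lambda>u a \<tau>. \<integral>\<^sup>+y\<in>cball 0 r. ennreal \<bar>u \<tau> y - a y\<bar> \<partial>lborel"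
  show "((\<lambda>\<tau>. ?I u a \<tau> + ?I v b \<tau>) \<longlongrightarrow> 0) (at_right 0)"
    using tendsto_add[OF u(2)[unfolded local_init_def] v(2)[unfolded local_init_def]] by simp
  show "\<forall>\<^sub>F \<tau> in at_right 0. (\<integral>\<^sup>+y\<in>cball 0 r. ennreal (u \<tau> y - v \<tau> y) \<partial>lborel) \<le> ?I u a \<tau> + ?I v b \<tau>"
    using eventually_at_right_less[of 0]
  proof eventually_elim
    case (elim \<tau>)
    have [measurable]: "cball (0::'a) r \<in> sets borel" by simp
    note [measurable] = a b weak_sol_slice_measurable[OF u(1) elim] weak_sol_slice_measurable[OF v(1) elim]
    have "(\<integral>\<^sup>+y\<in>cball 0 r. ennreal (u \<tau> y - v \<tau> y) \<partial>lborel)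
       \<le> (\<integral>\<^sup>+y. ennreal \<bar>u \<tau> y - a y\<bar> * indicator (cball 0 r) y + ennreal \<bar>v \<tau> y - b y\<bar> * indicator (cball 0 r) y \<partial>lborel)"
    proof (rule nn_integral_mono)
      fix y :: 'a
      show "ennreal (u \<tau> y - v \<tau> y) * indicator (cball 0 r) y
        \<le> ennreal \<bar>u \<tau> y - a y\<bar> * indicator (cball 0 r) y + ennreal \<bar>v \<tau> y - b y\<bar> * indicator (cball 0 r) y"
      proof (cases "y \<in> cball 0 r")
        case True
        have "u \<tau> y - v \<tau> y \<le> \<bar>u \<tau> y - a y\<bar> + \<bar>v \<tau> y - b y\<bar>" using le[OF True] by simp
        then have "ennreal (u \<tau> y - v \<tau> y) \<le> ennreal (\<bar>u \<tau> y - a y\<bar> + \<bar>v \<tau> y - b y\<bar>)" by (rule ennreal_leI)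
        then show ?thesis using True by simp
      qed simp
    qed
    also have "\<dots> = ?I u a \<tau> + ?I v b \<tau>" by (intro nn_integral_add) measurable
    finally show ?case .
  qed
qed simp

context keller_osserman
begin

lemma comparison_data:
  fixes u v :: "real \<Rightarrow> 'a::euclidean_space \<Rightarrow> real"
  assumes "weak_sol h u" "\<And>r. local_init u a r" "weak_sol h v" "\<And>r. local_init v b r"
    "a \<in> borel_measurable borel" "b \<in> borel_measurable borel" "\<And>x. a x \<le> b x" "0 < t"
  shows "u t x \<le> v t x"
  by (rule comparison[OF assms(1,3) local_init_positive_part[OF assms(1,2,3,4,5,6)] assms(8)]) (rule assms(7))

text \<open>The data need to be ordered only on a ball around the cube. This permits comparison with
  a solution whose datum is cut off further out, at the price of the barrier.\<close>

lemma comparison_data_up_to_barrier: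
  fixes u v :: "real \<Rightarrow> 'a::euclidean_space \<Rightarrow> real" and R :: real
  assumes "weak_sol h u" "\<And>r. local_init u a r" "weak_sol h v" "\<And>r. local_init v b r"
    "a \<in> borel_measurable borel" "b \<in> borel_measurable borel"
    "\<And>x. x \<in> cball 0 (R * DIM('a) + 1) \<Longrightarrow> a x \<le> b x" "0 < t" "0 < R" "x \<in> cube R"
  shows "u t x \<le> v t x + barrier R x"
  by (rule comparison_up_to_barrier[OF assms(1,3,9) local_init_positive_part[OF assms(1,2,3,4,5,6)] assms(8,10)]) (rule assms(7))

end

section \<open>Truncated data and the approximating solutions\<close>

definition truncation :: "('a::euclidean_space \<Rightarrow> real) \<Rightarrow> nat \<Rightarrow> 'a \<Rightarrow> real" where
  "truncation g n x = (if x \<in> ball 0 (real n) then g x else 0)"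

locale initial_value_problem = keller_osserman h for h :: "real \<Rightarrow> real" +
  fixes g :: "'a::euclidean_space \<Rightarrow> real"
  assumes g_cont: "continuous_on UNIV g" and g_nonneg: "\<And>x. 0 \<le> g x"
begin

lemma g_measurable: "g \<in> borel_measurable borel"
  by (rule borel_measurable_continuous_onI[OF g_cont])

lemma truncation_measurable: "truncation g n \<in> borel_measurable borel"
proof -
  have [measurable]: "ball (0::'a) (real n) \<in> sets borel" by simp
  note [measurable] = g_measurable
  show ?thesis unfolding truncation_def[abs_def] by measurable
qed

lemma truncation_isCont:
  assumes "norm x \<noteq> real n" shows "isCont (truncation g n) x"
proof (cases "norm x < real n")
  case True
  have "continuous_on (ball 0 (real n)) (truncation g n)"
    by (rule continuous_on_eq[OF continuous_on_subset[OF g_cont]]) (auto simp: truncation_def)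
  then show ?thesis using True by (simp add: continuous_on_eq_continuous_at)
next
  case False
  have "continuous_on (- cball 0 (real n)) (truncation g n)"
    by (rule continuous_on_eq[OF continuous_on_const[of _ 0]]) (auto simp: truncation_def)
  moreover have "x \<in> - cball 0 (real n)" using False assms by simp
  ultimately show ?thesis using continuous_on_eq_continuous_at[of "- cball 0 (real n)"] open_Compl[OF closed_cball] by blast
qed

lemma truncated_datum:
  obtains M where "bounded_datum h (truncation g n) M (sphere 0 (real n))"
proof -
  have "bounded (g ` cball 0 (real n))"
    by (intro compact_imp_bounded compact_continuous_image continuous_on_subset[OF g_cont]) auto
  then obtain C where C: "\<And>x. x \<in> cball 0 (real n) \<Longrightarrow> \<bar>g x\<bar> \<le> C"
    unfolding bounded_iff real_norm_def by blast
  have C0: "0 \<le> C" using C[of 0] by simp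
  have le: "truncation g n x \<le> C" for x
    using C[of x] C0 by (auto simp: truncation_def)
  have nn: "0 \<le> truncation g n x" for x using g_nonneg by (simp add: truncation_def)
  have int: "integrable lborel (truncation g n)"
  proof (rule Bochner_Integration.integrable_bound)
    show "integrable lborel (\<lambda>x::'a. C * indicator (ball 0 (real n)) x)"
      by (intro integrable_mult_right integrable_real_indicator emeasure_lborel_ball_finite) simp
    show "truncation g n \<in> borel_measurable lborel" using truncation_measurable by simp
    show "AE x in lborel. norm (truncation g n x) \<le> norm (C * indicator (ball 0 (real n)) x)"
    proof (rule AE_I2)
      fix x show "norm (truncation g n x) \<le> norm (C * indicator (ball 0 (real n)) x)"
        using le[of x] nn[of x] C0 by (cases "x \<in> ball 0 (real n)") (simp_all add: truncation_def)
    qed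
  qed
  have null: "sphere 0 (real n) \<in> null_sets (lborel :: 'a measure)"
    using negligible_sphere[of "0::'a" "real n"]
    by (simp add: negligible_iff_null_sets null_sets_completion_iff)
  have "bounded_datum h (truncation g n) C (sphere 0 (real n))"
    by (unfold_locales; (rule truncation_measurable int nn le null)?) (auto intro: truncation_isCont)
  with that show thesis .
qed

text \<open>Comparison in both directions settles positive times; the normalisation at nonpositive
  times makes the two functions equal everywhere, as the definite description in \<open>u_gn\<close>
  requires.\<close>

lemma u_gn_unique:
  assumes "bounded_L1_solution h (truncation g n) u" "\<And>t x. t \<le> 0 \<Longrightarrow> u t x = 0"
    and "bounded_L1_solution h (truncation g n) v" "\<And>t x. t \<le> 0 \<Longrightarrow> v t x = 0"
  shows "u = v"
proof (intro ext)
  fix t x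
  have *: "u t x \<le> v t x" if "0 < t" "bounded_L1_solution h (truncation g n) u" "bounded_L1_solution h (truncation g n) v" for u v
  proof (rule comparison_data[OF _ bounded_L1_solution_local_init[OF that(2)] _ bounded_L1_solution_local_init[OF that(3)]
        truncation_measurable truncation_measurable order_refl that(1)])
    show "weak_sol h u" "weak_sol h v" using that(2,3) by (simp_all add: bounded_L1_solution_def)
  qed
  show "u t x = v t x"
  proof (cases "0 < t")
    case True
    show ?thesis by (rule order_antisym[OF *[OF True assms(1,3)] *[OF True assms(3,1)]])
  next
    case False
    then show ?thesis using assms(2)[of t x] assms(4)[of t x] by simp
  qed
qed

text \<open>The definite description is identified with the solution built by iteration. The limit
  along arbitrary sequences of points is extracted here, since it is a property of the constructed
  solution that \<open>L^1\<close> convergence alone does not give.\<close>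

lemma u_gn_properties:
  shows u_gn_bounded_L1: "bounded_L1_solution h (truncation g n) (u_gn h g n)"
    and u_gn_initial_limit: "\<And>T X x. (\<And>k. 0 < T k) \<Longrightarrow> T \<longlonglongrightarrow> 0 \<Longrightarrow> X \<longlonglongrightarrow> x \<Longrightarrow> norm x < real n
      \<Longrightarrow> (\<lambda>k. u_gn h g n (T k) (X k)) \<longlonglongrightarrow> g x"
proof -
  obtain M where "bounded_datum h (truncation g n) M (sphere 0 (real n))" by (rule truncated_datum)
  then interpret D: bounded_datum h "truncation g n" M "sphere 0 (real n)" .
  let ?u = "\<lambda>t x. D.sol (t, x)"
  have zero: "t \<le> 0 \<Longrightarrow> ?u t x = 0" for t x using D.admissibleD(4)[OF D.sol_admissible, of "(t, x)"] by simp
  have "u_gn h g n = ?u"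
    unfolding u_gn_def truncation_def[symmetric, abs_def]
    by (rule the_equality) (use D.sol_bounded_L1 zero u_gn_unique[OF _ _ D.sol_bounded_L1 zero] in blast)+
  then show "bounded_L1_solution h (truncation g n) (u_gn h g n)" using D.sol_bounded_L1 by simp
  fix T :: "nat \<Rightarrow> real" and X and x :: 'a
  assume lim: "\<And>k. 0 < T k" "T \<longlonglongrightarrow> 0" "X \<longlonglongrightarrow> x" and x: "norm x < real n"
  have "isCont (truncation g n) x" using x by (intro truncation_isCont) simp
  from D.sol_initial_limit[OF lim this] show "(\<lambda>k. u_gn h g n (T k) (X k)) \<longlonglongrightarrow> g x"
    using x \<open>u_gn h g n = ?u\<close> by (simp add: truncation_def)
qed

lemma u_gn_weak_sol: "weak_sol h (u_gn h g n)"
  using u_gn_bounded_L1 by (simp add: bounded_L1_solution_def)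

lemma u_gn_local_init: "local_init (u_gn h g n) (truncation g n) r"
  by (rule bounded_L1_solution_local_init[OF u_gn_bounded_L1])

lemma u_gn_mono:
  assumes "n \<le> m" "0 < t" shows "u_gn h g n t x \<le> u_gn h g m t x"
  by (rule comparison_data[OF u_gn_weak_sol u_gn_local_init u_gn_weak_sol u_gn_local_init truncation_measurable truncation_measurable _ assms(2)])
    (use assms(1) g_nonneg in \<open>auto simp: truncation_def\<close>)

text \<open>The ball required by the comparison lies inside \<open>ball 0 n\<close>, where the
  truncation agrees with \<open>g\<close>. Taking for \<open>u\<close> a solution with a larger
  truncation, the estimate bounds the whole sequence by one of its members.\<close>

lemma u_gn_upper:
  fixes R :: real
  assumes u: "weak_sol h u" "\<And>r. local_init u a r" "a \<in> borel_measurable borel" "\<And>x. a x \<le> g x"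
    and R: "0 < R" "R * DIM('a) + 1 < real n" and t: "0 < t" and x: "x \<in> cube R"
  shows "u t x \<le> u_gn h g n t x + barrier R x"
  by (rule comparison_data_up_to_barrier[OF u(1,2) u_gn_weak_sol u_gn_local_init u(3) truncation_measurable _ t R(1) x])
    (use R(2) u(4) in \<open>auto simp: truncation_def\<close>)

section \<open>Passage to the limit in the truncation\<close>

lemma truncation_le: "truncation g n x \<le> g x"
  using g_nonneg by (simp add: truncation_def)

text \<open>Monotonicity needs an upper bound at each point; a fixed approximation plus the barrier
  of a cube around \<open>x\<close> provides it, so the \<open>lim\<close> in
  \<open>prospective_min\<close> is a genuine limit.\<close>

lemma prospective_min_LIMSEQ:
  assumes t: "0 < t"
  shows "(\<lambda>n. u_gn h g n t x) \<longlonglongrightarrow> prospective_min h g t x"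
proof -
  obtain R0 where R0: "\<And>R y::'a. R0 \<le> R \<Longrightarrow> norm y \<le> norm x \<Longrightarrow> y \<in> cube R \<and> barrier R y < 1"
    using barrier_decay[of 1 "norm x"] by (metis zero_less_one)
  define R where "R = max R0 1"
  have R: "0 < R" "x \<in> cube R" using R0[of R x] by (auto simp: R_def)
  obtain m where m: "R * DIM('a) + 1 < real m" using reals_Archimedean2 by blast
  have "\<forall>n. u_gn h g n t x \<le> u_gn h g m t x + barrier R x"
    by (intro allI u_gn_upper[OF u_gn_weak_sol u_gn_local_init truncation_measurable truncation_le R(1) m t R(2)])
  moreover have "incseq (\<lambda>n. u_gn h g n t x)" using u_gn_mono[OF _ t] by (simp add: incseq_def)
  ultimately obtain l where "(\<lambda>n. u_gn h g n t x) \<longlonglongrightarrow> l" using incseq_convergent by blast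
  then show ?thesis unfolding prospective_min_def by (simp add: limI)
qed

lemma u_gn_le_prospective_min: "0 < t \<Longrightarrow> u_gn h g n t x \<le> prospective_min h g t x"
  using u_gn_mono by (intro incseq_le[OF _ prospective_min_LIMSEQ]) (auto simp: incseq_def)

lemma prospective_min_le_u_gn:
  fixes R :: real
  assumes "0 < R" "R * DIM('a) + 1 < real n" "0 < t" "x \<in> cube R"
  shows "prospective_min h g t x \<le> u_gn h g n t x + barrier R x"
  by (rule LIMSEQ_le_const2[OF prospective_min_LIMSEQ[OF assms(3)]])
    (use u_gn_upper[OF u_gn_weak_sol u_gn_local_init truncation_measurable truncation_le assms] in blast)

text \<open>The error is at most the barrier of a large cube, which does not depend on time. Hence
  the convergence is uniform for all positive times, including those near 0.\<close>

lemma u_gn_close: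
  assumes e: "0 < e"
  obtains n0 where "\<And>n t x. n0 \<le> n \<Longrightarrow> 0 < t \<Longrightarrow> norm x \<le> r \<Longrightarrow>
    \<bar>prospective_min h g t x - u_gn h g n t x\<bar> < e \<and> norm x < real n"
proof -
  obtain R0 where R0: "\<And>R y::'a. R0 \<le> R \<Longrightarrow> norm y \<le> r \<Longrightarrow> y \<in> cube R \<and> barrier R y < e"
    using barrier_decay[OF e, of r] by metis
  define R where "R = max R0 1"
  have R: "0 < R" "\<And>y::'a. norm y \<le> r \<Longrightarrow> y \<in> cube R \<and> barrier R y < e" using R0[of R] by (auto simp: R_def)
  obtain n0 where n0: "max (R * DIM('a) + 1) r < real n0" using reals_Archimedean2 by blast
  show thesis
  proof (rule that[of n0])
    fix n and t :: real and x :: 'a assume n: "n0 \<le> n" and t: "0 < t" and x: "norm x \<le> r"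
    have "R * DIM('a) + 1 < real n" "r < real n" using n0 n by (auto intro: less_le_trans)
    then show "\<bar>prospective_min h g t x - u_gn h g n t x\<bar> < e \<and> norm x < real n"
      using prospective_min_le_u_gn[OF R(1) _ t, of n x] u_gn_le_prospective_min[OF t, of n x] R(2)[OF x] x by auto
  qed
qed

lemma prospective_min_cont: "continuous_on ({0<..} \<times> UNIV) (\<lambda>(t, x). prospective_min h g t x)"
proof -
  have cont: "continuous_on ({0<..} \<times> ball 0 r) (\<lambda>(t, x). prospective_min h g t x)" for r
  proof (rule uniform_limit_theorem)
    show "\<forall>\<^sub>F n in sequentially. continuous_on ({0<..} \<times> ball 0 r) (\<lambda>(t, x). u_gn h g n t x)"
      using u_gn_weak_sol unfolding weak_sol_def by (intro always_eventually allI) (blast intro: continuous_on_subset)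
    show "uniform_limit ({0<..} \<times> ball 0 r) (\<lambda>n (t, x). u_gn h g n t x) (\<lambda>(t, x). prospective_min h g t x) sequentially"
    proof (rule uniform_limitI)
      fix e :: real assume "0 < e"
      then obtain n0 where n0: "\<And>n t x. n0 \<le> n \<Longrightarrow> 0 < t \<Longrightarrow> norm x \<le> r \<Longrightarrow>
        \<bar>prospective_min h g t x - u_gn h g n t x\<bar> < e \<and> norm x < real n"
        using u_gn_close by blast
      show "\<forall>\<^sub>F n in sequentially. \<forall>z\<in>{0<..} \<times> ball 0 r. dist (case z of (t, x) \<Rightarrow> u_gn h g n t x) (case z of (t, x) \<Rightarrow> prospective_min h g t x) < e"
        using eventually_ge_at_top[of n0]
      proof eventually_elim
        case (elim n)
        show ?case using n0[OF elim] by (auto simp: dist_real_def abs_minus_commute less_imp_le)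
      qed
    qed
  qed simp
  have op: "open ({0<..} \<times> ball 0 r :: (real \<times> 'a) set)" for r by (intro open_Times) auto
  have "isCont (\<lambda>(t, x). prospective_min h g t x) z" if z: "z \<in> {0<..} \<times> UNIV" for z :: "real \<times> 'a"
  proof -
    have "\<forall>y\<in>{0<..} \<times> ball 0 (norm (snd z) + 1). isCont (\<lambda>(t, x). prospective_min h g t x) y"
      by (rule continuous_on_eq_continuous_at[OF op, THEN iffD1, OF cont])
    then show ?thesis by (rule bspec) (use z in \<open>auto simp: mem_Times_iff\<close>)
  qed
  then show ?thesis by (simp add: continuous_at_imp_continuous_on)
qed

lemma prospective_min_nonneg: "0 < t \<Longrightarrow> 0 \<le> prospective_min h g t x"
  using u_gn_le_prospective_min[of t 0 x] u_gn_weak_sol[of 0] unfolding weak_sol_def by (meson order_trans)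

text \<open>On the compact support of a test function the approximations lie between 0 and their
  continuous, hence bounded, limit; dominated convergence then passes to the limit in the weak
  equation.\<close>

lemma prospective_min_weak_sol: "weak_sol h (prospective_min h g)"
  unfolding weak_sol_def
proof (intro conjI allI impI prospective_min_cont prospective_min_nonneg)
  fix \<phi> D D2 assume t: "test_fun (\<phi> :: real \<times> 'a \<Rightarrow> real) D D2"
  define U where "U z = prospective_min h g (fst z) (snd z)" for z
  define v where "v n z = u_gn h g n (fst z) (snd z)" for n z
  \<comment> \<open>With zero-order coefficient 0 this is the operator acting on the test function
    in \<open>weak_sol\<close>.\<close>
  let ?\<psi> = "test_rhs 0 \<phi> D D2"
  obtain K where K: "compact K" "K \<subseteq> {z. 0 < fst z}" and
    supp: "\<And>z. z \<notin> K \<Longrightarrow> \<phi> z = 0" "\<And>z. z \<notin> K \<Longrightarrow> D z = 0" "\<And>z. z \<notin> K \<Longrightarrow> D2 z = 0"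
    using test_fun_support[OF t] by metis
  have \<psi>0: "?\<psi> z = 0" if "z \<notin> K" for z using supp[OF that] by (simp add: test_rhs_def dt_test_def lap_test_def)
  obtain C where C: "\<And>z. \<bar>?\<psi> z\<bar> \<le> C" "\<And>z. \<bar>\<phi> z\<bar> \<le> C" using test_rhs_properties(2)[OF t] by metis
  obtain A B where AB: "K \<subseteq> cbox A B" using bounded_subset_cbox_symmetric compact_imp_bounded[OF K(1)] by metis
  have "continuous_on K U"
  proof -
    have "K \<subseteq> {0<..} \<times> UNIV" using K(2) by auto
    from continuous_on_subset[OF prospective_min_cont this] show ?thesis by (simp add: U_def[abs_def] split_beta')
  qed
  then have "bounded (U ` K)" by (intro compact_imp_bounded compact_continuous_image K(1))
  then obtain c' where "\<And>z. z \<in> K \<Longrightarrow> \<bar>U z\<bar> \<le> c'" unfolding bounded_iff real_norm_def by blast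
  then have c: "\<bar>U z\<bar> \<le> \<bar>c'\<bar>" if "z \<in> K" for z using that abs_ge_self order_trans by blast
  define c where "c = \<bar>c'\<bar>"
  note c = c[folded c_def]
  have c0: "0 \<le> c" by (simp add: c_def)
  have v: "0 \<le> v n z" "v n z \<le> U z" "(\<lambda>n. v n z) \<longlonglongrightarrow> U z" if "z \<in> K" for n z
  proof -
    have z: "0 < fst z" using that K by auto
    show "0 \<le> v n z" using u_gn_weak_sol z by (simp add: v_def weak_sol_def)
    show "v n z \<le> U z" unfolding v_def U_def by (rule u_gn_le_prospective_min[OF z])
    show "(\<lambda>n. v n z) \<longlonglongrightarrow> U z" unfolding v_def U_def by (rule prospective_min_LIMSEQ[OF z])
  qed
  \<comment> \<open>Extending \<open>f\<close> constantly to the left makes it continuous on the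
    whole line, so limits may be taken at the value 0 as well; on \<open>K\<close> all values are
    nonnegative and nothing changes.\<close>
  define G where "G r = f (max 0 r)" for r :: real
  have G_cont: "continuous_on UNIV G"
    unfolding G_def by (rule continuous_on_compose2[OF f_cont]) (auto intro!: continuous_intros)
  define E where "E w z = w z * ?\<psi> z + G (w z) * \<phi> z" for w :: "real \<times> 'a \<Rightarrow> real" and z
  have E_eq: "E w = (\<lambda>(t, x). w (t, x) * (- dt_test D (t, x) - lap_test D2 (t, x)) + w (t, x) * h (w (t, x)) * \<phi> (t, x))"
    if "\<And>z. z \<in> K \<Longrightarrow> 0 \<le> w z" for w
  proof
    fix z :: "real \<times> 'a"
    show "E w z = (case z of (t, x) \<Rightarrow> w (t, x) * (- dt_test D (t, x) - lap_test D2 (t, x)) + w (t, x) * h (w (t, x)) * \<phi> (t, x))"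
    proof (cases "z \<in> K")
      case True
      then show ?thesis using that[OF True] by (cases z) (simp add: E_def test_rhs_def G_def f_def)
    next
      case False
      then show ?thesis using supp[OF False] \<psi>0[OF False] by (cases z) (simp add: E_def test_rhs_def dt_test_def lap_test_def)
    qed
  qed
  have "(E U has_integral 0) UNIV"
  proof (rule has_integral_dominated_convergence)
    show "(E (v n) has_integral 0) UNIV" for n
      using u_gn_weak_sol[of n] t v(1) by (subst E_eq) (auto simp: weak_sol_def v_def)
    show "(\<lambda>z. if z \<in> cbox A B then c * C + f c * C else 0) integrable_on UNIV"
      unfolding integrable_restrict_UNIV by (rule integrable_const)
    have "norm (E (v n) z) \<le> (if z \<in> cbox A B then c * C + f c * C else 0)" for n z
    proof (cases "z \<in> K")
      case True
      have vc: "0 \<le> v n z" "v n z \<le> c" using v(1,2)[OF True, of n] c[OF True] by auto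
      have "norm (E (v n) z) \<le> \<bar>v n z\<bar> * \<bar>?\<psi> z\<bar> + \<bar>G (v n z)\<bar> * \<bar>\<phi> z\<bar>"
        unfolding E_def real_norm_def abs_mult[symmetric] by (rule abs_triangle_ineq)
      also have "\<dots> \<le> c * C + f c * C"
      proof (intro add_mono mult_mono C)
        show "\<bar>G (v n z)\<bar> \<le> f c" using vc f_mono[OF vc] f_nonneg[OF vc(1)] by (simp add: G_def)
        show "0 \<le> f c" using vc by (intro f_nonneg) simp
      qed (use vc in auto)
      finally show ?thesis using True AB by auto
    next
      case False
      have "0 \<le> C" using C(2)[of z] by (meson abs_ge_zero order_trans)
      then have "0 \<le> c * C + f c * C" using c0 f_nonneg[OF c0] by simp
      then show ?thesis using supp(1)[OF False] \<psi>0[OF False] by (simp add: E_def)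
    qed
    then show "\<forall>z\<in>UNIV. norm (E (v n) z) \<le> (if z \<in> cbox A B then c * C + f c * C else 0)" for n
      by blast
    show "\<forall>z\<in>UNIV. (\<lambda>n. E (v n) z) \<longlonglongrightarrow> E U z"
    proof
      fix z
      show "(\<lambda>n. E (v n) z) \<longlonglongrightarrow> E U z"
      proof (cases "z \<in> K")
        case True
        have "isCont G (U z)" using G_cont continuous_on_eq_continuous_at[OF open_UNIV] by blast
        from isCont_tendsto_compose[OF this v(3)[OF True]]
        show ?thesis unfolding E_def by (intro tendsto_add tendsto_mult tendsto_const v(3)[OF True])
      next
        case False
        then show ?thesis using supp(1)[OF False] \<psi>0[OF False] by (simp add: E_def)
      qed
    qed
  qed simp
  moreover have "0 \<le> U z" if "z \<in> K" for z using v(1,2)[OF that, of 0] by simp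
  ultimately show "((\<lambda>(t, x). prospective_min h g t x * (- dt_test D (t, x) - lap_test D2 (t, x))
      + prospective_min h g t x * h (prospective_min h g t x) * \<phi> (t, x)) has_integral 0) UNIV"
    by (subst (asm) E_eq) (simp_all add: U_def)
qed

text \<open>Compactness turns convergence along arbitrary sequences of points into uniform
  convergence: offending times and points would have a subsequence converging to a point of
  \<open>K\<close>, where both the solution and \<open>g\<close> tend to the same value.\<close>

lemma u_gn_initial_uniform:
  assumes K: "compact K" "\<And>x. x \<in> K \<Longrightarrow> norm x < real n" and e: "0 < e"
  shows "\<exists>d>0. \<forall>t. 0 < t \<and> t < d \<longrightarrow> (\<forall>x\<in>K. \<bar>u_gn h g n t x - g x\<bar> < e)"
proof (rule ccontr)
  assume "\<not> ?thesis"
  then have "\<exists>t x. 0 < t \<and> t < d \<and> x \<in> K \<and> e \<le> \<bar>u_gn h g n t x - g x\<bar>" if "0 < d" for d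
    using that by (meson not_le)
  then have "\<exists>t x. 0 < t \<and> t < 1 / real (Suc k) \<and> x \<in> K \<and> e \<le> \<bar>u_gn h g n t x - g x\<bar>" for k by simp
  then obtain T X where TX: "\<And>k. 0 < T k" "\<And>k. T k < 1 / real (Suc k)" "\<And>k. X k \<in> K"
    "\<And>k. e \<le> \<bar>u_gn h g n (T k) (X k) - g (X k)\<bar>" by metis
  obtain x \<sigma> where x: "x \<in> K" "strict_mono \<sigma>" "(X \<circ> \<sigma>) \<longlonglongrightarrow> x"
    using K(1) TX(3) unfolding compact_def by blast
  have "T \<longlonglongrightarrow> 0"
    by (rule tendsto_sandwich[OF always_eventually always_eventually tendsto_const LIMSEQ_inverse_real_of_nat])
      (use TX(1,2) in \<open>auto simp: less_imp_le inverse_eq_divide\<close>)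
  then have T: "(\<lambda>k. T (\<sigma> k)) \<longlonglongrightarrow> 0" using LIMSEQ_subseq_LIMSEQ[OF _ x(2)] by (force simp: o_def)
  have X: "(\<lambda>k. X (\<sigma> k)) \<longlonglongrightarrow> x" using x(3) by (simp add: o_def)
  have "(\<lambda>k. u_gn h g n (T (\<sigma> k)) (X (\<sigma> k))) \<longlonglongrightarrow> g x"
    by (rule u_gn_initial_limit[OF TX(1) T X K(2)[OF x(1)]])
  moreover have "isCont g x" using g_cont continuous_on_eq_continuous_at[OF open_UNIV] by blast
  then have "(\<lambda>k. g (X (\<sigma> k))) \<longlonglongrightarrow> g x" using X by (rule isCont_tendsto_compose)
  ultimately have "(\<lambda>k. \<bar>u_gn h g n (T (\<sigma> k)) (X (\<sigma> k)) - g (X (\<sigma> k))\<bar>) \<longlonglongrightarrow> \<bar>g x - g x\<bar>"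
    by (intro tendsto_rabs tendsto_diff)
  then have "e \<le> \<bar>g x - g x\<bar>" by (rule LIMSEQ_le_const) (use TX(4) in auto)
  then show False using e by simp
qed

text \<open>A single approximation is fixed first, close to the limit uniformly in time; then its
  own initial convergence on \<open>K\<close> is used. This order is possible because the closeness
  does not deteriorate as time tends to 0.\<close>

lemma prospective_min_is_solution: "is_solution h g (prospective_min h g)"
  unfolding is_solution_def
proof (intro conjI prospective_min_weak_sol allI impI)
  fix K :: "'a set" and e :: real assume K: "compact K" and e: "0 < e"
  obtain r where r: "\<And>x. x \<in> K \<Longrightarrow> norm x \<le> r" using compact_imp_bounded[OF K] unfolding bounded_iff by blast
  obtain n where n: "\<And>t x. 0 < t \<Longrightarrow> norm x \<le> r \<Longrightarrow> \<bar>prospective_min h g t x - u_gn h g n t x\<bar> < e / 2 \<and> norm x < real n"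
    using u_gn_close[of "e / 2" r] e by (metis half_gt_zero order_refl)
  have "norm x < real n" if "x \<in> K" for x using n[of 1 x] r[OF that] by simp
  then obtain d where d: "0 < d" "\<And>t x. 0 < t \<Longrightarrow> t < d \<Longrightarrow> x \<in> K \<Longrightarrow> \<bar>u_gn h g n t x - g x\<bar> < e / 2"
    using u_gn_initial_uniform[OF K, of n "e / 2"] e by (metis half_gt_zero)
  have "\<bar>prospective_min h g t x - g x\<bar> < e" if "0 < t" "t < d" "x \<in> K" for t x
    using n[OF that(1) r[OF that(3)]] d(2)[OF that] by linarith
  with d(1) show "\<exists>d>0. \<forall>t. 0 < t \<and> t < d \<longrightarrow> (\<forall>x\<in>K. \<bar>prospective_min h g t x - g x\<bar> < e)" by blast
qed

lemma solution_ge_prospective_min: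
  assumes u: "is_solution h g u" and t: "0 < t"
  shows "prospective_min h g t x \<le> u t x"
proof (rule LIMSEQ_le_const2[OF prospective_min_LIMSEQ[OF t]])
  have "weak_sol h u" using u by (simp add: is_solution_def)
  then have "u_gn h g n t x \<le> u t x" for n
    by (intro comparison_data[OF u_gn_weak_sol u_gn_local_init _ is_solution_local_init[OF u] truncation_measurable g_measurable truncation_le t])
  then show "\<exists>N. \<forall>n\<ge>N. u_gn h g n t x \<le> u t x" by blast
qed

lemma solution_le_prospective_min:
  assumes u: "is_solution h g u" and t: "0 < t"
  shows "u t x \<le> prospective_min h g t x"
proof -
  have "weak_sol h u" using u by (simp add: is_solution_def)
  then show ?thesis
    using prospective_min_is_solution
    by (intro comparison_data[OF _ is_solution_local_init[OF u] prospective_min_weak_sol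
      is_solution_local_init[OF prospective_min_is_solution] g_measurable g_measurable order_refl t])
qed

end

theorem theoremA:
  fixes h :: "real \<Rightarrow> real" and g :: "'a::euclidean_space \<Rightarrow> real"
  assumes h_cont: "continuous_on {0..} h"
    and h_nonneg: "\<forall>s\<ge>0. h s \<ge> 0"
    and h_mono: "mono_on {0..} h"
    and h_zero: "\<forall>s\<ge>0. h s = 0 \<longleftrightarrow> s = 0"
    and h_convex: "convex_on {0..} (\<lambda>r. r * h r)"
    and KO: "\<exists>a>0. set_integrable lborel {a..} (\<lambda>s. 1 / sqrt (Hprim h s))"
    and g_cont: "continuous_on UNIV g"
    and g_nonneg: "\<forall>x. g x \<ge> 0"
  shows "is_solution h g (prospective_min h g)
         \<and> (\<forall>u. is_solution h g u \<longrightarrow> (\<forall>t>0. \<forall>x. prospective_min h g t x \<le> u t x))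
         \<and> (\<forall>u. is_solution h g u \<longrightarrow> (\<forall>t>0. \<forall>x. u t x = prospective_min h g t x))"
proof -
  interpret initial_value_problem h g
    using assms by unfold_locales auto
  show ?thesis
    using prospective_min_is_solution solution_ge_prospective_min solution_le_prospective_min
    by (blast intro: order_antisym)
qed

end
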